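(* Let $(M,\varphi)$ be a $G_2$-manifold and write $\psi=\star\varphi$. Then the following hold, where all isomorphisms are isomorphisms of real vector spaces. (i) The quotients $\widetilde{\Omega}^1_R(TM)$ and $\widetilde{\Omega}^2_{cR}(TM)$ are quotients by the zero subspace, i.e. $\widetilde{\Omega}^1_R(TM)=\Omega^1_R(TM)$ and $\widetilde{\Omega}^2_{cR}(TM)=\Omega^2_{cR}(TM)$. Sending a multivector field $Q$ to the class modulo closed $1$-forms of a $1$-form $\alpha$ with $Q\lrcorner\varphi=d\alpha$ (respectively $Q\lrcorner\psi=d\alpha$) gives isomorphisms $$\widetilde{\Omega}^1_R(TM)\cong\widetilde{\Omega}^1_R(T^*M),\qquad \widetilde{\Omega}^2_{cR}(TM)\cong\widetilde{\Omega}^1_{cR}(T^*M).$$ Moreover $\widetilde{\Omega}^1_R(T^*M)\subseteq\widetilde{\Omega}^1_{cR}(T^*M)=\Omega^1(T^*M)/Z^1(M)$, and through these identifications there is an injective linear map $\Omega^1_R(TM)\hookrightarrow\Omega^2_{cR}(TM)$, sending a Rochesterian vector field $X$ with $X\lrcorner\varphi=d\alpha$ to the unique $2$-multivector field $U$ with $U\lrcorner\psi=d\alpha$. (ii) $\widetilde{\Omega}^0_R(T^*M)=\widetilde{\Omega}^0_{cR}(T^*M)=C^\infty(M)/\{f:M\to\mathbb{R}\mid f\text{ locally constant}\}$, and sending $Q$ to the class of a function $f$ with $Q\lrcorner\varphi=df$ (respectively $Q\lrcorner\psi=df$) gives isomorphisms $$\widetilde{\Omega}^2_R(TM)\cong\widetilde{\Omega}^0_R(T^*M),\qquad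 \widetilde{\Omega}^3_{cR}(TM)\cong\widetilde{\Omega}^0_{cR}(T^*M);$$ in particular $\widetilde{\Omega}^2_R(TM)\cong\widetilde{\Omega}^3_{cR}(TM)$. (iii) $\widetilde{\Omega}^1_{cR}(TM)=\Omega^1_{cR}(TM)$ (the quotient is by the zero subspace), and sending $X$ to the class modulo closed $2$-forms of a $2$-form $\alpha$ with $X\lrcorner\psi=d\alpha$ gives an isomorphism $\Omega^1_{cR}(TM)\cong\widetilde{\Omega}^2_{cR}(T^*M)$.
   Context: A $G_2$-structure on a smooth $7$-manifold $M$ is a smooth $3$-form $\varphi$ such that for every $p\in M$ the pair $(T_pM,\varphi_p)$ is isomorphic to $(\mathbb{R}^7,\varphi_0)$, where $$\varphi_0=dx^{123}+dx^{145}+dx^{167}+dx^{246}-dx^{257}-dx^{347}-dx^{356},\quad dx^{ijk}=dx^i\wedge dx^j\wedge dx^k.$$ It determines an orientation, a Riemannian metric $g_\varphi$ and its volume form $\mathrm{Vol}_\varphi$, characterized by $(X\lrcorner\varphi)\wedge(Y\lrcorner\varphi)\wedge\varphi=6g_\varphi(X,Y)\mathrm{Vol}_\varphi$ for all vector fields $X,Y$; $\star$ denotes the Hodge star of $g_\varphi$. $(M,\varphi)$ is a $G_2$-manifold if $\varphi$ is parallel for the Levi-Civita connection of $g_\varphi$ (equivalently $d\varphi=0$ and $d\star\varphi=0$). $\Omega^l(TM)$ denotes smooth $l$-multivector fields (sections of $\Lambda^l TM$) and $\Omega^l(T^*M)$ smooth differential $l$-forms; $\Omega^0=C^\infty(M)$;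 $Z^l(M)$ denotes closed $l$-forms. Contraction is $(X_1\wedge\cdots\wedge X_q)\lrcorner\phi=X_q\lrcorner\cdots\lrcorner X_1\lrcorner\phi$, extended linearly. Rochesterian objects: $\Omega^l_R(TM)$ ($l=1,2$) is the space of $l$-multivector fields $Q$ such that $Q\lrcorner\varphi=d\alpha$ for some $(2-l)$-form $\alpha$ (Rochesterian $l$-multivector fields); $\Omega^l_R(T^*M)$ ($l=0,1$) is the space of $l$-forms $\alpha$ such that $d\alpha=Q\lrcorner\varphi$ for some $(2-l)$-multivector field $Q$. CoRochesterian objects: $\Omega^l_{cR}(TM)$ ($l=1,2,3$) is the space of $l$-multivector fields $Q$ such that $Q\lrcorner\star\varphi=d\alpha$ for some $(3-l)$-form $\alpha$; $\Omega^l_{cR}(T^*M)$ ($l=0,1,2$) is the space of $l$-forms $\alpha$ such that $d\alpha=Q\lrcorner\star\varphi$ for some $(3-l)$-multivector field $Q$. Quotients: $\widetilde{\Omega}^l_R(T^*M)=\Omega^l_R(T^*M)/Z^l(M)$ and $\widetilde{\Omega}^l_{cR}(T^*M)=\Omega^l_{cR}(T^*M)/Z^l(M)$; $\widetilde{\Omega}^l_R(TM)$ is the quotient of $\Omega^l_R(TM)$ by the subspace of $l$-multivector fields $Q$ with $Q\lrcorner\varphi=0$, and $\widetilde{\Omega}^l_{cR}(TM)$ is the quotient of $\Omega^l_{cR}(TM)$ by the subspace of those $Q$ with $Q\lrcorner\star\varphi=0$. *)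

theory Defs
  imports "HOL-Analysis.Analysis" "HOL-Library.Function_Algebras"
begin

section \<open>Pointwise vector space structure on functions\<close>

instantiation "fun" :: (type, scaleR) scaleR
begin
definition scaleR_fun_def: "r *\<^sub>R f = (\<lambda>x. r *\<^sub>R f x)"
instance ..
end

instance "fun" :: (type, real_vector) real_vector
  by standard (auto simp: scaleR_fun_def plus_fun_def fun_eq_iff algebra_simps)


section \<open>Quotients of real vector spaces\<close>

text \<open>The vector space \<open>V / W\<close> is the set of cosets \<open>x + W\<close> with \<open>x \<in> V\<close>. Its sum is the sum of
  sets, and \<open>r (x + W) = r x + W\<close>; adding \<open>W\<close> after scaling matters only for \<open>r = 0\<close>.\<close>

definition coset :: "'a::real_vector set \<Rightarrow> 'a \<Rightarrow> 'a set" where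
  "coset W x = (+) x ` W"

definition quotient_space :: "'a::real_vector set \<Rightarrow> 'a set \<Rightarrow> 'a set set" where
  "quotient_space V W = coset W ` V"

definition coset_scale :: "'a::real_vector set \<Rightarrow> real \<Rightarrow> 'a set \<Rightarrow> 'a set" where
  "coset_scale W r C = (*\<^sub>R) r ` C + W"

definition quotient_iso ::
  "'a::real_vector set \<Rightarrow> 'a set \<Rightarrow> 'b::real_vector set \<Rightarrow> 'b set \<Rightarrow> ('a set \<Rightarrow> 'b set) \<Rightarrow> bool" where
  "quotient_iso V W V' W' F \<longleftrightarrow>
     subspace V \<and> subspace W \<and> W \<subseteq> V \<and> subspace V' \<and> subspace W' \<and> W' \<subseteq> V' \<and>
     bij_betw F (quotient_space V W) (quotient_space V' W') \<and>
     (\<forall>C\<in>quotient_space V W. \<forall>D\<in>quotient_space V W. F (C + D) = F C + F D) \<and>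
     (\<forall>r. \<forall>C\<in>quotient_space V W. F (coset_scale W r C) = coset_scale W' r (F C))"

definition linear_between ::
  "'a::real_vector set \<Rightarrow> 'b::real_vector set \<Rightarrow> ('a \<Rightarrow> 'b) \<Rightarrow> bool" where
  "linear_between V V' f \<longleftrightarrow> subspace V \<and> subspace V' \<and> f ` V \<subseteq> V' \<and>
     (\<forall>x\<in>V. \<forall>y\<in>V. f (x + y) = f x + f y) \<and> (\<forall>r. \<forall>x\<in>V. f (r *\<^sub>R x) = r *\<^sub>R f x)"


section \<open>Exterior algebra of the model space\<close>

text \<open>\<open>alt l\<close> is the space of alternating \<open>l\<close>-linear functionals, represented as functions on lists
  that vanish on lists of length other than \<open>l\<close>. An element of \<open>\<Lambda>\<^sup>l V\<^sup>*\<close> (\<open>V = \<real>\<^sup>7\<close>) is such a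
  functional of \<open>l\<close> vectors. An element of \<open>\<Lambda>\<^sup>l V\<close> is such a functional of \<open>l\<close> covectors, where
  \<open>X\<^sub>1 \<and> \<dots> \<and> X\<^sub>l\<close> is \<open>(\<xi>\<^sub>1, \<dots>, \<xi>\<^sub>l) \<mapsto> det (\<xi>\<^sub>i X\<^sub>j)\<close>. Covectors are again written as elements of
  \<open>real^7\<close>, acting by the dot product.\<close>

definition alt :: "nat \<Rightarrow> ('a::real_vector list \<Rightarrow> real) set" where
  "alt l = {\<omega>. (\<forall>vs. length vs \<noteq> l \<longrightarrow> \<omega> vs = 0) \<and>
     (\<forall>vs i. length vs = l \<and> i < l \<longrightarrow> linear (\<lambda>v. \<omega> (vs[i := v]))) \<and>
     (\<forall>vs i j. length vs = l \<and> i < j \<and> j < l \<and> vs ! i = vs ! j \<longrightarrow> \<omega> vs = 0)}"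

text \<open>Wedge product as a sum over shuffles: \<open>S\<close> is the set of positions of the arguments passed to
  \<open>\<alpha>\<close>, and the sign is that of the shuffle listing \<open>S\<close> before its complement. For
  \<open>\<alpha> \<in> alt k\<close> only sets \<open>S\<close> of \<open>k\<close> elements contribute.\<close>

definition shuffle_sign :: "nat \<Rightarrow> nat set \<Rightarrow> real" where
  "shuffle_sign n S = (-1) ^ card {(i, j). i \<in> S \<and> j \<in> {..<n} - S \<and> j < i}"

definition wedge :: "('a list \<Rightarrow> real) \<Rightarrow> ('a list \<Rightarrow> real) \<Rightarrow> 'a list \<Rightarrow> real" where
  "wedge \<alpha> \<beta> vs = (\<Sum>S\<in>Pow {..<length vs}.
     shuffle_sign (length vs) S * \<alpha> (nths vs S) * \<beta> (nths vs ({..<length vs} - S)))"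

definition int_prod :: "'a \<Rightarrow> ('a list \<Rightarrow> real) \<Rightarrow> 'a list \<Rightarrow> real" where
  "int_prod v \<omega> vs = \<omega> (v # vs)"

text \<open>Contraction of \<open>Q \<in> \<Lambda>\<^sup>q V\<close> with a form: \<open>(1/q!) \<Sum> Q\<^sup>I \<omega>(e\<^sub>I, \<dots>)\<close> over all index tuples \<open>I\<close>.
  This is the linear extension of \<open>X\<^sub>1 \<and> \<dots> \<and> X\<^sub>q \<mapsto> \<omega>(X\<^sub>1, \<dots>, X\<^sub>q, \<dots>)\<close>, which is
  \<open>X\<^sub>q \<lrcorner> \<dots> \<lrcorner> X\<^sub>1 \<lrcorner> \<omega>\<close>.\<close>

definition basis_vecs :: "7 list \<Rightarrow> (real^7) list" where
  "basis_vecs I = map (\<lambda>i. axis i 1) I"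

definition contract :: "nat \<Rightarrow> ((real^7) list \<Rightarrow> real) \<Rightarrow> ((real^7) list \<Rightarrow> real) \<Rightarrow> (real^7) list \<Rightarrow> real" where
  "contract q Q \<omega> vs =
     (\<Sum>I\<in>{I. length I = q}. Q (basis_vecs I) * \<omega> (basis_vecs I @ vs)) / fact q"


section \<open>Linear algebra of \<open>G\<^sub>2\<close>-forms\<close>

text \<open>In the index type \<open>7\<close> the numerals \<open>1, \<dots>, 7\<close> enumerate all elements (with \<open>7 = 0\<close>).\<close>

definition dx :: "7 \<Rightarrow> (real^7) list \<Rightarrow> real" where
  "dx i vs = (if length vs = 1 then hd vs $ i else 0)"

definition dx3 :: "7 \<Rightarrow> 7 \<Rightarrow> 7 \<Rightarrow> (real^7) list \<Rightarrow> real" where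
  "dx3 i j k = wedge (wedge (dx i) (dx j)) (dx k)"

definition phi0 :: "(real^7) list \<Rightarrow> real" where
  "phi0 = dx3 1 2 3 + dx3 1 4 5 + dx3 1 6 7 + dx3 2 4 6 - dx3 2 5 7 - dx3 3 4 7 - dx3 3 5 6"

definition inner_product_form :: "(real^7 \<Rightarrow> real^7 \<Rightarrow> real) \<Rightarrow> bool" where
  "inner_product_form g \<longleftrightarrow> bilinear g \<and> (\<forall>u v. g u v = g v u) \<and> (\<forall>v. v \<noteq> 0 \<longrightarrow> g v v > 0)"

text \<open>\<open>vol\<close> is the volume form of \<open>g\<close> for one of the two orientations. The orientation is itself
  determined by the form, through the last clause of \<open>g2_metric_vol\<close>.\<close>

definition volume_form :: "(real^7 \<Rightarrow> real^7 \<Rightarrow> real) \<Rightarrow> ((real^7) list \<Rightarrow> real) \<Rightarrow> bool" where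
  "volume_form g vol \<longleftrightarrow> vol \<in> alt 7 \<and>
     (\<forall>es. length es = 7 \<and> (\<forall>i<7. \<forall>j<7. g (es ! i) (es ! j) = (if i = j then 1 else 0))
        \<longrightarrow> \<bar>vol es\<bar> = 1)"

definition g2_metric_vol ::
  "((real^7) list \<Rightarrow> real) \<Rightarrow> (real^7 \<Rightarrow> real^7 \<Rightarrow> real) \<Rightarrow> ((real^7) list \<Rightarrow> real) \<Rightarrow> bool" where
  "g2_metric_vol \<phi> g vol \<longleftrightarrow> inner_product_form g \<and> volume_form g vol \<and>
     (\<forall>u v. wedge (wedge (int_prod u \<phi>) (int_prod v \<phi>)) \<phi> = (6 * g u v) *\<^sub>R vol)"

definition g2_metric :: "((real^7) list \<Rightarrow> real) \<Rightarrow> real^7 \<Rightarrow> real^7 \<Rightarrow> real" where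
  "g2_metric \<phi> = (THE g. \<exists>vol. g2_metric_vol \<phi> g vol)"

definition g2_vol :: "((real^7) list \<Rightarrow> real) \<Rightarrow> (real^7) list \<Rightarrow> real" where
  "g2_vol \<phi> = (THE vol. \<exists>g. g2_metric_vol \<phi> g vol)"

definition inverse_gram :: "(real^7 \<Rightarrow> real^7 \<Rightarrow> real) \<Rightarrow> real^7^7" where
  "inverse_gram g = matrix_inv (\<chi> i j. g (axis i 1) (axis j 1))"

text \<open>The inner product on \<open>k\<close>-forms induced by \<open>g\<close>:
  \<open>(1/k!) g\<^bsup>i\<^sub>1 j\<^sub>1\<^esup> \<dots> g\<^bsup>i\<^sub>k j\<^sub>k\<^esup> \<alpha>\<^bsub>i\<^sub>1 \<dots> i\<^sub>k\<^esub> \<beta>\<^bsub>j\<^sub>1 \<dots> j\<^sub>k\<^esub>\<close>.\<close>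

definition form_inner ::
  "(real^7 \<Rightarrow> real^7 \<Rightarrow> real) \<Rightarrow> nat \<Rightarrow> ((real^7) list \<Rightarrow> real) \<Rightarrow> ((real^7) list \<Rightarrow> real) \<Rightarrow> real" where
  "form_inner g k \<alpha> \<beta> = (\<Sum>I\<in>{I. length I = k}. \<Sum>J\<in>{J. length J = k}.
     (\<Prod>r<k. inverse_gram g $ (I ! r) $ (J ! r)) * \<alpha> (basis_vecs I) * \<beta> (basis_vecs J)) / fact k"

definition hodge_star ::
  "(real^7 \<Rightarrow> real^7 \<Rightarrow> real) \<Rightarrow> ((real^7) list \<Rightarrow> real) \<Rightarrow> nat \<Rightarrow> ((real^7) list \<Rightarrow> real)
     \<Rightarrow> (real^7) list \<Rightarrow> real" where
  "hodge_star g vol k \<beta> =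
     (THE \<eta>. \<eta> \<in> alt (7 - k) \<and> (\<forall>\<alpha>\<in>alt k. wedge \<alpha> \<eta> = form_inner g k \<alpha> \<beta> *\<^sub>R vol))"


section \<open>Smooth manifolds of dimension 7\<close>

text \<open>\<open>C\<^sup>k\<close> and \<open>C\<^sup>\<infinity>\<close> maps on an open set.\<close>

fun Ck_on :: "nat \<Rightarrow> ('a::euclidean_space \<Rightarrow> 'b::real_normed_vector) \<Rightarrow> 'a set \<Rightarrow> bool" where
  "Ck_on 0 f S = continuous_on S f"
| "Ck_on (Suc k) f S =
     (f differentiable_on S \<and> (\<forall>v. Ck_on k (\<lambda>x. frechet_derivative f (at x) v) S))"

definition smooth_on :: "('a::euclidean_space \<Rightarrow> 'b::real_normed_vector) \<Rightarrow> 'a set \<Rightarrow> bool" where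
  "smooth_on f S \<longleftrightarrow> (\<forall>k. Ck_on k f S)"

text \<open>A chart is a pair of its domain and its coordinate map. The smooth structure is given by any
  smooth atlas, not necessarily a maximal one.\<close>

type_synonym 'm chart = "'m set \<times> ('m \<Rightarrow> real^7)"

definition transition :: "'m chart \<Rightarrow> 'm chart \<Rightarrow> real^7 \<Rightarrow> real^7" where
  "transition c d = snd d \<circ> inv_into (fst c) (snd c)"

definition smooth_manifold :: "'m topology \<Rightarrow> 'm chart set \<Rightarrow> bool" where
  "smooth_manifold M \<A> \<longleftrightarrow> Hausdorff_space M \<and> second_countable M \<and>
     (\<Union>c\<in>\<A>. fst c) = topspace M \<and>
     (\<forall>c\<in>\<A>. openin M (fst c) \<and> open (snd c ` fst c) \<and>
        homeomorphic_map (subtopology M (fst c)) (top_of_set (snd c ` fst c)) (snd c)) \<and>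
     (\<forall>c\<in>\<A>. \<forall>d\<in>\<A>. smooth_on (transition c d) (snd c ` (fst c \<inter> fst d)))"

definition chart_at :: "'m chart set \<Rightarrow> 'm \<Rightarrow> 'm chart \<Rightarrow> bool" where
  "chart_at \<A> p c \<longleftrightarrow> c \<in> \<A> \<and> p \<in> fst c"


section \<open>Forms and multivector fields\<close>

text \<open>A section of \<open>\<Lambda>\<^sup>l T\<^sup>*M\<close> or \<open>\<Lambda>\<^sup>l TM\<close> assigns to a point \<open>p\<close> and a chart \<open>c\<close> around \<open>p\<close> its
  representative over the model space, where the chart identifies \<open>T\<^sub>pM\<close> with \<open>\<real>\<^sup>7\<close>.
  Representatives in two charts are related by the derivative of the transition map: by pullback for
  forms and by pushforward for multivectors. Values at charts not containing \<open>p\<close> are set to \<open>0\<close>,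
  so that equality of fields is equality of functions.\<close>

type_synonym 'm field = "'m \<Rightarrow> 'm chart \<Rightarrow> (real^7) list \<Rightarrow> real"

definition local_rep :: "'m chart \<Rightarrow> 'm field \<Rightarrow> real^7 \<Rightarrow> (real^7) list \<Rightarrow> real" where
  "local_rep c \<omega> x = \<omega> (inv_into (fst c) (snd c) x) c"

definition transition_deriv :: "'m \<Rightarrow> 'm chart \<Rightarrow> 'm chart \<Rightarrow> real^7 \<Rightarrow> real^7" where
  "transition_deriv p c d = frechet_derivative (transition c d) (at (snd c p))"

definition smooth_alt_field :: "'m chart set \<Rightarrow> nat \<Rightarrow> 'm field \<Rightarrow> bool" where
  "smooth_alt_field \<A> l \<omega> \<longleftrightarrow>
     (\<forall>p c. if chart_at \<A> p c then \<omega> p c \<in> alt l else \<omega> p c = 0) \<and>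
     (\<forall>c\<in>\<A>. \<forall>vs. smooth_on (\<lambda>x. local_rep c \<omega> x vs) (snd c ` fst c))"

definition forms :: "'m chart set \<Rightarrow> nat \<Rightarrow> 'm field set" where
  "forms \<A> l = {\<omega>. smooth_alt_field \<A> l \<omega> \<and>
     (\<forall>p c d vs. chart_at \<A> p c \<and> chart_at \<A> p d
        \<longrightarrow> \<omega> p c vs = \<omega> p d (map (transition_deriv p c d) vs))}"

definition mvecs :: "'m chart set \<Rightarrow> nat \<Rightarrow> 'm field set" where
  "mvecs \<A> l = {Q. smooth_alt_field \<A> l Q \<and>
     (\<forall>p c d \<xi>s. chart_at \<A> p c \<and> chart_at \<A> p d
        \<longrightarrow> Q p d \<xi>s = Q p c (map (adjoint (transition_deriv p c d)) \<xi>s))}"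

text \<open>In a chart, \<open>d\<omega>(v\<^sub>0, \<dots>, v\<^sub>l) = \<Sum>\<^sub>i (-1)\<^sup>i D\<^bsub>v\<^sub>i\<^esub> (\<omega>(v\<^sub>0, \<dots>, v\<^sub>l without v\<^sub>i))\<close> for
  constant vector fields \<open>v\<^sub>i\<close>.\<close>

definition ext_deriv :: "'m chart set \<Rightarrow> 'm field \<Rightarrow> 'm field" where
  "ext_deriv \<A> \<omega> p c vs = (if chart_at \<A> p c
     then \<Sum>i<length vs. (-1) ^ i *
       frechet_derivative (\<lambda>x. local_rep c \<omega> x (take i vs @ drop (Suc i) vs)) (at (snd c p)) (vs ! i)
     else 0)"

definition closed_forms :: "'m chart set \<Rightarrow> nat \<Rightarrow> 'm field set" where
  "closed_forms \<A> l = {\<alpha> \<in> forms \<A> l. ext_deriv \<A> \<alpha> = 0}"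

definition field_contract :: "nat \<Rightarrow> 'm field \<Rightarrow> 'm field \<Rightarrow> 'm field" where
  "field_contract q Q \<omega> p c = contract q (Q p c) (\<omega> p c)"

text \<open>Functions on \<open>M\<close> are extended by \<open>0\<close> outside the carrier of the topology.\<close>

definition smooth_functions :: "'m topology \<Rightarrow> 'm chart set \<Rightarrow> ('m \<Rightarrow> real) set" where
  "smooth_functions M \<A> = {f. (\<forall>p. p \<notin> topspace M \<longrightarrow> f p = 0) \<and>
     (\<forall>c\<in>\<A>. smooth_on (f \<circ> inv_into (fst c) (snd c)) (snd c ` fst c))}"

definition locally_constant_functions :: "'m topology \<Rightarrow> ('m \<Rightarrow> real) set" where
  "locally_constant_functions M = {f. (\<forall>p. p \<notin> topspace M \<longrightarrow> f p = 0) \<and>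
     (\<forall>p\<in>topspace M. \<exists>U. openin M U \<and> p \<in> U \<and> (\<forall>q\<in>U. f q = f p))}"

text \<open>The function \<open>f\<close> regarded as a \<open>0\<close>-form.\<close>

definition form0 :: "'m chart set \<Rightarrow> ('m \<Rightarrow> real) \<Rightarrow> 'm field" where
  "form0 \<A> f p c vs = (if chart_at \<A> p c \<and> vs = [] then f p else 0)"


section \<open>\<open>G\<^sub>2\<close>-manifolds\<close>

definition G2_structure :: "'m topology \<Rightarrow> 'm chart set \<Rightarrow> 'm field \<Rightarrow> bool" where
  "G2_structure M \<A> \<phi> \<longleftrightarrow> smooth_manifold M \<A> \<and> \<phi> \<in> forms \<A> 3 \<and>
     (\<forall>p c. chart_at \<A> p c \<longrightarrow> (\<exists>L. linear L \<and> bij L \<and> (\<forall>vs. \<phi> p c (map L vs) = phi0 vs)))"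

text \<open>The components \<open>g\<^sub>i\<^sub>j\<close> of \<open>g\<^sub>\<phi>\<close> in a chart, the Christoffel symbols \<open>\<Gamma>\<^sup>k\<^sub>i\<^sub>j\<close> of its Levi-Civita
  connection, and the components \<open>(\<nabla>\<^sub>i \<phi>)\<^bsub>jkl\<^esub>\<close>.\<close>

definition partial :: "7 \<Rightarrow> (real^7 \<Rightarrow> real) \<Rightarrow> real^7 \<Rightarrow> real" where
  "partial i f x = frechet_derivative f (at x) (axis i 1)"

definition metric_comp :: "'m chart \<Rightarrow> 'm field \<Rightarrow> 7 \<Rightarrow> 7 \<Rightarrow> real^7 \<Rightarrow> real" where
  "metric_comp c \<phi> i j x = g2_metric (local_rep c \<phi> x) (axis i 1) (axis j 1)"

definition christoffel :: "'m chart \<Rightarrow> 'm field \<Rightarrow> 7 \<Rightarrow> 7 \<Rightarrow> 7 \<Rightarrow> real^7 \<Rightarrow> real" where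
  "christoffel c \<phi> k i j x = (\<Sum>l\<in>UNIV. inverse_gram (g2_metric (local_rep c \<phi> x)) $ k $ l *
     (partial i (metric_comp c \<phi> j l) x + partial j (metric_comp c \<phi> i l) x
        - partial l (metric_comp c \<phi> i j) x)) / 2"

definition nabla_phi :: "'m chart \<Rightarrow> 'm field \<Rightarrow> 7 \<Rightarrow> 7 \<Rightarrow> 7 \<Rightarrow> 7 \<Rightarrow> real^7 \<Rightarrow> real" where
  "nabla_phi c \<phi> i j k l x =
     partial i (\<lambda>y. local_rep c \<phi> y (basis_vecs [j, k, l])) x
     - (\<Sum>m\<in>UNIV. christoffel c \<phi> m i j x * local_rep c \<phi> x (basis_vecs [m, k, l])
          + christoffel c \<phi> m i k x * local_rep c \<phi> x (basis_vecs [j, m, l])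
          + christoffel c \<phi> m i l x * local_rep c \<phi> x (basis_vecs [j, k, m]))"

definition G2_manifold :: "'m topology \<Rightarrow> 'm chart set \<Rightarrow> 'm field \<Rightarrow> bool" where
  "G2_manifold M \<A> \<phi> \<longleftrightarrow> G2_structure M \<A> \<phi> \<and>
     (\<forall>c\<in>\<A>. \<forall>x\<in>snd c ` fst c. \<forall>i j k l. nabla_phi c \<phi> i j k l x = 0)"

text \<open>The form \<open>\<star>\<phi>\<close>, with the Hodge star of \<open>g\<^sub>\<phi>\<close> and the orientation determined by \<open>\<phi>\<close>.\<close>

definition star_phi :: "'m chart set \<Rightarrow> 'm field \<Rightarrow> 'm field" where
  "star_phi \<A> \<phi> p c = (if chart_at \<A> p c
     then hodge_star (g2_metric (\<phi> p c)) (g2_vol (\<phi> p c)) 3 (\<phi> p c) else 0)"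


section \<open>Rochesterian and coRochesterian objects\<close>

text \<open>Degrees: \<open>l \<in> {1, 2}\<close> and \<open>l \<in> {0, 1}\<close> for Rochesterian multivector fields and forms;
  \<open>l \<in> {1, 2, 3}\<close> and \<open>l \<in> {0, 1, 2}\<close> in the coRochesterian case.\<close>

definition R_mvecs :: "'m chart set \<Rightarrow> 'm field \<Rightarrow> nat \<Rightarrow> 'm field set" where
  "R_mvecs \<A> \<phi> l = {Q \<in> mvecs \<A> l. \<exists>\<alpha>\<in>forms \<A> (2 - l). field_contract l Q \<phi> = ext_deriv \<A> \<alpha>}"

definition R_forms :: "'m chart set \<Rightarrow> 'm field \<Rightarrow> nat \<Rightarrow> 'm field set" where
  "R_forms \<A> \<phi> l =
     {\<alpha> \<in> forms \<A> l. \<exists>Q\<in>mvecs \<A> (2 - l). ext_deriv \<A> \<alpha> = field_contract (2 - l) Q \<phi>}"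

definition cR_mvecs :: "'m chart set \<Rightarrow> 'm field \<Rightarrow> nat \<Rightarrow> 'm field set" where
  "cR_mvecs \<A> \<phi> l =
     {Q \<in> mvecs \<A> l. \<exists>\<alpha>\<in>forms \<A> (3 - l). field_contract l Q (star_phi \<A> \<phi>) = ext_deriv \<A> \<alpha>}"

definition cR_forms :: "'m chart set \<Rightarrow> 'm field \<Rightarrow> nat \<Rightarrow> 'm field set" where
  "cR_forms \<A> \<phi> l = {\<alpha> \<in> forms \<A> l.
     \<exists>Q\<in>mvecs \<A> (3 - l). ext_deriv \<A> \<alpha> = field_contract (3 - l) Q (star_phi \<A> \<phi>)}"

definition R_ker :: "'m chart set \<Rightarrow> 'm field \<Rightarrow> nat \<Rightarrow> 'm field set" where
  "R_ker \<A> \<phi> l = {Q \<in> mvecs \<A> l. field_contract l Q \<phi> = 0}"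

definition cR_ker :: "'m chart set \<Rightarrow> 'm field \<Rightarrow> nat \<Rightarrow> 'm field set" where
  "cR_ker \<A> \<phi> l = {Q \<in> mvecs \<A> l. field_contract l Q (star_phi \<A> \<phi>) = 0}"

definition qR_mvecs :: "'m chart set \<Rightarrow> 'm field \<Rightarrow> nat \<Rightarrow> 'm field set set" where
  "qR_mvecs \<A> \<phi> l = quotient_space (R_mvecs \<A> \<phi> l) (R_ker \<A> \<phi> l)"

definition qR_forms :: "'m chart set \<Rightarrow> 'm field \<Rightarrow> nat \<Rightarrow> 'm field set set" where
  "qR_forms \<A> \<phi> l = quotient_space (R_forms \<A> \<phi> l) (closed_forms \<A> l)"

definition qcR_forms :: "'m chart set \<Rightarrow> 'm field \<Rightarrow> nat \<Rightarrow> 'm field set set" where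
  "qcR_forms \<A> \<phi> l = quotient_space (cR_forms \<A> \<phi> l) (closed_forms \<A> l)"

end

theory Submission
  imports Defs
begin

text \<open>The contractions with \<open>\<phi>\<close> and \<open>\<psi> = \<star>\<phi>\<close> are inverted pointwise by explicit formulas that are
  natural in \<open>\<phi>\<close>. Write \<open>\<sharp>\<close> for raising all indices with \<open>g\<^sub>\<phi>\<close>. In a frame in which \<open>\<phi>\<close> is \<open>\<phi>\<^sub>0\<close> the
  identities \<open>\<phi>\<^bsub>aij\<^esub> \<phi>\<^bsub>bij\<^esub> = 6 \<delta>\<^bsub>ab\<^esub>\<close> and \<open>\<psi>\<^bsub>abcd\<^esub> = \<phi>\<^bsub>abi\<^esub> \<phi>\<^bsub>cdi\<^esub> - \<delta>\<^bsub>ac\<^esub> \<delta>\<^bsub>bd\<^esub> + \<delta>\<^bsub>ad\<^esub> \<delta>\<^bsub>bc\<^esub>\<close> give, for a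
  1-form \<open>\<alpha>\<close>, that \<open>(\<alpha>\<^sup>\<sharp> \<lrcorner> \<phi>)\<^sup>\<sharp> \<lrcorner> \<phi> = 3 \<alpha>\<close> and \<open>(\<alpha>\<^sup>\<sharp> \<lrcorner> \<psi>)\<^sup>\<sharp> \<lrcorner> \<psi> = -4 \<alpha>\<close>, and that the operator
  \<open>T \<omega> = \<omega>\<^sup>\<sharp> \<lrcorner> \<psi>\<close> on 2-forms satisfies \<open>T\<^sup>2 = T + 2\<close>. Hence all exact 1-forms are contractions with \<open>\<phi>\<close>
  and with \<open>\<psi>\<close>, all 2-forms are contractions with \<open>\<psi>\<close> in a unique way, and vectors inject under both
  contractions. The resulting multivector fields are smooth because \<open>g\<^sub>\<phi>\<close> is: if \<open>v\<close> is the coordinate volume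
  and \<open>B = 6 v g\<close> the matrix of \<open>(X \<lrcorner> \<phi>) \<and> (Y \<lrcorner> \<phi>) \<and> \<phi>\<close>, then \<open>det B = 6\<^sup>7 v\<^sup>9\<close>, so that \<open>v\<close> is a ninth root.
  The quotient isomorphisms are then the isomorphisms induced by the linear relation
  \<open>Q \<lrcorner> \<phi> = d\<alpha>\<close>, for which only linearity of both sides matters.\<close>

section \<open>Alternating functionals on lists\<close>

text \<open>The obstacle is that adapted frames are given only point by point. A frame therefore
  serves only to verify identities at one point; whatever has to be smooth is expressed through
  \<open>\<phi>\<close> alone, and independence of the chart follows by carrying one frame to the
  other chart. The constants come from counting. The seven triples of \<open>phi0\<close> are the
  lines of the Fano plane: each index lies on three of them, which gives 6 = 3 times 2!, and in four
  of the complementary quadruples, which gives 24 = 4 times 3!. The factorials in the contraction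
  leave 3 and 4, the latter with a sign from moving one argument past three. On 2-forms
  \<open>T\<close> is \<open>3 P - 1\<close>, where \<open>P\<close> projects onto the forms
  \<open>X \<lrcorner> \<phi>\<close>; so \<open>T\<close> has the eigenvalues 2 and -1, and
  \<open>(T - 1) / 2\<close> is its inverse. The asymmetry in part (i) has the same source:
  contraction of vectors with \<open>\<phi>\<close> is injective with image of rank 7 in rank 21,
  while contraction of bivectors with \<open>\<psi>\<close> is bijective.\<close>

lemma alt_length: "\<omega> \<in> alt l \<Longrightarrow> length vs \<noteq> l \<Longrightarrow> \<omega> vs = 0"
  unfolding alt_def by blast

text \<open>Slots are written \<open>as @ v # bs\<close> rather than as list updates, which suits
  recursion on lists. A list of the wrong length gives the zero map, which is linear as
  well.\<close>

lemma alt_linear: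
  assumes "\<omega> \<in> alt l"
  shows "linear (\<lambda>v. \<omega> (as @ v # bs))"
proof (cases "length as + length bs + 1 = l")
  case True
  \<comment> \<open>\<open>undefined\<close> only holds the place that the update
    overwrites.\<close>
  then have "linear (\<lambda>v. \<omega> ((as @ undefined # bs)[length as := v]))"
    using assms unfolding alt_def mem_Collect_eq by (elim conjE allE[of _ "as @ undefined # bs"] allE[of _ "length as"]) simp
  then show ?thesis by simp
next
  case False
  then have "(\<lambda>v. \<omega> (as @ v # bs)) = (\<lambda>v. 0)"
    using alt_length[OF assms] by (intro ext) auto
  then show ?thesis by (simp add: linear_zero)
qed

lemma alt_eq_0:
  assumes "\<omega> \<in> alt l"
  shows "\<omega> (as @ x # bs @ x # cs) = 0"
proof (cases "length (as @ x # bs @ x # cs) = l")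
  case True
  let ?vs = "as @ x # bs @ x # cs" and ?i = "length as" and ?j = "length as + length bs + 1"
  have "?vs ! ?j = (x # bs @ x # cs) ! (length bs + 1)"
    by (subst nth_append) simp
  also have "\<dots> = x" by (simp add: nth_append)
  finally have "?vs ! ?i = ?vs ! ?j" by simp
  moreover have "?i < ?j" "?j < l" using True by auto
  ultimately show ?thesis using assms True unfolding alt_def by blast
qed (use alt_length[OF assms] in blast)

text \<open>Polarization: expand the vanishing value with \<open>x + y\<close> in both
  arguments.\<close>

lemma linear_swap:
  fixes f :: "'a::real_vector \<Rightarrow> 'a \<Rightarrow> real"
  assumes "\<And>x. linear (f x)" "\<And>y. linear (\<lambda>x. f x y)" "\<And>x. f x x = 0"
  shows "f x y = - f y x"
proof -
  have "0 = f (x + y) (x + y)" using assms(3) by simp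
  also have "\<dots> = f x x + f x y + (f y x + f y y)"
    by (simp add: linear_add[OF assms(1)] linear_add[OF assms(2)])
  finally show ?thesis using assms(3) by simp
qed

lemma alt_swap:
  assumes "\<omega> \<in> alt l"
  shows "\<omega> (as @ x # y # bs) = - \<omega> (as @ y # x # bs)"
proof (rule linear_swap[of "\<lambda>x y. \<omega> (as @ x # y # bs)"])
  fix z
  show "linear (\<lambda>y. \<omega> (as @ z # y # bs))" using alt_linear[OF assms, of "as @ [z]"] by simp
  show "linear (\<lambda>x. \<omega> (as @ x # z # bs))" using alt_linear[OF assms] by simp
  show "\<omega> (as @ z # z # bs) = 0" using alt_eq_0[OF assms, of as z "[]"] by simp
qed

text \<open>Vanishing on neighbouring equal arguments suffices: it yields antisymmetry in
  neighbours, and antisymmetry brings any two equal arguments next to each other.\<close>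

lemma altI:
  assumes len: "\<And>vs. length vs \<noteq> l \<Longrightarrow> \<omega> vs = 0"
    and lin: "\<And>as bs. Suc (length as + length bs) = l \<Longrightarrow> linear (\<lambda>v. \<omega> (as @ v # bs))"
    and adj: "\<And>as x bs. Suc (Suc (length as + length bs)) = l \<Longrightarrow> \<omega> (as @ x # x # bs) = 0"
  shows "\<omega> \<in> alt l"
proof -
  have swap: "\<omega> (as @ x # y # bs) = - \<omega> (as @ y # x # bs)" for as x y bs
  proof (cases "Suc (Suc (length as + length bs)) = l")
    case True
    show ?thesis
    proof (rule linear_swap[of "\<lambda>x y. \<omega> (as @ x # y # bs)"])
      fix z
      show "linear (\<lambda>y. \<omega> (as @ z # y # bs))" using lin[of "as @ [z]" bs] True by simp
      show "linear (\<lambda>x. \<omega> (as @ x # z # bs))" using lin[of as "z # bs"] True by simp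
      show "\<omega> (as @ z # z # bs) = 0" using adj True by simp
    qed
  qed (use len in auto)
  have same: "\<omega> (as @ x # bs @ x # cs) = 0" for as x bs cs
  proof (induction bs arbitrary: as)
    case Nil
    show ?case
      using adj[of as cs x] len[of "as @ x # x # cs"]
      by (cases "Suc (Suc (length as + length cs)) = l") auto
  next
    case (Cons b bs)
    have "\<omega> (as @ x # b # bs @ x # cs) = - \<omega> ((as @ [b]) @ x # bs @ x # cs)"
      using swap[of as x b "bs @ x # cs"] by simp
    then show ?case using Cons.IH[of "as @ [b]"] by simp
  qed
  show ?thesis
    unfolding alt_def
  proof (intro CollectI conjI allI impI)
    show "\<omega> vs = 0" if "length vs \<noteq> l" for vs using that by (rule len)
  next
    fix vs :: "'a list" and i assume "length vs = l \<and> i < l"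
    then have "(\<lambda>v. \<omega> (vs[i := v])) = (\<lambda>v. \<omega> (take i vs @ v # drop (Suc i) vs))"
      and "Suc (length (take i vs) + length (drop (Suc i) vs)) = l"
      by (auto simp: upd_conv_take_nth_drop)
    then show "linear (\<lambda>v. \<omega> (vs[i := v]))" using lin by presburger
  next
    fix vs :: "'a list" and i j
    assume *: "length vs = l \<and> i < j \<and> j < l \<and> vs ! i = vs ! j"
    define bs where "bs = take (j - Suc i) (drop (Suc i) vs)"
    have "vs = take i vs @ vs ! i # drop (Suc i) vs"
      using * by (intro id_take_nth_drop) simp
    moreover have "drop (Suc i) vs = bs @ vs ! j # drop (Suc j) vs"
      using * id_take_nth_drop[of "j - Suc i" "drop (Suc i) vs"] diff_less_mono[of j l "Suc i"]
      by (simp add: bs_def)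
    ultimately have "vs = take i vs @ vs ! i # bs @ vs ! i # drop (Suc j) vs"
      using * by metis
    then show "\<omega> vs = 0" using same by metis
  qed
qed

text \<open>The induction step on the degree: slots beyond the first are delegated to interior
  products, so only conditions on the first slot remain.\<close>

lemma alt_SucI:
  assumes "\<omega> [] = 0" and lin: "\<And>vs. linear (\<lambda>v. \<omega> (v # vs))"
    and ip: "\<And>v. int_prod v \<omega> \<in> alt n" and adj: "\<And>v vs. \<omega> (v # v # vs) = 0"
  shows "\<omega> \<in> alt (Suc n)"
proof (rule altI)
  fix vs :: "'a list" assume "length vs \<noteq> Suc n"
  then show "\<omega> vs = 0"
    using assms(1) alt_length[OF ip] by (cases vs) (auto simp: int_prod_def)
next
  fix as bs :: "'a list"
  show "linear (\<lambda>v. \<omega> (as @ v # bs))"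
  proof (cases as)
    case (Cons a as')
    then show ?thesis using alt_linear[OF ip[of a], of as' bs] by (simp add: int_prod_def)
  qed (use lin in simp)
next
  fix as bs :: "'a list" and x
  show "\<omega> (as @ x # x # bs) = 0"
  proof (cases as)
    case (Cons a as')
    then show ?thesis using alt_eq_0[OF ip[of a], of as' x "[]" bs] by (simp add: int_prod_def)
  qed (use adj in simp)
qed

lemma int_prod_alt: "\<omega> \<in> alt (Suc n) \<Longrightarrow> int_prod v \<omega> \<in> alt n"
proof (rule altI)
  assume \<omega>: "\<omega> \<in> alt (Suc n)"
  show "int_prod v \<omega> vs = 0" if "length vs \<noteq> n" for vs
    using alt_length[OF \<omega>, of "v # vs"] that by (simp add: int_prod_def)
  show "linear (\<lambda>w. int_prod v \<omega> (as @ w # bs))" for as bs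
    using alt_linear[OF \<omega>, of "v # as" bs] by (simp add: int_prod_def)
  show "int_prod v \<omega> (as @ x # x # bs) = 0" for as x bs
    using alt_eq_0[OF \<omega>, of "v # as" x "[]" bs] by (simp add: int_prod_def)
qed

lemma int_prod_alt0: "\<omega> \<in> alt 0 \<Longrightarrow> int_prod v \<omega> = 0"
  by (auto simp: int_prod_def fun_eq_iff intro!: alt_length)

lemma subspace_alt: "subspace (alt l)"
proof (rule subspaceI)
  show "(0 :: 'a list \<Rightarrow> real) \<in> alt l"
    by (auto simp: alt_def linear_zero)
next
  fix \<alpha> \<beta> :: "'a list \<Rightarrow> real" assume "\<alpha> \<in> alt l" "\<beta> \<in> alt l"
  then show "\<alpha> + \<beta> \<in> alt l"
    unfolding alt_def by (auto simp: linear_compose_add)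
next
  fix \<alpha> :: "'a list \<Rightarrow> real" and r :: real assume "\<alpha> \<in> alt l"
  then show "r *\<^sub>R \<alpha> \<in> alt l"
    unfolding alt_def by (auto simp: scaleR_fun_def linear_compose_scale_right
      linear_compose_scale_right[where 'b=real, unfolded real_scaleR_def])
qed

lemmas alt_add = subspace_add[OF subspace_alt]
  and alt_diff = subspace_diff[OF subspace_alt]
  and alt_scale = subspace_scale[OF subspace_alt]
  and alt_0 = subspace_0[OF subspace_alt]

lemma alt_map:
  assumes "\<omega> \<in> alt l" "linear L"
  shows "\<omega> \<circ> map L \<in> alt l"
proof (rule altI)
  show "(\<omega> \<circ> map L) vs = 0" if "length vs \<noteq> l" for vs
    using alt_length[OF assms(1)] that by simp
  show "linear (\<lambda>v. (\<omega> \<circ> map L) (as @ v # bs))" for as bs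
    using linear_compose[OF assms(2) alt_linear[OF assms(1), of "map L as" "map L bs"]]
    by (simp add: o_def)
  show "(\<omega> \<circ> map L) (as @ x # x # bs) = 0" for as x bs
    using alt_eq_0[OF assms(1), of _ _ "[]"] by simp
qed

text \<open>Turns a rescaled basis into a power of the scale; this normalizes the volume in the
  uniqueness of the metric.\<close>

lemma alt_scale_all:
  assumes "\<omega> \<in> alt l"
  shows "\<omega> (as @ map ((*\<^sub>R) r) vs) = r ^ length vs * \<omega> (as @ vs)"
proof (induction vs arbitrary: as)
  case (Cons v vs)
  have "\<omega> (as @ map ((*\<^sub>R) r) (v # vs)) = r * \<omega> (as @ v # map ((*\<^sub>R) r) vs)"
    using linear_scale[OF alt_linear[OF assms, of as]] by simp
  also have "\<dots> = r * (r ^ length vs * \<omega> (as @ v # vs))"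
    using Cons.IH[of "as @ [v]"] by simp
  finally show ?case by simp
qed simp

lemma alt_move:
  assumes "\<omega> \<in> alt l"
  shows "\<omega> (as @ x # bs @ cs) = 0 \<longleftrightarrow> \<omega> (as @ bs @ x # cs) = 0"
proof (induction bs arbitrary: as)
  case (Cons b bs)
  show ?case using Cons.IH[of "as @ [b]"] alt_swap[OF assms, of as x b "bs @ cs"] by simp
qed simp

text \<open>Only vanishing is compared, so the sign of the permutation never has to be tracked; this
  is enough for a difference of two functionals.\<close>

lemma alt_mset_eq_0:
  assumes "\<omega> \<in> alt l" "mset vs = mset ws"
  shows "\<omega> vs = 0 \<longleftrightarrow> \<omega> ws = 0"
  using assms
proof (induction vs arbitrary: \<omega> l ws)
  case (Cons v vs)
  then have "v \<in> set ws" using mset_eq_setD[OF Cons.prems(2)] by auto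
  then obtain ys zs where ws: "ws = ys @ v # zs" by (meson split_list)
  have "\<omega> ws = 0 \<longleftrightarrow> \<omega> (v # ys @ zs) = 0"
    using alt_move[OF Cons.prems(1), of "[]" v ys zs] ws by simp
  moreover have "\<omega> (v # ys @ zs) = 0 \<longleftrightarrow> \<omega> (v # vs) = 0"
  proof (cases l)
    case 0
    then show ?thesis using alt_length[OF Cons.prems(1)] by simp
  next
    case (Suc n)
    have "mset vs = mset (ys @ zs)" using Cons.prems(2) ws by simp
    then show ?thesis using Cons.IH[OF int_prod_alt] Cons.prems(1) Suc
      unfolding int_prod_def by blast
  qed
  ultimately show ?case by simp
qed simp

section \<open>The wedge product\<close>

text \<open>The antiderivation rule. Sets of positions are split by whether they contain 0, the
  position of \<open>v\<close>: if they do, \<open>v\<close> is an argument of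
  \<open>\<alpha>\<close>, otherwise of \<open>\<beta>\<close>.\<close>

lemma int_prod_wedge:
  fixes \<alpha> \<beta> :: "'a list \<Rightarrow> real"
  assumes \<alpha>: "\<And>vs. length vs \<noteq> k \<Longrightarrow> \<alpha> vs = 0"
  shows "wedge \<alpha> \<beta> (v # vs) = wedge (int_prod v \<alpha>) \<beta> vs + (-1) ^ k * wedge \<alpha> (int_prod v \<beta>) vs"
proof -
  let ?n = "length vs"
  define f where "f S = shuffle_sign (Suc ?n) S * \<alpha> (nths (v # vs) S) *
    \<beta> (nths (v # vs) ({..<Suc ?n} - S))" for S
  have 0: "{j. Suc j \<in> insert 0 (Suc ` S)} = S" "{j. Suc j \<in> Suc ` S} = S"
    "{j. Suc j \<in> {..<Suc ?n} - insert 0 (Suc ` S)} = {..<?n} - S"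
    "{j. Suc j \<in> {..<Suc ?n} - Suc ` S} = {..<?n} - S"
    "{j. j < ?n \<and> Suc j \<notin> Suc ` S} = {..<?n} - S"
    "{j. j < ?n \<and> j \<notin> S} = {..<?n} - S" for S by auto
  \<comment> \<open>No position lies below 0, so putting 0 into the set creates no
    inversion.\<close>
  have sgn1: "shuffle_sign (Suc ?n) (insert 0 (Suc ` S)) = shuffle_sign ?n S" for S
  proof -
    have "{(i, j). i \<in> insert 0 (Suc ` S) \<and> j \<in> {..<Suc ?n} - insert 0 (Suc ` S) \<and> j < i}
      = map_prod Suc Suc ` {(i, j). i \<in> S \<and> j \<in> {..<?n} - S \<and> j < i}" (is "?A = ?B")
    proof
      show "?A \<subseteq> ?B"
      proof
        fix x assume "x \<in> ?A"
        then obtain i j where "x = (Suc i, Suc j)" "(Suc i, Suc j) \<in> ?A"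
          by (cases x; cases "fst x"; cases "snd x") auto
        then show "x \<in> ?B" by (auto simp: image_iff)
      qed
    qed auto
    then show ?thesis unfolding shuffle_sign_def
      by (simp add: card_image inj_on_def)
  qed
  \<comment> \<open>Here 0 is in the complement and forms an inversion with every element of the
    set.\<close>
  have sgn2: "shuffle_sign (Suc ?n) (Suc ` S) = (-1) ^ card S * shuffle_sign ?n S"
    if "S \<subseteq> {..<?n}" for S
  proof -
    have fin: "finite S" using that finite_subset by blast
    have "{(i, j). i \<in> Suc ` S \<and> j \<in> {..<Suc ?n} - Suc ` S \<and> j < i}
      = map_prod Suc Suc ` {(i, j). i \<in> S \<and> j \<in> {..<?n} - S \<and> j < i} \<union> (\<lambda>i. (Suc i, 0)) ` S"
      (is "?A = ?B \<union> ?C")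
    proof
      show "?A \<subseteq> ?B \<union> ?C"
      proof
        fix x assume x: "x \<in> ?A"
        then obtain i j where ij: "x = (Suc i, j)" by auto
        then show "x \<in> ?B \<union> ?C" using x by (cases j) (auto simp: image_iff)
      qed
    qed auto
    moreover have "finite {(i, j). i \<in> S \<and> j \<in> {..<?n} - S \<and> j < i}"
      by (rule finite_subset[of _ "S \<times> {..<?n}"]) (use fin in auto)
    moreover have "?B \<inter> ?C = {}" by auto
    moreover have "card ?C = card S" by (intro card_image) (auto simp: inj_on_def)
    ultimately have "card ?A = card {(i, j). i \<in> S \<and> j \<in> {..<?n} - S \<and> j < i} + card S"
      using fin by (simp add: card_Un_disjoint card_image inj_on_def)
    then show ?thesis unfolding shuffle_sign_def by (simp add: power_add)
  qed
  have Pow: "Pow {..<Suc ?n} = (\<lambda>S. insert 0 (Suc ` S)) ` Pow {..<?n} \<union> (`) Suc ` Pow {..<?n}"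
    by (simp add: lessThan_Suc_eq_insert_0 Pow_insert image_Pow_surj[OF refl, symmetric]
        image_image Un_commute)
  have "wedge \<alpha> \<beta> (v # vs) = (\<Sum>S\<in>Pow {..<Suc ?n}. f S)"
    by (simp add: wedge_def f_def)
  also have "\<dots> = (\<Sum>S\<in>Pow {..<?n}. f (insert 0 (Suc ` S))) + (\<Sum>S\<in>Pow {..<?n}. f (Suc ` S))"
  proof -
    have "inj_on (\<lambda>S. insert 0 (Suc ` S)) (Pow {..<?n})"
      by (rule inj_onI) (metis 0(1))
    moreover have "inj_on ((`) Suc) (Pow {..<?n})"
      by (rule inj_onI) (metis 0(2))
    moreover have "(\<lambda>S. insert 0 (Suc ` S)) ` Pow {..<?n} \<inter> (`) Suc ` Pow {..<?n} = {}"
      by auto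
    ultimately show ?thesis unfolding Pow
      by (subst sum.union_disjoint) (auto simp: sum.reindex)
  qed
  also have "(\<Sum>S\<in>Pow {..<?n}. f (insert 0 (Suc ` S))) = wedge (int_prod v \<alpha>) \<beta> vs"
    unfolding wedge_def f_def
    by (intro sum.cong refl) (simp add: sgn1 nths_Cons 0 int_prod_def del: Diff_insert)
  also have "(\<Sum>S\<in>Pow {..<?n}. f (Suc ` S)) = (-1) ^ k * wedge \<alpha> (int_prod v \<beta>) vs"
    unfolding wedge_def f_def sum_distrib_left
  proof (intro sum.cong refl)
    fix S assume S: "S \<in> Pow {..<?n}"
    have "length (nths vs S) = card S"
      using S unfolding length_nths by (intro arg_cong[of _ _ card]) auto
    \<comment> \<open>Sets of a size other than \<open>k\<close> contribute zero, so the exponent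
      may be taken to be \<open>k\<close>.\<close>
    then have "(-1) ^ card S * \<alpha> (nths vs S) = (-1) ^ k * \<alpha> (nths vs S)"
      using \<alpha> by (cases "card S = k") auto
    then show "shuffle_sign (Suc ?n) (Suc ` S) * \<alpha> (nths (v # vs) (Suc ` S)) *
        \<beta> (nths (v # vs) ({..<Suc ?n} - Suc ` S)) =
      (-1) ^ k * (shuffle_sign ?n S * \<alpha> (nths vs S) * int_prod v \<beta> (nths vs ({..<?n} - S)))"
      using S by (auto simp: sgn2 nths_Cons 0 int_prod_def image_iff)
  qed
  finally show ?thesis .
qed

lemma wedge_Nil [simp]: "wedge \<alpha> \<beta> [] = \<alpha> [] * \<beta> []"
  by (simp add: wedge_def shuffle_sign_def)

lemma wedge_zero [simp]: "wedge 0 \<beta> = 0" "wedge \<alpha> 0 = 0"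
  by (simp_all add: wedge_def fun_eq_iff)

lemma wedge_diff_right: "wedge \<alpha> (\<beta> - \<gamma>) = wedge \<alpha> \<beta> - wedge \<alpha> \<gamma>"
  by (simp add: wedge_def fun_eq_iff sum_subtractf algebra_simps)

lemma wedge_map: "wedge (\<alpha> \<circ> map L) (\<beta> \<circ> map L) = wedge \<alpha> \<beta> \<circ> map L"
  by (simp add: wedge_def fun_eq_iff nths_map)

lemma wedge_length:
  assumes "\<And>vs. length vs \<noteq> k \<Longrightarrow> \<alpha> vs = 0" "\<And>vs. length vs \<noteq> l \<Longrightarrow> \<beta> vs = 0"
    and vs: "length vs \<noteq> k + l"
  shows "wedge \<alpha> \<beta> vs = 0"
  unfolding wedge_def
proof (intro sum.neutral ballI)
  fix S assume "S \<in> Pow {..<length vs}"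
  then have "length (nths vs S) + length (nths vs ({..<length vs} - S)) = length vs"
  proof -
    have "{i. i < length vs \<and> i \<in> S} \<union> {i. i < length vs \<and> i \<in> {..<length vs} - S} = {..<length vs}"
      by auto
    then show ?thesis unfolding length_nths by (subst card_Un_disjoint[symmetric]) auto
  qed
  then have "length (nths vs S) \<noteq> k \<or> length (nths vs ({..<length vs} - S)) \<noteq> l"
    using vs by auto
  then show "shuffle_sign (length vs) S * \<alpha> (nths vs S) * \<beta> (nths vs ({..<length vs} - S)) = 0"
    using assms(1,2) by auto
qed

text \<open>Induction on the total degree, with both factors and their degrees generalized, because
  by \<open>int_prod_wedge\<close> an interior product lowers the degree of either factor.\<close>

lemma wedge_alt:
  assumes "\<alpha> \<in> alt k" "\<beta> \<in> alt l"
  shows "wedge \<alpha> \<beta> \<in> alt (k + l)"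
proof -
  have "\<forall>k l (\<alpha> :: 'a list \<Rightarrow> real) (\<beta> :: 'a list \<Rightarrow> real). k + l = n \<longrightarrow> \<alpha> \<in> alt k \<longrightarrow> \<beta> \<in> alt l \<longrightarrow> wedge \<alpha> \<beta> \<in> alt n" for n
  proof (induction n)
    case 0
    show ?case
    proof (intro allI impI)
      fix k l :: nat and \<alpha> \<beta> :: "'a list \<Rightarrow> real"
      assume *: "k + l = 0" "\<alpha> \<in> alt k" "\<beta> \<in> alt l"
      show "wedge \<alpha> \<beta> \<in> alt 0"
        by (rule altI) (use * in \<open>auto intro!: wedge_length[OF alt_length alt_length]\<close>)
    qed
  next
    case (Suc n)
    show ?case
    proof (intro allI impI)
      fix k l :: nat and \<alpha> \<beta> :: "'a list \<Rightarrow> real"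
      assume kl: "k + l = Suc n" and \<alpha>: "\<alpha> \<in> alt k" and \<beta>: "\<beta> \<in> alt l"
      have step: "wedge \<alpha> \<gamma> (v # vs) = wedge (int_prod v \<alpha>) \<gamma> vs + (-1) ^ k * wedge \<alpha> (int_prod v \<gamma>) vs"
        for \<gamma> v vs by (rule int_prod_wedge) (rule alt_length[OF \<alpha>])
      have 1: "wedge (int_prod v \<alpha>) \<beta> \<in> alt n" for v
      proof (cases k)
        case 0
        then show ?thesis using int_prod_alt0 \<alpha> alt_0 by fastforce
      next
        case (Suc k')
        then show ?thesis using Suc.IH int_prod_alt[of \<alpha> k'] \<alpha> \<beta> kl by auto
      qed
      have 2: "wedge \<alpha> (int_prod v \<beta>) \<in> alt n" for v
      proof (cases l)
        case 0
        then show ?thesis using int_prod_alt0 \<beta> alt_0 by fastforce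
      next
        case (Suc l')
        then show ?thesis using Suc.IH int_prod_alt[of \<beta> l'] \<alpha> \<beta> kl by auto
      qed
      have lin: "linear (\<lambda>v. c * \<omega> (v # as) * d)" if "\<omega> \<in> alt m"
        for \<omega> :: "'a list \<Rightarrow> real" and as c d m
        using linear_compose_scale_right[OF alt_linear[OF that, of "[]" as], of "c * d"]
        by (simp add: mult_ac)
      show "wedge \<alpha> \<beta> \<in> alt (Suc n)"
      proof (rule alt_SucI)
        show "wedge \<alpha> \<beta> [] = 0"
          by (rule wedge_length[OF alt_length[OF \<alpha>] alt_length[OF \<beta>]]) (use kl in auto)
        show "linear (\<lambda>v. wedge \<alpha> \<beta> (v # vs))" for vs
        proof -
          have "linear (\<lambda>v. wedge (int_prod v \<alpha>) \<beta> vs)"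
            unfolding wedge_def int_prod_def by (intro linear_compose_sum ballI lin[OF \<alpha>])
          moreover have "linear (\<lambda>v. (-1) ^ k * wedge \<alpha> (int_prod v \<beta>) vs)"
            unfolding wedge_def int_prod_def sum_distrib_left
            using lin[OF \<beta>, of _ _ 1] by (intro linear_compose_sum ballI) (simp add: mult.assoc[symmetric])
          ultimately show ?thesis unfolding step by (rule linear_compose_add)
        qed
        show "int_prod v (wedge \<alpha> \<beta>) \<in> alt n" for v
        proof -
          have "int_prod v (wedge \<alpha> \<beta>) = wedge (int_prod v \<alpha>) \<beta> + (-1) ^ k *\<^sub>R wedge \<alpha> (int_prod v \<beta>)"
            by (simp add: fun_eq_iff int_prod_def[of v "wedge \<alpha> \<beta>"] step scaleR_fun_def)
          then show ?thesis using 1 2 by (simp add: alt_add alt_scale)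
        qed
        \<comment> \<open>Applying the rule twice leaves only the two terms with \<open>v\<close> in
          both factors. They carry the signs \<open>(-1) ^ k\<close> and
          \<open>(-1) ^ (k - 1)\<close> and cancel; for \<open>k = 0\<close> both vanish.\<close>
        show "wedge \<alpha> \<beta> (v # v # vs) = 0" for v vs
        proof -
          have sq: "int_prod v (int_prod v \<omega>) = 0" if "\<omega> \<in> alt m" for \<omega> :: "'a list \<Rightarrow> real" and m
            using alt_eq_0[OF that, of "[]" v "[]"] by (simp add: fun_eq_iff int_prod_def)
          have "wedge \<alpha> \<beta> (v # v # vs) = wedge (int_prod v \<alpha>) \<beta> (v # vs) +
            (-1) ^ k * wedge \<alpha> (int_prod v \<beta>) (v # vs)" by (rule step)
          also have "wedge \<alpha> (int_prod v \<beta>) (v # vs) = wedge (int_prod v \<alpha>) (int_prod v \<beta>) vs"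
            by (simp add: step sq[OF \<beta>])
          also have "wedge (int_prod v \<alpha>) \<beta> (v # vs) =
            - ((-1) ^ k * wedge (int_prod v \<alpha>) (int_prod v \<beta>) vs)"
          proof (cases k)
            case 0
            then show ?thesis using int_prod_alt0 \<alpha> by fastforce
          next
            case (Suc k')
            then have "int_prod v \<alpha> \<in> alt k'" using \<alpha> int_prod_alt by blast
            then have "wedge (int_prod v \<alpha>) \<beta> (v # vs) = wedge (int_prod v (int_prod v \<alpha>)) \<beta> vs +
                (-1) ^ k' * wedge (int_prod v \<alpha>) (int_prod v \<beta>) vs"
              by (intro int_prod_wedge) (rule alt_length)
            then show ?thesis by (simp add: sq[OF \<alpha>] Suc)
          qed
          finally show ?thesis by simp
        qed
      qed
    qed
  qed
  then show ?thesis using assms by blast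
qed

text \<open>A computable list of signed shuffles, so that wedge products on explicit lists evaluate
  by rewriting. An entry sent to the second block passes the \<open>Suc k\<close> entries that the
  first block still lacks, whence the sign in the last equation.\<close>

fun shuffles_of :: "nat \<Rightarrow> 'a list \<Rightarrow> (real \<times> 'a list \<times> 'a list) list" where
  "shuffles_of 0 vs = [(1, [], vs)]"
| "shuffles_of (Suc k) [] = []"
| "shuffles_of (Suc k) (v # vs) = map (\<lambda>(s, as, bs). (s, v # as, bs)) (shuffles_of k vs) @
     map (\<lambda>(s, as, bs). ((-1) ^ Suc k * s, as, v # bs)) (shuffles_of (Suc k) vs)"

text \<open>Each recursion step of \<open>shuffles_of\<close> is one use of the antiderivation rule
  at the head of the list.\<close>

lemma wedge_shuffles_of:
  assumes "\<And>vs. length vs \<noteq> k \<Longrightarrow> \<alpha> vs = 0"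
  shows "wedge \<alpha> \<beta> vs = (\<Sum>(s, as, bs)\<leftarrow>shuffles_of k vs. s * \<alpha> as * \<beta> bs)"
  using assms
proof (induction k vs arbitrary: \<alpha> \<beta> rule: shuffles_of.induct)
  case (1 vs)
  show ?case
  proof (induction vs arbitrary: \<beta>)
    case (Cons v vs)
    have "int_prod v \<alpha> = 0" using 1 by (auto simp: int_prod_def)
    then show ?case using Cons int_prod_wedge[of 0 \<alpha> \<beta> v vs] 1 by (simp add: int_prod_def)
  qed simp
next
  case (2 k)
  then show ?case by simp
next
  case (3 k v vs)
  have a: "wedge (int_prod v \<alpha>) \<beta> vs = (\<Sum>(s, as, bs)\<leftarrow>shuffles_of k vs. s * int_prod v \<alpha> as * \<beta> bs)"
    by (rule "3.IH"(1)) (simp add: int_prod_def "3.prems")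
  have b: "wedge \<alpha> (int_prod v \<beta>) vs =
      (\<Sum>(s, as, bs)\<leftarrow>shuffles_of (Suc k) vs. s * \<alpha> as * int_prod v \<beta> bs)"
    by (rule "3.IH"(2)) (rule "3.prems")
  have "wedge \<alpha> \<beta> (v # vs) = wedge (int_prod v \<alpha>) \<beta> vs + (-1) ^ Suc k * wedge \<alpha> (int_prod v \<beta>) vs"
    by (rule int_prod_wedge) (rule "3.prems")
  then show ?case unfolding a b
    by (simp add: o_def case_prod_unfold int_prod_def sum_list_const_mult[symmetric] mult.assoc)
qed

section \<open>Bases\<close>

lemma alt_eq_0_on_span:
  assumes \<omega>: "\<omega> \<in> alt l" and B: "span B = UNIV"
    and 0: "\<And>vs. set vs \<subseteq> B \<Longrightarrow> length vs = l \<Longrightarrow> \<omega> vs = 0"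
  shows "\<omega> = 0"
proof -
  \<comment> \<open>The prefix holds arguments from \<open>B\<close>, the rest is arbitrary;
    linearity in the slot between them extends vanishing from \<open>B\<close> to its span.\<close>
  have "\<forall>as. set as \<subseteq> B \<longrightarrow> \<omega> (as @ vs) = 0" for vs
  proof (induction vs)
    case Nil
    show ?case
    proof (intro allI impI)
      fix as assume "set as \<subseteq> B"
      then show "\<omega> (as @ []) = 0"
        using 0[of as] alt_length[OF \<omega>, of as] by (cases "length as = l") auto
    qed
  next
    case (Cons v vs)
    show ?case
    proof (intro allI impI)
      fix as assume as: "set as \<subseteq> B"
      have "\<omega> (as @ b # vs) = 0" if "b \<in> B" for b
        using Cons.IH[rule_format, of "as @ [b]"] as that by simp
      then show "\<omega> (as @ v # vs) = 0"
        using linear_eq_0_on_span[OF alt_linear[OF \<omega>, of as vs], of B v] B by simp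
    qed
  qed
  from this[rule_format, of "[]"] show ?thesis by (simp add: fun_eq_iff)
qed

lemma basis_vecs_simps [simp]:
  "basis_vecs [] = []" "basis_vecs (i # I) = axis i 1 # basis_vecs I"
  "basis_vecs (I @ J) = basis_vecs I @ basis_vecs J" "length (basis_vecs I) = length I"
  by (simp_all add: basis_vecs_def)

lemma vec_axis_sum: "(v :: real^'n) = (\<Sum>i\<in>UNIV. (v $ i) *\<^sub>R axis i 1)"
  by (simp add: vec_eq_iff axis_def if_distrib sum.delta cong: if_cong)

lemma alt_basis_eq_0:
  fixes \<omega> :: "(real^7) list \<Rightarrow> real"
  assumes \<omega>: "\<omega> \<in> alt l" and 0: "\<And>I. length I = l \<Longrightarrow> distinct I \<Longrightarrow> \<omega> (basis_vecs I) = 0"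
  shows "\<omega> = 0"
proof (rule alt_eq_0_on_span[OF \<omega>, of "range (\<lambda>i. axis i 1)"])
  have "x \<in> span (range (\<lambda>i. axis i 1))" for x :: "real^7"
    by (subst vec_axis_sum) (intro span_sum span_scale span_base rangeI)
  then show "span (range (\<lambda>i. axis i 1)) = (UNIV :: (real^7) set)" by blast
next
  fix vs :: "(real^7) list" assume vs: "set vs \<subseteq> range (\<lambda>i. axis i 1)" "length vs = l"
  then have "vs \<in> lists (range (\<lambda>i. axis i 1))" by (auto simp: in_lists_conv_set)
  then obtain I where I: "vs = basis_vecs I"
    unfolding basis_vecs_def by (metis (no_types, lifting) imageE lists_image lists_UNIV)
  show "\<omega> vs = 0"
  proof (cases "distinct I")
    case False
    then obtain xs ys zs y where "I = xs @ [y] @ ys @ [y] @ zs"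
      using not_distinct_decomp by blast
    then show ?thesis using alt_eq_0[OF \<omega>] I by simp
  qed (use 0 vs I in auto)
qed

lemma UNIV_7: "(UNIV :: 7 set) = {1, 2, 3, 4, 5, 6, 7}"
proof (rule sym, rule card_subset_eq)
  show "card {1, 2, 3, 4, 5, 6, 7::7} = card (UNIV :: 7 set)"
    by simp
qed auto

abbreviation std_basis :: "(real^7) list" where
  "std_basis \<equiv> basis_vecs [1, 2, 3, 4, 5, 6, 7]"

text \<open>Seven distinct indices are a rearrangement of the standard ones, so a functional that
  vanishes on \<open>std_basis\<close> vanishes on every list of seven distinct basis
  vectors.\<close>

lemma alt7_eqI:
  fixes \<omega> \<eta> :: "(real^7) list \<Rightarrow> real"
  assumes "\<omega> \<in> alt 7" "\<eta> \<in> alt 7" "\<omega> std_basis = \<eta> std_basis"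
  shows "\<omega> = \<eta>"
proof -
  have "\<omega> - \<eta> = 0"
  proof (rule alt_basis_eq_0[OF alt_diff[OF assms(1,2)]])
    fix I :: "7 list" assume I: "length I = 7" "distinct I"
    have "set I = UNIV" by (rule card_eq_UNIV_imp_eq_UNIV) (use I in \<open>auto simp: distinct_card\<close>)
    then have "set I = set [1, 2, 3, 4, 5, 6, 7]" by (simp only: UNIV_7 list.set)
    moreover have "distinct [1, 2, 3, 4, 5, 6, 7::7]" by simp
    ultimately have "mset I = mset [1, 2, 3, 4, 5, 6, 7]"
      using set_eq_iff_mset_eq_distinct I(2) by blast
    then have "mset (basis_vecs I) = mset std_basis"
      by (simp only: basis_vecs_def mset_map)
    then have "(\<omega> - \<eta>) (basis_vecs I) = 0 \<longleftrightarrow> (\<omega> - \<eta>) std_basis = 0"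
      by (rule alt_mset_eq_0[OF alt_diff[OF assms(1,2)]])
    then show "(\<omega> - \<eta>) (basis_vecs I) = 0" using assms(3) by simp
  qed
  then show ?thesis by simp
qed

section \<open>Contraction\<close>

lemma finite_lists_length [simp]: "finite {I :: 'i::finite list. length I = q}"
  using finite_lists_length_eq[of "UNIV :: 'i set" q] by simp

lemma sum_lists_0 [simp]: "(\<Sum>I\<in>{I. length I = 0}. f I) = f []"
  by simp

lemma sum_lists_Suc:
  fixes f :: "'i::finite list \<Rightarrow> 'b::comm_monoid_add"
  shows "(\<Sum>I\<in>{I. length I = Suc q}. f I) = (\<Sum>i\<in>UNIV. \<Sum>I\<in>{I. length I = q}. f (i # I))"
proof -
  have "{I :: 'i list. length I = Suc q} = (\<lambda>(i, I). i # I) ` (UNIV \<times> {I. length I = q})"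
    by (auto simp: length_Suc_conv image_iff)
  then have "(\<Sum>I\<in>{I. length I = Suc q}. f I) = sum f ((\<lambda>(i, I). i # I) ` (UNIV \<times> {I. length I = q}))"
    by simp
  also have "\<dots> = (\<Sum>(i, I)\<in>UNIV \<times> {I. length I = q}. f (i # I))"
    by (subst sum.reindex) (auto simp: inj_on_def case_prod_unfold)
  also have "\<dots> = (\<Sum>i\<in>UNIV. \<Sum>I\<in>{I. length I = q}. f (i # I))"
    by (rule sum.cartesian_product[symmetric])
  finally show ?thesis .
qed

lemma alt_expand:
  fixes \<omega> :: "(real^7) list \<Rightarrow> real"
  assumes "\<omega> \<in> alt l"
  shows "\<omega> (as @ v # bs) = (\<Sum>i\<in>UNIV. v $ i * \<omega> (as @ axis i 1 # bs))"
proof -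
  have "\<omega> (as @ v # bs) = \<omega> (as @ (\<Sum>i\<in>UNIV. (v $ i) *\<^sub>R axis i 1) # bs)"
    using vec_axis_sum[of v] by simp
  also have "\<dots> = (\<Sum>i\<in>UNIV. v $ i * \<omega> (as @ axis i 1 # bs))"
    by (simp add: linear_sum[OF alt_linear[OF assms, of as bs]] linear_scale[OF alt_linear[OF assms, of as bs]])
  finally show ?thesis .
qed

lemma contract_alt:
  assumes \<omega>: "\<omega> \<in> alt (q + l)"
  shows "contract q Q \<omega> \<in> alt l"
proof (rule altI)
  show "contract q Q \<omega> vs = 0" if "length vs \<noteq> l" for vs
    unfolding contract_def using that by (simp add: alt_length[OF \<omega>])
  show "linear (\<lambda>v. contract q Q \<omega> (as @ v # bs))" for as bs
  proof -
    have "linear (\<lambda>v. c * \<omega> (es @ as @ v # bs))" for c es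
      using linear_compose_scale_right[OF alt_linear[OF \<omega>, of "es @ as" bs], of c] by simp
    then have "linear (\<lambda>v. \<Sum>I\<in>{I. length I = q}. Q (basis_vecs I) * \<omega> (basis_vecs I @ as @ v # bs))"
      by (intro linear_compose_sum ballI)
    from linear_compose_scale_right[OF this, of "1 / fact q"] show ?thesis
      by (simp add: contract_def)
  qed
  show "contract q Q \<omega> (as @ x # x # bs) = 0" for as x bs
    unfolding contract_def using alt_eq_0[OF \<omega>, of "_ @ as" x "[]" bs] by simp
qed

lemma adjoint_component: "linear L \<Longrightarrow> adjoint L \<xi> $ j = \<xi> \<bullet> L (axis j 1)" for \<xi> :: "real^'m"
  using adjoint_works[of L "axis j 1" \<xi>] inner_commute[of \<xi> "L (axis j 1)"]
  by (simp add: inner_axis')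

text \<open>The canonical element is the same in every frame: since \<open>L\<close> inverts
  \<open>K\<close>, the sum over \<open>i\<close> of \<open>adjoint K e_i\<close> paired with
  \<open>L e_i\<close> equals the sum over \<open>j\<close> of \<open>e_j\<close> paired with
  \<open>e_j\<close>. The lemma serves both for frames at a point and for changes of charts.\<close>

lemma contract_frame:
  assumes L: "linear L" "linear K" "L \<circ> K = id" and Q: "Q \<in> alt q" and \<omega>: "\<omega> \<in> alt l"
  shows "contract q (Q \<circ> map (adjoint K)) (\<omega> \<circ> map L) = contract q Q \<omega> \<circ> map L"
proof -
  \<comment> \<open>The prefixes \<open>as\<close> and \<open>bs\<close> hold the slots in front.
    The induction hypothesis changes the tail back to the standard basis, and the remaining head
    slot is treated by \<open>one\<close>.\<close>
  have "(\<Sum>I\<in>{I. length I = n}. Q (as @ map (adjoint K) (basis_vecs I)) * \<omega> (bs @ map L (basis_vecs I) @ cs))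
    = (\<Sum>I\<in>{I. length I = n}. Q (as @ basis_vecs I) * \<omega> (bs @ basis_vecs I @ cs))" for n as bs cs
  proof (induction n arbitrary: as bs)
    case (Suc n)
    have "(\<Sum>i\<in>UNIV. Q (as @ adjoint K (axis i 1) # as') * \<omega> (bs @ L (axis i 1) # bs'))
      = (\<Sum>j\<in>UNIV. Q (as @ axis j 1 # as') * \<omega> (bs @ axis j 1 # bs'))" for as' bs'
    proof -
      have inner: "(\<Sum>i\<in>UNIV. K (axis j 1) $ i * \<omega> (bs @ L (axis i 1) # bs')) = \<omega> (bs @ axis j 1 # bs')" for j
      proof -
        have lin: "linear (\<lambda>v. \<omega> (bs @ L v # bs'))"
          using linear_compose[OF L(1) alt_linear[OF \<omega>, of bs bs']] by (simp add: o_def)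
        have "\<omega> (bs @ axis j 1 # bs') = \<omega> (bs @ L (K (axis j 1)) # bs')"
          using L(3) by (metis comp_apply id_apply)
        also have "\<dots> = \<omega> (bs @ L (\<Sum>i\<in>UNIV. (K (axis j 1) $ i) *\<^sub>R axis i 1) # bs')"
          using vec_axis_sum[of "K (axis j 1)"] by simp
        also have "\<dots> = (\<Sum>i\<in>UNIV. K (axis j 1) $ i * \<omega> (bs @ L (axis i 1) # bs'))"
          by (simp add: linear_sum[OF lin] linear_scale[OF lin])
        finally show ?thesis by simp
      qed
      have "(\<Sum>i\<in>UNIV. Q (as @ adjoint K (axis i 1) # as') * \<omega> (bs @ L (axis i 1) # bs'))
        = (\<Sum>i\<in>UNIV. \<Sum>j\<in>UNIV. K (axis j 1) $ i * Q (as @ axis j 1 # as') * \<omega> (bs @ L (axis i 1) # bs'))"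
        by (subst alt_expand[OF Q]) (simp add: adjoint_component[OF L(2)] inner_axis' sum_distrib_right)
      also have "\<dots> = (\<Sum>j\<in>UNIV. Q (as @ axis j 1 # as') *
          (\<Sum>i\<in>UNIV. K (axis j 1) $ i * \<omega> (bs @ L (axis i 1) # bs')))"
        by (subst sum.swap) (simp add: sum_distrib_left mult_ac)
      finally show ?thesis by (simp only: inner)
    qed
    note one = this
    have "(\<Sum>i\<in>UNIV. \<Sum>I\<in>{I. length I = n}. Q (as @ adjoint K (axis i 1) # map (adjoint K) (basis_vecs I)) *
          \<omega> (bs @ L (axis i 1) # map L (basis_vecs I) @ cs))
      = (\<Sum>i\<in>UNIV. \<Sum>I\<in>{I. length I = n}. Q (as @ adjoint K (axis i 1) # basis_vecs I) *
          \<omega> (bs @ L (axis i 1) # basis_vecs I @ cs))"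
      using Suc.IH[of "as @ [adjoint K (axis i 1)]" "bs @ [L (axis i 1)]" for i] by simp
    also have "\<dots> = (\<Sum>I\<in>{I. length I = n}. \<Sum>i\<in>UNIV. Q (as @ axis i 1 # basis_vecs I) *
          \<omega> (bs @ axis i 1 # basis_vecs I @ cs))"
      by (subst sum.swap) (simp add: one)
    also have "\<dots> = (\<Sum>i\<in>UNIV. \<Sum>I\<in>{I. length I = n}. Q (as @ axis i 1 # basis_vecs I) *
          \<omega> (bs @ axis i 1 # basis_vecs I @ cs))"
      by (rule sum.swap)
    finally show ?case by (simp add: sum_lists_Suc)
  qed (simp add: basis_vecs_def)
  from this[where n=q and as="[]" and bs="[]"] show ?thesis
    by (simp add: contract_def fun_eq_iff)
qed

section \<open>The model form\<close>

lemma dx_alt: "dx i \<in> alt 1"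
proof (rule altI)
  show "linear (\<lambda>v. dx i (as @ v # bs))" if "Suc (length as + length bs) = 1" for as bs
    using that by (auto simp: dx_def intro!: linearI)
qed (auto simp: dx_def)

lemma dx3_alt: "dx3 i j k \<in> alt 3"
  using wedge_alt[OF wedge_alt[OF dx_alt dx_alt] dx_alt] by (simp add: dx3_def numeral_3_eq_3)

lemma dx3_eval: "dx3 i j k [u, v, w] =
   u $ i * (v $ j * w $ k - v $ k * w $ j) - u $ j * (v $ i * w $ k - v $ k * w $ i)
   + u $ k * (v $ i * w $ j - v $ j * w $ i)"
proof -
  have 1: "wedge (dx i) (dx j) [x, y] = x $ i * y $ j - x $ j * y $ i" for x y
    by (subst wedge_shuffles_of[of 1]) (auto simp: dx_def)
  have "dx3 i j k [u, v, w] = (\<Sum>(s, as, bs)\<leftarrow>shuffles_of 2 [u, v, w]. s * wedge (dx i) (dx j) as * dx k bs)"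
    unfolding dx3_def using alt_length[OF wedge_alt[OF dx_alt dx_alt]]
    by (intro wedge_shuffles_of) simp
  then show ?thesis by (simp add: numeral_2_eq_2 1 dx_def algebra_simps)
qed

lemma phi0_alt: "phi0 \<in> alt 3"
  unfolding phi0_def by (intro alt_add alt_diff dx3_alt)

text \<open>The components of the seven-dimensional cross product of \<open>u\<close> and
  \<open>v\<close>. The identities of the model form are reduced to these polynomials.\<close>

lemma phi0_axis:
  "phi0 [u, v, axis 1 1] = u$2 * v$3 - u$3 * v$2 + u$4 * v$5 - u$5 * v$4 + u$6 * v$7 - u$7 * v$6"
  "phi0 [u, v, axis 2 1] = u$3 * v$1 - u$1 * v$3 + u$4 * v$6 - u$6 * v$4 - u$5 * v$7 + u$7 * v$5"
  "phi0 [u, v, axis 3 1] = u$1 * v$2 - u$2 * v$1 - u$4 * v$7 + u$7 * v$4 - u$5 * v$6 + u$6 * v$5"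
  "phi0 [u, v, axis 4 1] = u$5 * v$1 - u$1 * v$5 - u$2 * v$6 + u$6 * v$2 + u$3 * v$7 - u$7 * v$3"
  "phi0 [u, v, axis 5 1] = u$1 * v$4 - u$4 * v$1 + u$2 * v$7 - u$7 * v$2 + u$3 * v$6 - u$6 * v$3"
  "phi0 [u, v, axis 6 1] = u$7 * v$1 - u$1 * v$7 + u$2 * v$4 - u$4 * v$2 - u$3 * v$5 + u$5 * v$3"
  "phi0 [u, v, axis 7 1] = u$1 * v$6 - u$6 * v$1 - u$2 * v$5 + u$5 * v$2 - u$3 * v$4 + u$4 * v$3"
  by (simp_all add: phi0_def dx3_eval axis_def)

lemma sum_7: "sum f (UNIV :: 7 set) = f 1 + f 2 + f 3 + f 4 + f 5 + f 6 + (f 7 :: real)"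
  unfolding UNIV_7 by simp

lemma inner_7: "(u :: real^7) \<bullet> v = u$1 * v$1 + u$2 * v$2 + u$3 * v$3 + u$4 * v$4 + u$5 * v$5 + u$6 * v$6 + u$7 * v$7"
  by (simp add: inner_vec_def sum_7)

lemma forall_7: "(\<forall>i::7. P i) \<longleftrightarrow> P 1 \<and> P 2 \<and> P 3 \<and> P 4 \<and> P 5 \<and> P 6 \<and> P 7"
proof -
  have "(\<forall>i::7. P i) \<longleftrightarrow> (\<forall>i\<in>{1, 2, 3, 4, 5, 6, 7}. P i)" by (simp only: UNIV_7[symmetric] ball_UNIV)
  then show ?thesis by simp
qed

lemma linear_eq_axis:
  fixes f g :: "real^'n \<Rightarrow> real"
  assumes "linear f" "linear g" "\<And>i. f (axis i 1) = g (axis i 1)"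
  shows "f v = g v"
proof -
  have "f v = f (\<Sum>i\<in>UNIV. (v $ i) *\<^sub>R axis i 1)" using vec_axis_sum[of v] by simp
  also have "\<dots> = g (\<Sum>i\<in>UNIV. (v $ i) *\<^sub>R axis i 1)"
    by (simp add: linear_sum[OF assms(1)] linear_sum[OF assms(2)] linear_scale[OF assms(1)]
        linear_scale[OF assms(2)] assms(3))
  finally show ?thesis using vec_axis_sum[of v] by simp
qed

lemma linear_phi0: "linear (\<lambda>x. phi0 [x, v, w])" "linear (\<lambda>x. phi0 [u, x, w])" "linear (\<lambda>x. phi0 [u, v, x])"
  using alt_linear[OF phi0_alt, of "[]" "[v, w]"] alt_linear[OF phi0_alt, of "[u]" "[w]"]
    alt_linear[OF phi0_alt, of "[u, v]" "[]"] by simp_all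

lemma linear_inner: "linear (\<lambda>x. x \<bullet> v)" "linear (\<lambda>x. v \<bullet> x)"
  by (auto intro!: linearI simp: inner_add_left inner_add_right)

lemma linear_times_right: "linear f \<Longrightarrow> linear (\<lambda>x. c * f x :: real)"
  using linear_compose_scale_right[of f c] by simp

lemma linear_times_left: "linear f \<Longrightarrow> linear (\<lambda>x. f x * c :: real)"
  using linear_times_right[of f c] by (simp add: mult.commute)

lemmas linear_rules = linear_compose_add linear_compose_sub linear_compose_sum ballI
  linear_times_left linear_times_right linear_phi0 linear_inner

text \<open>This evaluates the inner product of the cross products of \<open>u\<close>,
  \<open>v\<close> and of \<open>v\<close>, \<open>w\<close>. Both sides are linear in
  \<open>w\<close>, so basis vectors suffice there while \<open>u\<close> and \<open>v\<close> stay
  symbolic. It will make \<open>psi0\<close> vanish on two equal middle arguments.\<close>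

lemma phi0_quadratic:
  "(\<Sum>i\<in>UNIV. phi0 [u, v, axis i 1] * phi0 [v, w, axis i 1]) = (u \<bullet> v) * (v \<bullet> w) - (u \<bullet> w) * (v \<bullet> v)"
proof (rule linear_eq_axis[where v=w])
  fix b
  have "\<forall>b. (\<Sum>i\<in>UNIV. phi0 [u, v, axis i 1] * phi0 [v, axis b 1, axis i 1]) =
      (u \<bullet> v) * (v $ b) - (u $ b) * (v \<bullet> v)"
    unfolding forall_7 inner_7 sum_7 by (intro conjI; simp add: phi0_axis; simp add: axis_def algebra_simps)
  then show "(\<Sum>i\<in>UNIV. phi0 [u, v, axis i 1] * phi0 [v, axis b 1, axis i 1]) =
      (u \<bullet> v) * (v \<bullet> axis b 1) - (u \<bullet> axis b 1) * (v \<bullet> v)"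
    by (simp add: inner_axis)
qed (intro linear_rules)+

text \<open>Off the diagonal no summand survives, because two indices \<open>a\<close>,
  \<open>b\<close> determine the third index of their triple.\<close>

lemma phi0_phi0: "(\<Sum>a\<in>UNIV. \<Sum>b\<in>UNIV. phi0 [u, axis a 1, axis b 1] * phi0 [v, axis a 1, axis b 1]) = 6 * (u \<bullet> v)"
  unfolding inner_7 sum_7 by (simp add: phi0_axis) (simp add: axis_def)

text \<open>The form \<open>\<star>\<phi>\<^sub>0\<close>, given by the contraction identity rather than as a sum of wedge products, so that
  the same formula expresses \<open>\<star>\<phi>\<close> through \<open>\<phi>\<close> and \<open>g\<^sub>\<phi>\<close> in any chart.\<close>

definition psi0 :: "(real^7) list \<Rightarrow> real" where
  "psi0 vs = (if length vs = 4 then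
     (\<Sum>i\<in>UNIV. phi0 [vs ! 0, vs ! 1, axis i 1] * phi0 [vs ! 2, vs ! 3, axis i 1])
     - (vs ! 0 \<bullet> vs ! 2) * (vs ! 1 \<bullet> vs ! 3) + (vs ! 0 \<bullet> vs ! 3) * (vs ! 1 \<bullet> vs ! 2) else 0)"

lemma psi0_eval: "psi0 [u, v, w, x] = (\<Sum>i\<in>UNIV. phi0 [u, v, axis i 1] * phi0 [w, x, axis i 1])
    - (u \<bullet> w) * (v \<bullet> x) + (u \<bullet> x) * (v \<bullet> w)"
  by (simp add: psi0_def)

lemma phi0_same [simp]: "phi0 [u, u, v] = 0" "phi0 [u, v, u] = 0" "phi0 [v, u, u] = 0"
  using alt_eq_0[OF phi0_alt, of "[]" u "[]" "[v]"] alt_eq_0[OF phi0_alt, of "[]" u "[v]" "[]"]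
    alt_eq_0[OF phi0_alt, of "[v]" u "[]" "[]"] by simp_all

lemma phi0_swap: "phi0 [u, v, w] = - phi0 [v, u, w]" "phi0 [u, v, w] = - phi0 [u, w, v]"
  using alt_swap[OF phi0_alt, of "[]" u v "[w]"] alt_swap[OF phi0_alt, of "[u]" v w "[]"] by simp_all

lemma phi0_rotate: "phi0 [u, v, w] = phi0 [w, u, v]"
  using phi0_swap(1)[of u w v] phi0_swap(2)[of u v w] by simp

text \<open>Equal arguments in the first pair or the last pair are killed by the antisymmetry of
  \<open>phi0\<close>; equal middle arguments are the content of
  \<open>phi0_quadratic\<close>.\<close>

lemma psi0_alt: "psi0 \<in> alt 4"
proof (rule altI)
  show "psi0 vs = 0" if "length vs \<noteq> 4" for vs
    using that by (simp add: psi0_def)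
next
  fix as bs :: "(real^7) list" assume l: "Suc (length as + length bs) = 4"
  have "linear (\<lambda>x. psi0 [x, u, v, w])" "linear (\<lambda>x. psi0 [u, x, v, w])"
    "linear (\<lambda>x. psi0 [u, v, x, w])" "linear (\<lambda>x. psi0 [u, v, w, x])" for u v w
    unfolding psi0_eval by (intro linear_rules)+
  moreover have "length as = 0 \<and> length bs = 3 \<or> length as = 1 \<and> length bs = 2 \<or>
      length as = 2 \<and> length bs = 1 \<or> length as = 3 \<and> length bs = 0" using l by arith
  ultimately show "linear (\<lambda>v. psi0 (as @ v # bs))"
    by (auto simp: eval_nat_numeral length_Suc_conv)
next
  fix as bs :: "(real^7) list" and x assume l: "Suc (Suc (length as + length bs)) = 4"
  have "psi0 [x, x, u, v] = 0" "psi0 [u, x, x, v] = 0" "psi0 [u, v, x, x] = 0" for u v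
    unfolding psi0_eval phi0_quadratic by (simp_all add: mult.commute inner_commute)
  moreover have "length as = 0 \<and> length bs = 2 \<or> length as = 1 \<and> length bs = 1 \<or>
      length as = 2 \<and> length bs = 0" using l by arith
  ultimately show "psi0 (as @ x # x # bs) = 0"
    by (auto simp: eval_nat_numeral length_Suc_conv)
qed

lemma psi0_pair_swap: "psi0 [u, v, w, x] = psi0 [w, x, u, v]"
  by (simp add: psi0_eval mult.commute inner_commute)

lemma psi0_same: "psi0 [u, v, w, v] = 0"
  using alt_eq_0[OF psi0_alt, of "[u]" v "[w]" "[]"] by simp

lemma psi0_rotate: "psi0 [u, v, w, x] = - psi0 [x, u, v, w]"
  using alt_swap[OF psi0_alt, of "[]" x u "[v, w]"] alt_swap[OF psi0_alt, of "[u]" x v "[w]"]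
    alt_swap[OF psi0_alt, of "[u, v]" x w "[]"] by simp

section \<open>Contractions with the model forms in the standard basis\<close>

lemma contract_1: "contract 1 Q \<omega> vs = (\<Sum>i\<in>UNIV. Q [axis i 1] * \<omega> (axis i 1 # vs))"
  by (simp add: contract_def sum_lists_Suc)

lemma contract_2: "contract 2 Q \<omega> vs =
    (\<Sum>i\<in>UNIV. \<Sum>j\<in>UNIV. Q [axis i 1, axis j 1] * \<omega> (axis i 1 # axis j 1 # vs)) / 2"
  by (simp add: contract_def sum_lists_Suc numeral_2_eq_2)

lemma contract_3: "contract 3 Q \<omega> vs = (\<Sum>i\<in>UNIV. \<Sum>j\<in>UNIV. \<Sum>k\<in>UNIV.
    Q [axis i 1, axis j 1, axis k 1] * \<omega> (axis i 1 # axis j 1 # axis k 1 # vs)) / 6"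
  by (simp add: contract_def sum_lists_Suc numeral_3_eq_3)

lemma sum_axis_inner:
  fixes v :: "real^'n"
  assumes "linear f"
  shows "(\<Sum>i\<in>UNIV. (axis i 1 \<bullet> v) * f (axis i 1)) = f v" "(\<Sum>i\<in>UNIV. f (axis i 1) * (axis i 1 \<bullet> v)) = f v"
    "(\<Sum>i\<in>UNIV. (v \<bullet> axis i 1) * f (axis i 1)) = f v" "(\<Sum>i\<in>UNIV. f (axis i 1) * (v \<bullet> axis i 1)) = f v"
proof -
  have "f v = (\<Sum>i\<in>UNIV. v $ i * f (axis i 1))"
    by (subst vec_axis_sum) (simp add: linear_sum[OF assms] linear_scale[OF assms])
  then show "(\<Sum>i\<in>UNIV. (axis i 1 \<bullet> v) * f (axis i 1)) = f v"
     "(\<Sum>i\<in>UNIV. f (axis i 1) * (axis i 1 \<bullet> v)) = f v"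
    "(\<Sum>i\<in>UNIV. (v \<bullet> axis i 1) * f (axis i 1)) = f v" "(\<Sum>i\<in>UNIV. f (axis i 1) * (v \<bullet> axis i 1)) = f v"
    by (simp_all add: inner_axis inner_axis' mult.commute)
qed

lemma alt1_linear: "\<alpha> \<in> alt 1 \<Longrightarrow> linear (\<lambda>v. \<alpha> [v])"
  using alt_linear[of \<alpha> 1 "[]" "[]"] by simp

lemma alt1_eqI:
  assumes "\<alpha> \<in> alt 1" "\<beta> \<in> alt 1" "\<And>v. \<alpha> [v] = \<beta> [v]" shows "\<alpha> = \<beta>"
proof
  fix vs show "\<alpha> vs = \<beta> vs"
    using assms(3) alt_length[OF assms(1), of vs] alt_length[OF assms(2), of vs]
    by (cases "length vs = 1") (auto simp: length_Suc_conv)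
qed

lemma alt2_eqI:
  assumes "\<alpha> \<in> alt 2" "\<beta> \<in> alt 2" "\<And>u v. \<alpha> [u, v] = \<beta> [u, v]" shows "\<alpha> = \<beta>"
proof
  fix vs show "\<alpha> vs = \<beta> vs"
    using assms(3) alt_length[OF assms(1), of vs] alt_length[OF assms(2), of vs]
    by (cases "length vs = 2") (auto simp: length_Suc_conv numeral_2_eq_2)
qed

lemma alt2_linear:
  assumes "\<omega> \<in> alt 2" shows "linear (\<lambda>v. \<omega> [v, w])" "linear (\<lambda>v. \<omega> [w, v])"
  using alt_linear[OF assms, of "[]" "[w]"] alt_linear[OF assms, of "[w]" "[]"] by simp_all

lemma sum_rotate_2:
  "(\<Sum>a\<in>A. \<Sum>b\<in>B. \<Sum>i\<in>I. f i a b) = (\<Sum>i\<in>I. \<Sum>a\<in>A. \<Sum>b\<in>B. f i a b)"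
proof -
  have "(\<Sum>a\<in>A. \<Sum>b\<in>B. \<Sum>i\<in>I. f i a b) = (\<Sum>a\<in>A. \<Sum>i\<in>I. \<Sum>b\<in>B. f i a b)"
    by (intro sum.cong refl sum.swap)
  then show ?thesis by (simp only: sum.swap[of _ I A])
qed

lemma sum_rotate_3:
  "(\<Sum>a\<in>A. \<Sum>b\<in>B. \<Sum>c\<in>C. \<Sum>i\<in>I. f i a b c) = (\<Sum>i\<in>I. \<Sum>a\<in>A. \<Sum>b\<in>B. \<Sum>c\<in>C. f i a b c)"
proof -
  have "(\<Sum>a\<in>A. \<Sum>b\<in>B. \<Sum>c\<in>C. \<Sum>i\<in>I. f i a b c) = (\<Sum>a\<in>A. \<Sum>i\<in>I. \<Sum>b\<in>B. \<Sum>c\<in>C. f i a b c)"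
    by (intro sum.cong refl sum_rotate_2)
  then show ?thesis by (simp only: sum.swap[of _ I A])
qed

text \<open>The free argument moves from the last slot to the first by a cyclic permutation of three
  arguments, hence without a sign; then \<open>phi0_phi0\<close> applies, and \<open>2!\<close>
  divides its 6.\<close>

lemma contract_phi0_phi0:
  assumes \<alpha>: "\<alpha> \<in> alt 1"
  shows "contract 2 (contract 1 \<alpha> phi0) phi0 = 3 *\<^sub>R \<alpha>"
proof (rule alt1_eqI)
  have "contract 2 Q phi0 \<in> alt 1" for Q using contract_alt[of phi0 2 1] phi0_alt by simp
  then show "contract 2 (contract 1 \<alpha> phi0) phi0 \<in> alt 1" .
  show "3 *\<^sub>R \<alpha> \<in> alt 1" using \<alpha> by (rule alt_scale)
  fix v
  have "2 * contract 2 (contract 1 \<alpha> phi0) phi0 [v] =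
      (\<Sum>a\<in>UNIV. \<Sum>b\<in>UNIV. \<Sum>i\<in>UNIV. \<alpha> [axis i 1] * (phi0 [axis i 1, axis a 1, axis b 1] * phi0 [v, axis a 1, axis b 1]))"
    unfolding contract_1 contract_2
    by (simp add: sum_distrib_right phi0_rotate[of _ _ v] mult.assoc)
  also have "\<dots> = (\<Sum>i\<in>UNIV. \<alpha> [axis i 1] * (\<Sum>a\<in>UNIV. \<Sum>b\<in>UNIV. phi0 [axis i 1, axis a 1, axis b 1] * phi0 [v, axis a 1, axis b 1]))"
    by (subst sum_rotate_2) (simp add: sum_distrib_left)
  also have "\<dots> = 6 * (\<Sum>i\<in>UNIV. \<alpha> [axis i 1] * (axis i 1 \<bullet> v))"
    unfolding phi0_phi0 by (simp add: sum_distrib_left mult_ac)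
  also have "\<dots> = 6 * \<alpha> [v]" by (simp only: sum_axis_inner[OF alt1_linear[OF \<alpha>]])
  finally show "contract 2 (contract 1 \<alpha> phi0) phi0 [v] = (3 *\<^sub>R \<alpha>) [v]"
    by (simp add: scaleR_fun_def)
qed

text \<open>One sixth of this covector, contracted again with \<open>phi0\<close>, is the projection
  of a 2-form onto the 7-dimensional summand of the 2-forms.\<close>

definition phi0_dual :: "((real^7) list \<Rightarrow> real) \<Rightarrow> real^7 \<Rightarrow> real" where
  "phi0_dual \<omega> v = (\<Sum>a\<in>UNIV. \<Sum>b\<in>UNIV. \<omega> [axis a 1, axis b 1] * phi0 [axis a 1, axis b 1, v])"

text \<open>The two metric terms of \<open>psi0\<close> return \<open>- \<omega>\<close> after
  halving, and the product term is three times the projection described by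
  \<open>phi0_dual\<close>.\<close>

lemma contract_psi0_2:
  assumes \<omega>: "\<omega> \<in> alt 2"
  shows "contract 2 \<omega> psi0 [u, v] = (\<Sum>i\<in>UNIV. phi0 [u, v, axis i 1] * phi0_dual \<omega> (axis i 1)) / 2 - \<omega> [u, v]"
proof -
  let ?e = "\<lambda>i::7. axis i 1 :: real^7"
  have 1: "(\<Sum>a\<in>UNIV. \<Sum>b\<in>UNIV. \<omega> [?e a, ?e b] * (\<Sum>i\<in>UNIV. phi0 [?e a, ?e b, ?e i] * phi0 [u, v, ?e i]))
     = (\<Sum>i\<in>UNIV. phi0 [u, v, ?e i] * phi0_dual \<omega> (?e i))" (is "?L = ?R")
  proof -
    have "?L = (\<Sum>a\<in>UNIV. \<Sum>i\<in>UNIV. \<Sum>b\<in>UNIV. phi0 [u, v, ?e i] * (\<omega> [?e a, ?e b] * phi0 [?e a, ?e b, ?e i]))"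
      unfolding sum_distrib_left by (subst sum.swap) (simp add: mult_ac)
    also have "\<dots> = ?R"
      unfolding phi0_dual_def sum_distrib_left by (rule sum.swap)
    finally show ?thesis .
  qed
  have 2: "(\<Sum>a\<in>UNIV. \<Sum>b\<in>UNIV. \<omega> [?e a, ?e b] * ((?e a \<bullet> x) * (?e b \<bullet> y))) = \<omega> [x, y]" for x y
  proof -
    have "(\<Sum>a\<in>UNIV. \<Sum>b\<in>UNIV. \<omega> [?e a, ?e b] * ((?e a \<bullet> x) * (?e b \<bullet> y))) =
        (\<Sum>a\<in>UNIV. (?e a \<bullet> x) * (\<Sum>b\<in>UNIV. \<omega> [?e a, ?e b] * (?e b \<bullet> y)))"
      by (simp add: sum_distrib_left mult_ac)
    then show ?thesis
      by (simp only: sum_axis_inner[OF alt2_linear(1)[OF \<omega>]] sum_axis_inner[OF alt2_linear(2)[OF \<omega>]])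
  qed
  have "2 * contract 2 \<omega> psi0 [u, v] =
    (\<Sum>a\<in>UNIV. \<Sum>b\<in>UNIV. \<omega> [?e a, ?e b] * (\<Sum>i\<in>UNIV. phi0 [?e a, ?e b, ?e i] * phi0 [u, v, ?e i]))
    - (\<Sum>a\<in>UNIV. \<Sum>b\<in>UNIV. \<omega> [?e a, ?e b] * ((?e a \<bullet> u) * (?e b \<bullet> v)))
    + (\<Sum>a\<in>UNIV. \<Sum>b\<in>UNIV. \<omega> [?e a, ?e b] * ((?e a \<bullet> v) * (?e b \<bullet> u)))"
    unfolding contract_2 psi0_eval
    by (simp add: ring_distribs sum.distrib sum_subtractf)
  also have "\<dots> = ?R - 2 * \<omega> [u, v]"
    unfolding 1 2 using alt_swap[OF \<omega>, of "[]" u v "[]"] by simp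
  finally show ?thesis by simp
qed

lemma phi0_dual_linear: "linear (phi0_dual \<omega>)"
  unfolding phi0_dual_def by (intro linear_rules)

lemma phi0_phi0': "(\<Sum>a\<in>UNIV. \<Sum>b\<in>UNIV. phi0 [axis a 1, axis b 1, u] * phi0 [axis a 1, axis b 1, v]) = 6 * (u \<bullet> v)"
  using phi0_phi0[of u v] by (simp add: phi0_rotate[of "axis _ 1" _ u] phi0_rotate[of "axis _ 1" _ v])

text \<open>The hypothesis concerns pairs only, so it can be met by functions given by ad hoc
  formulas on lists.\<close>

lemma phi0_dual_contract_phi0:
  assumes "\<And>u v. \<omega> [u, v] = (\<Sum>i\<in>UNIV. phi0 [u, v, axis i 1] * f (axis i 1))" "linear f"
  shows "phi0_dual \<omega> v = 6 * f v"
proof -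
  let ?e = "\<lambda>i::7. axis i 1 :: real^7"
  have "phi0_dual \<omega> v = (\<Sum>a\<in>UNIV. \<Sum>b\<in>UNIV. \<Sum>i\<in>UNIV. f (?e i) * (phi0 [?e a, ?e b, ?e i] * phi0 [?e a, ?e b, v]))"
    unfolding phi0_dual_def assms(1) sum_distrib_right by (simp add: mult_ac)
  also have "\<dots> = (\<Sum>i\<in>UNIV. f (?e i) * (\<Sum>a\<in>UNIV. \<Sum>b\<in>UNIV. phi0 [?e a, ?e b, ?e i] * phi0 [?e a, ?e b, v]))"
    by (subst sum_rotate_2) (simp add: sum_distrib_left)
  also have "\<dots> = 6 * (\<Sum>i\<in>UNIV. f (?e i) * (?e i \<bullet> v))"
    unfolding phi0_phi0' by (simp add: sum_distrib_left mult_ac)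
  finally show ?thesis by (simp only: sum_axis_inner[OF assms(2)])
qed

lemma phi0_dual_diff: "phi0_dual (\<lambda>vs. \<alpha> vs / 2 - \<beta> vs) v = phi0_dual \<alpha> v / 2 - phi0_dual \<beta> v"
  unfolding phi0_dual_def by (simp add: left_diff_distrib sum_subtractf sum_divide_distrib)

lemma contract_psi0_2_alt: "contract 2 Q psi0 \<in> alt 2"
  using contract_alt[of psi0 2 2] psi0_alt by simp

lemma contract_psi0_psi0_2:
  assumes \<omega>: "\<omega> \<in> alt 2"
  shows "contract 2 (contract 2 \<omega> psi0) psi0 = contract 2 \<omega> psi0 + 2 *\<^sub>R \<omega>"
proof -
  \<comment> \<open>Six times the projection of \<open>\<omega>\<close> onto the 7-dimensional
    summand; only its values on pairs matter, and the value 0 elsewhere is a default.\<close>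
  define \<beta> where "\<beta> vs = (case vs of [u, v] \<Rightarrow> (\<Sum>i\<in>UNIV. phi0 [u, v, axis i 1] * phi0_dual \<omega> (axis i 1)) | _ \<Rightarrow> 0)" for vs
  have \<beta>: "\<beta> [u, v] = (\<Sum>i\<in>UNIV. phi0 [u, v, axis i 1] * phi0_dual \<omega> (axis i 1))" for u v
    by (simp add: \<beta>_def)
  have 1: "contract 2 \<omega> psi0 [u, v] = \<beta> [u, v] / 2 - \<omega> [u, v]" for u v
    unfolding contract_psi0_2[OF \<omega>] \<beta> ..
  have "phi0_dual (contract 2 \<omega> psi0) v = phi0_dual \<beta> v / 2 - phi0_dual \<omega> v" for v
    using phi0_dual_diff[of \<beta> \<omega> v] unfolding phi0_dual_def 1 .
  \<comment> \<open>The projected part contributes \<open>6 / 2\<close>, and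
    \<open>- \<omega>\<close> takes 1 away: this is the eigenvalue 2 on the 7-dimensional
    summand.\<close>
  then have 2: "phi0_dual (contract 2 \<omega> psi0) v = 2 * phi0_dual \<omega> v" for v
    using phi0_dual_contract_phi0[of \<beta>, OF \<beta> phi0_dual_linear, of v] by simp
  show ?thesis
  proof (rule alt2_eqI)
    show "contract 2 (contract 2 \<omega> psi0) psi0 [u, v] = (contract 2 \<omega> psi0 + 2 *\<^sub>R \<omega>) [u, v]" for u v
      using 1[of u v] contract_psi0_2[OF contract_psi0_2_alt, of \<omega> u v]
      unfolding 2 \<beta> by (simp add: scaleR_fun_def sum_distrib_left mult_ac flip: sum_divide_distrib)
  qed (intro contract_psi0_2_alt alt_add alt_scale \<omega>)+
qed

text \<open>Fixing one summed index turns the other two into a contraction of a 2-form with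
  \<open>psi0\<close>, so \<open>contract_psi0_2\<close> reduces the sum to
  \<open>phi0_phi0\<close>.\<close>

lemma psi0_psi0: "(\<Sum>a\<in>UNIV. \<Sum>b\<in>UNIV. \<Sum>c\<in>UNIV. psi0 [v, axis a 1, axis b 1, axis c 1] *
    psi0 [w, axis a 1, axis b 1, axis c 1]) = 24 * (v \<bullet> w)"
proof -
  let ?e = "\<lambda>i::7. axis i 1 :: real^7"
  have "(\<Sum>b\<in>UNIV. \<Sum>c\<in>UNIV. psi0 [v, ?e a, ?e b, ?e c] * psi0 [w, ?e a, ?e b, ?e c])
    = (\<Sum>i\<in>UNIV. phi0 [w, ?e a, ?e i] * phi0 [v, ?e a, ?e i]) * 4" for a
  proof -
    define \<omega> where "\<omega> = int_prod (?e a) (int_prod v psi0)"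
    have \<omega>: "\<omega> \<in> alt 2" unfolding \<omega>_def
      using int_prod_alt[OF int_prod_alt, of psi0 2] psi0_alt by simp
    have \<omega>': "\<omega> [b, c] = psi0 [v, ?e a, b, c]" for b c by (simp add: \<omega>_def int_prod_def)
    have "phi0_dual \<omega> x = 4 * phi0 [v, ?e a, x]" for x
    proof -
      have "phi0_dual \<omega> x = (\<Sum>b\<in>UNIV. \<Sum>c\<in>UNIV. (\<Sum>i\<in>UNIV. phi0 [?e b, ?e c, ?e i] * phi0 [v, ?e a, ?e i])
            * phi0 [?e b, ?e c, x])
          - (\<Sum>b\<in>UNIV. (v \<bullet> ?e b) * (\<Sum>c\<in>UNIV. (?e a \<bullet> ?e c) * phi0 [?e b, ?e c, x]))
          + (\<Sum>c\<in>UNIV. (v \<bullet> ?e c) * (\<Sum>b\<in>UNIV. (?e a \<bullet> ?e b) * phi0 [?e b, ?e c, x]))"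
      proof -
        have "(\<Sum>c\<in>UNIV. (v \<bullet> ?e c) * (\<Sum>b\<in>UNIV. (?e a \<bullet> ?e b) * phi0 [?e b, ?e c, x])) =
            (\<Sum>b\<in>UNIV. \<Sum>c\<in>UNIV. (v \<bullet> ?e c) * ((?e a \<bullet> ?e b) * phi0 [?e b, ?e c, x]))"
          unfolding sum_distrib_left by (rule sum.swap)
        then show ?thesis unfolding phi0_dual_def \<omega>' psi0_eval
          by (simp add: ring_distribs sum.distrib sum_subtractf sum_distrib_left mult_ac)
      qed
      \<comment> \<open>The 6 belongs to the product term of \<open>psi0\<close>; the two metric
        terms take away 1 each, the second one after exchanging \<open>v\<close> and
        \<open>?e a\<close>.\<close>
      also have "\<dots> = 6 * phi0 [v, ?e a, x] - phi0 [v, ?e a, x] + phi0 [?e a, v, x]"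
        unfolding sum_axis_inner[OF linear_phi0(1)] sum_axis_inner[OF linear_phi0(2)]
        using phi0_dual_contract_phi0[OF _ linear_phi0(3)[of v "?e a"], of "\<lambda>vs. \<Sum>i\<in>UNIV. phi0 (vs @ [?e i]) * phi0 [v, ?e a, ?e i]" x]
        unfolding phi0_dual_def by simp
      finally show ?thesis using phi0_swap(1)[of "?e a" v x] by simp
    qed
    \<comment> \<open>Inserting \<open>?e a\<close> once more removes the term
      \<open>- \<omega>\<close>, since \<open>psi0\<close> then has a repeated argument.\<close>
    then have "contract 2 \<omega> psi0 [w, ?e a] = (\<Sum>i\<in>UNIV. phi0 [w, ?e a, ?e i] * phi0 [v, ?e a, ?e i]) * 2"
      unfolding contract_psi0_2[OF \<omega>] \<omega>' psi0_same by (simp add: sum_distrib_left sum_distrib_right mult_ac sum_divide_distrib)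
    then show ?thesis
      unfolding contract_2 \<omega>' psi0_pair_swap[of _ _ w] by (simp add: field_simps)
  qed
  then have "(\<Sum>a\<in>UNIV. \<Sum>b\<in>UNIV. \<Sum>c\<in>UNIV. psi0 [v, ?e a, ?e b, ?e c] * psi0 [w, ?e a, ?e b, ?e c])
    = (\<Sum>a\<in>UNIV. \<Sum>i\<in>UNIV. phi0 [v, ?e a, ?e i] * phi0 [w, ?e a, ?e i]) * 4"
    by (simp add: sum_distrib_left mult_ac)
  then show ?thesis unfolding phi0_phi0 by simp
qed

text \<open>A cyclic permutation of four arguments is odd, which makes the constant
  \<open>- 24 / 3!\<close>.\<close>

lemma contract_psi0_psi0_3:
  assumes \<alpha>: "\<alpha> \<in> alt 1"
  shows "contract 3 (contract 1 \<alpha> psi0) psi0 = (-4) *\<^sub>R \<alpha>"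
proof (rule alt1_eqI)
  have "contract 3 Q psi0 \<in> alt 1" for Q using contract_alt[of psi0 3 1] psi0_alt by simp
  then show "contract 3 (contract 1 \<alpha> psi0) psi0 \<in> alt 1" .
  show "(-4) *\<^sub>R \<alpha> \<in> alt 1" using \<alpha> by (rule alt_scale)
  fix v
  let ?e = "\<lambda>i::7. axis i 1 :: real^7"
  have "6 * contract 3 (contract 1 \<alpha> psi0) psi0 [v] =
      - (\<Sum>a\<in>UNIV. \<Sum>b\<in>UNIV. \<Sum>c\<in>UNIV. \<Sum>i\<in>UNIV. \<alpha> [?e i] * (psi0 [?e i, ?e a, ?e b, ?e c] * psi0 [v, ?e a, ?e b, ?e c]))"
    unfolding contract_1 contract_3
    by (simp add: sum_distrib_right psi0_rotate[of _ _ _ v] mult.assoc sum_negf)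
  also have "(\<Sum>a\<in>UNIV. \<Sum>b\<in>UNIV. \<Sum>c\<in>UNIV. \<Sum>i\<in>UNIV. \<alpha> [?e i] * (psi0 [?e i, ?e a, ?e b, ?e c] * psi0 [v, ?e a, ?e b, ?e c]))
     = (\<Sum>i\<in>UNIV. \<alpha> [?e i] * (\<Sum>a\<in>UNIV. \<Sum>b\<in>UNIV. \<Sum>c\<in>UNIV. psi0 [?e i, ?e a, ?e b, ?e c] * psi0 [v, ?e a, ?e b, ?e c]))"
    by (subst sum_rotate_3) (simp add: sum_distrib_left)
  also have "\<dots> = 24 * (\<Sum>i\<in>UNIV. \<alpha> [?e i] * (?e i \<bullet> v))"
    unfolding psi0_psi0 by (simp add: sum_distrib_left mult_ac)
  also have "\<dots> = 24 * \<alpha> [v]" by (simp only: sum_axis_inner[OF alt1_linear[OF \<alpha>]])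
  finally show "contract 3 (contract 1 \<alpha> psi0) psi0 [v] = ((-4) *\<^sub>R \<alpha>) [v]"
    by (simp add: scaleR_fun_def)
qed

section \<open>Metric and Hodge dual of the model form\<close>

lemma phi0_metric:
  "wedge (wedge (int_prod u phi0) (int_prod v phi0)) phi0 std_basis = 6 * (u \<bullet> v)"
proof -
  have ip: "int_prod x phi0 \<in> alt 2" for x using int_prod_alt[of phi0 2] phi0_alt by simp
  have 1: "wedge (int_prod u phi0) (int_prod v phi0) vs =
      (\<Sum>(s, as, bs)\<leftarrow>shuffles_of 2 vs. s * int_prod u phi0 as * int_prod v phi0 bs)" for vs
    by (rule wedge_shuffles_of) (rule alt_length[OF ip])
  have "wedge (wedge (int_prod u phi0) (int_prod v phi0)) phi0 std_basis =
     (\<Sum>(s, as, bs)\<leftarrow>shuffles_of 4 std_basis. s * wedge (int_prod u phi0) (int_prod v phi0) as * phi0 bs)"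
    by (rule wedge_shuffles_of) (rule alt_length[OF wedge_alt[OF ip ip], simplified])
  then show ?thesis
    by (simp add: eval_nat_numeral 1 int_prod_def phi0_axis inner_7) (simp add: axis_def)
qed

lemma sum_axis_nth [simp]: "(\<Sum>a\<in>UNIV. axis a 1 $ i * f a) = (f i :: real)"
  by (simp add: axis_def if_distrib if_distribR sum.delta cong: if_cong)

lemma alt3_swap:
  assumes "\<alpha> \<in> alt 3"
  shows "\<alpha> [u, v, w] = - \<alpha> [v, u, w]" "\<alpha> [u, v, w] = - \<alpha> [u, w, v]"
  using alt_swap[OF assms, of "[]" u v "[w]"] alt_swap[OF assms, of "[u]" v w "[]"] by simp_all

text \<open>The six products in the determinant pick out six signed rearrangements of one value of
  \<open>\<alpha>\<close>, which cancels the division by \<open>3!\<close>.\<close>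

lemma contract_dx3:
  assumes \<alpha>: "\<alpha> \<in> alt 3"
  shows "contract 3 (dx3 i j k) \<alpha> [] = \<alpha> [axis i 1, axis j 1, axis k 1]"
proof -
  let ?e = "\<lambda>i::7. axis i 1 :: real^7"
  define s where "s i j k = (\<Sum>a\<in>UNIV. ?e a $ i * (\<Sum>b\<in>UNIV. ?e b $ j * (\<Sum>c\<in>UNIV. ?e c $ k * \<alpha> [?e a, ?e b, ?e c])))" for i j k
  have "6 * contract 3 (dx3 i j k) \<alpha> [] = s i j k - s i k j - (s j i k - s j k i) + (s k i j - s k j i)"
    unfolding contract_3 dx3_eval s_def
    by (simp only: ring_distribs sum.distrib sum_subtractf sum_distrib_left mult_ac) simp
  moreover have "s i j k = \<alpha> [?e i, ?e j, ?e k]" for i j k by (simp add: s_def)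
  moreover have "\<alpha> [?e i, ?e k, ?e j] = - \<alpha> [?e i, ?e j, ?e k]" "\<alpha> [?e j, ?e i, ?e k] = - \<alpha> [?e i, ?e j, ?e k]"
     "\<alpha> [?e j, ?e k, ?e i] = \<alpha> [?e i, ?e j, ?e k]" "\<alpha> [?e k, ?e i, ?e j] = \<alpha> [?e i, ?e j, ?e k]"
     "\<alpha> [?e k, ?e j, ?e i] = - \<alpha> [?e i, ?e j, ?e k]"
    by (metis alt3_swap[OF \<alpha>] minus_minus)+
  ultimately show ?thesis by simp
qed

lemma contract_add_left: "contract q (P + Q) \<omega> = contract q P \<omega> + contract q Q \<omega>"
  by (simp add: contract_def fun_eq_iff ring_distribs sum.distrib add_divide_distrib)

lemma contract_diff_left: "contract q (P - Q) \<omega> = contract q P \<omega> - contract q Q \<omega>"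
  by (simp add: contract_def fun_eq_iff ring_distribs sum_subtractf diff_divide_distrib)

text \<open>Of the 35 shuffles only seven survive: on basis quadruples \<open>psi0\<close> is
  nonzero exactly on the complements of the triples of \<open>phi0\<close>, and with the shuffle
  signs the coefficients become those of \<open>phi0\<close>. The right-hand side is the Euclidean
  inner product of \<open>\<alpha>\<close> with \<open>phi0\<close>.\<close>

lemma psi0_hodge_std:
  assumes \<alpha>: "\<alpha> \<in> alt 3"
  shows "wedge \<alpha> psi0 std_basis = contract 3 phi0 \<alpha> []"
proof -
  have "wedge \<alpha> psi0 std_basis = (\<Sum>(s, as, bs)\<leftarrow>shuffles_of 3 std_basis. s * \<alpha> as * psi0 bs)"
    by (rule wedge_shuffles_of) (rule alt_length[OF \<alpha>])
  also have "\<dots> = \<alpha> (basis_vecs [1, 2, 3]) + \<alpha> (basis_vecs [1, 4, 5]) + \<alpha> (basis_vecs [1, 6, 7]) + \<alpha> (basis_vecs [2, 4, 6])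
      - \<alpha> (basis_vecs [2, 5, 7]) - \<alpha> (basis_vecs [3, 4, 7]) - \<alpha> (basis_vecs [3, 5, 6])"
    by (simp add: eval_nat_numeral psi0_eval sum_7 phi0_axis inner_axis) (simp add: axis_def)
  also have "\<dots> = contract 3 phi0 \<alpha> []"
    unfolding phi0_def by (simp add: contract_add_left contract_diff_left contract_dx3[OF \<alpha>])
  finally show ?thesis .
qed

text \<open>Nondegeneracy of the wedge pairing between degrees 3 and 4, which makes the Hodge star
  unique. A basis quadruple is tested with \<open>dx3\<close> on the three complementary
  indices.\<close>

lemma alt4_eq_0:
  assumes \<delta>: "\<delta> \<in> alt 4" and 0: "\<And>\<alpha>. \<alpha> \<in> alt 3 \<Longrightarrow> wedge \<alpha> \<delta> = (0 :: (real^7) list \<Rightarrow> real)"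
  shows "\<delta> = 0"
proof (rule alt_basis_eq_0[OF \<delta>])
  fix J :: "7 list" assume J: "length J = 4" "distinct J"
  obtain K where K: "set K = - set J" "distinct K"
    using finite_distinct_list[of "- set J"] by auto
  have "length K = 3"
    using J K distinct_card[OF J(2)] distinct_card[OF K(2)]
    by (simp add: Compl_eq_Diff_UNIV card_Diff_subset)
  then obtain i j k where K': "K = [i, j, k]" by (auto simp: eval_nat_numeral length_Suc_conv)
  obtain a b c d where J': "J = [a, b, c, d]" using J by (auto simp: eval_nat_numeral length_Suc_conv)
  have ne: "i \<noteq> j" "i \<noteq> k" "j \<noteq> k" "a \<noteq> b" "a \<noteq> c" "a \<noteq> d" "b \<noteq> c" "b \<noteq> d" "c \<noteq> d"
    "i \<noteq> a" "i \<noteq> b" "i \<noteq> c" "i \<noteq> d" "j \<noteq> a" "j \<noteq> b" "j \<noteq> c" "j \<noteq> d" "k \<noteq> a" "k \<noteq> b" "k \<noteq> c" "k \<noteq> d"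
    using J(2) K unfolding J' K' by auto
  have "wedge (dx3 i j k) \<delta> (basis_vecs (K @ J)) =
      (\<Sum>(s, as, bs)\<leftarrow>shuffles_of 3 (basis_vecs (K @ J)). s * dx3 i j k as * \<delta> bs)"
    by (rule wedge_shuffles_of) (rule alt_length[OF dx3_alt])
  \<comment> \<open>On \<open>K @ J\<close> only the first shuffle contributes, with sign 1, because
    \<open>dx3 i j k\<close> vanishes on basis triples that contain an index from
    \<open>J\<close>.\<close>
  then have "0 = \<delta> (basis_vecs J)"
    unfolding 0[OF dx3_alt]
    by (simp add: J' K' eval_nat_numeral dx3_eval) (simp add: axis_def ne ne[symmetric])
  then show "\<delta> (basis_vecs J) = 0" by simp
qed

section \<open>The Euclidean volume form as a determinant\<close>

definition row_pos :: "7 \<Rightarrow> nat" where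
  "row_pos i = (if i = 1 then 0 else if i = 2 then 1 else if i = 3 then 2 else if i = 4 then 3
     else if i = 5 then 4 else if i = 6 then 5 else 6)"

lemma row_pos_simps [simp]: "row_pos 1 = 0" "row_pos 2 = 1" "row_pos 3 = 2" "row_pos 4 = 3"
  "row_pos 5 = 4" "row_pos 6 = 5" "row_pos 7 = 6"
  by (simp_all add: row_pos_def)

lemma row_pos_less [simp]: "row_pos i < 7"
  by (simp add: row_pos_def)

lemma row_pos_inj: "row_pos i = row_pos j \<longleftrightarrow> i = j"
proof -
  have "\<forall>i j. row_pos i = row_pos j \<longrightarrow> i = j" unfolding forall_7 by simp
  then show ?thesis by blast
qed

lemma row_pos_surj: "n < 7 \<Longrightarrow> \<exists>i. row_pos i = n"
proof -
  have "inj row_pos" by (simp add: inj_def row_pos_inj)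
  then have "range row_pos = {..<7}"
    by (intro card_subset_eq) (auto simp: card_image)
  then show "n < 7 \<Longrightarrow> \<exists>i. row_pos i = n" by (metis lessThan_iff rangeE)
qed

text \<open>Determinants are indexed by the type \<open>7\<close> and lists by position. The order
  is that of \<open>row_pos\<close>, because 7 and 0 are the same element of the type while its row
  has to come last.\<close>

definition row_matrix :: "(real^7) list \<Rightarrow> real^7^7" where
  "row_matrix vs = (\<chi> i. vs ! row_pos i)"

definition vol0 :: "(real^7) list \<Rightarrow> real" where
  "vol0 vs = (if length vs = 7 then det (row_matrix vs) else 0)"

lemma vol0_alt: "vol0 \<in> alt 7"
proof (rule altI)
  show "vol0 vs = 0" if "length vs \<noteq> 7" for vs using that by (simp add: vol0_def)
next
  fix as bs :: "(real^7) list" assume l: "Suc (length as + length bs) = 7"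
  then obtain k where k: "row_pos k = length as" using row_pos_surj[of "length as"] by auto
  \<comment> \<open>The 0 stands in the slot of \<open>v\<close>, so that the other rows do not
    mention \<open>v\<close>.\<close>
  have "row_matrix (as @ v # bs) = (\<chi> i. if i = k then v else (as @ 0 # bs) ! row_pos i)" for v
    using k by (auto simp: row_matrix_def vec_eq_iff nth_append nth_Cons' row_pos_inj[symmetric])
  then have 1: "vol0 (as @ v # bs) = det (\<chi> i. if i = k then v else (as @ 0 # bs) ! row_pos i)" for v
    using l by (simp add: vol0_def)
  show "linear (\<lambda>v. vol0 (as @ v # bs))"
    unfolding 1
    by (rule linearI) (simp_all add: det_row_add
      det_row_mul[of k "_::real" "\<lambda>_. _", unfolded scalar_mult_eq_scaleR])
next
  fix as bs :: "(real^7) list" and x assume l: "Suc (Suc (length as + length bs)) = 7"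
  obtain j where j: "row_pos j = length as" using row_pos_surj[of "length as"] l by auto
  obtain k where k: "row_pos k = Suc (length as)" using row_pos_surj[of "Suc (length as)"] l by auto
  have "j \<noteq> k" using j k by auto
  moreover have "row j (row_matrix (as @ x # x # bs)) = row k (row_matrix (as @ x # x # bs))"
    by (simp add: row_def row_matrix_def j k nth_append)
  ultimately have "det (row_matrix (as @ x # x # bs)) = 0" by (rule det_identical_rows)
  then show "vol0 (as @ x # x # bs) = 0" by (simp add: vol0_def)
qed

lemma row_matrix_std_basis: "row_matrix std_basis = mat 1"
proof -
  have "\<forall>i. std_basis ! row_pos i = axis i 1" unfolding forall_7 by (simp add: eval_nat_numeral)
  then show ?thesis by (simp add: row_matrix_def vec_eq_iff mat_def axis_def)
qed

lemma vol0_std_basis: "vol0 std_basis = 1"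
  unfolding vol0_def row_matrix_std_basis by simp

lemma vol0_orthonormal:
  assumes "length es = 7" "\<And>i j. i < 7 \<Longrightarrow> j < 7 \<Longrightarrow> es ! i \<bullet> es ! j = (if i = j then 1 else 0)"
  shows "\<bar>vol0 es\<bar> = 1"
proof -
  have "row_matrix es ** transpose (row_matrix es) = mat 1"
    using assms(2)
    by (simp add: vec_eq_iff matrix_matrix_mult_def transpose_def row_matrix_def mat_def row_pos_inj
        flip: inner_vec_def[where 'a=real, unfolded inner_real_def])
  then have "orthogonal_matrix (row_matrix es)"
    by (metis orthogonal_matrix orthogonal_matrix_transpose transpose_transpose)
  then show ?thesis using det_orthogonal_matrix assms(1) by (fastforce simp: vol0_def)
qed

lemma phi0_g2_metric_vol: "g2_metric_vol phi0 (\<bullet>) vol0"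
proof -
  have ip: "int_prod x phi0 \<in> alt 2" for x using int_prod_alt[of phi0 2] phi0_alt by simp
  have "wedge (wedge (int_prod u phi0) (int_prod v phi0)) phi0 = (6 * (u \<bullet> v)) *\<^sub>R vol0" for u v
  proof (rule alt7_eqI)
    show "wedge (wedge (int_prod u phi0) (int_prod v phi0)) phi0 \<in> alt 7"
      using wedge_alt[OF wedge_alt[OF ip ip] phi0_alt] by simp
  qed (simp_all only: phi0_metric scaleR_fun_def vol0_std_basis alt_scale[OF vol0_alt, unfolded scaleR_fun_def], simp)
  then show ?thesis
    unfolding g2_metric_vol_def inner_product_form_def volume_form_def
    by (auto simp: bilinear_def linear_inner vol0_alt inner_commute intro!: vol0_orthonormal)
qed

lemma psi0_hodge:
  assumes \<alpha>: "\<alpha> \<in> alt 3"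
  shows "wedge \<alpha> psi0 = contract 3 phi0 \<alpha> [] *\<^sub>R vol0"
proof (rule alt7_eqI)
  show "wedge \<alpha> psi0 \<in> alt 7" using wedge_alt[OF \<alpha> psi0_alt] by simp
qed (simp_all only: psi0_hodge_std[OF \<alpha>] scaleR_fun_def vol0_std_basis alt_scale[OF vol0_alt, unfolded scaleR_fun_def], simp)

section \<open>Adapted frames\<close>

lemma matrix_inv_eqI:
  fixes A B :: "'a::semiring_1^'n^'n"
  assumes "A ** B = mat 1" "B ** A = mat 1"
  shows "matrix_inv A = B"
proof -
  have "A ** matrix_inv A = mat 1 \<and> matrix_inv A ** A = mat 1"
    unfolding matrix_inv_def by (rule someI[of _ B]) (use assms in simp)
  then show ?thesis by (metis assms(2) matrix_mul_assoc matrix_mul_lid matrix_mul_rid)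
qed

text \<open>Index raising. Covectors are coefficient vectors under the dot product, so source and
  target are both \<open>real^7\<close>.\<close>

definition sharp :: "(real^7 \<Rightarrow> real^7 \<Rightarrow> real) \<Rightarrow> real^7 \<Rightarrow> real^7" where
  "sharp g \<xi> = \<xi> v* inverse_gram g"

lemma sharp_axis: "sharp g (axis i 1) = inverse_gram g $ i"
  by (simp add: sharp_def vector_matrix_mult_def vec_eq_iff axis_def if_distrib if_distribR sum.delta
      cong: if_cong)

lemma alt_expand_all:
  assumes \<beta>: "\<beta> \<in> alt l"
  shows "length I = k \<Longrightarrow> (\<Sum>J\<in>{J. length J = k}. (\<Prod>r<k. m (I ! r) $ (J ! r)) * \<beta> (as @ basis_vecs J)) = \<beta> (as @ map m I)"
proof (induction I arbitrary: k as)
  case (Cons i I)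
  then obtain n where n: "k = Suc n" "length I = n" by (cases k) auto
  have "(\<Sum>J\<in>{J. length J = k}. (\<Prod>r<k. m ((i # I) ! r) $ (J ! r)) * \<beta> (as @ basis_vecs J))
    = (\<Sum>j\<in>UNIV. m i $ j * (\<Sum>J\<in>{J. length J = n}. (\<Prod>r<n. m (I ! r) $ (J ! r)) * \<beta> ((as @ [axis j 1]) @ basis_vecs J)))"
    unfolding n sum_lists_Suc sum_distrib_left
    by (intro sum.cong refl) (simp add: prod.lessThan_Suc_shift mult_ac del: prod.lessThan_Suc)
  also have "\<dots> = (\<Sum>j\<in>UNIV. m i $ j * \<beta> (as @ axis j 1 # map m I))"
    unfolding Cons.IH[OF n(2)] by simp
  also have "\<dots> = \<beta> (as @ map m (i # I))" using alt_expand[OF \<beta>, of as "m i" "map m I"] by simp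
  finally show ?case .
qed simp

text \<open>Summing over \<open>J\<close> raises all arguments of \<open>\<beta>\<close>. The inner
  product thereby becomes a contraction and inherits its behaviour under frames.\<close>

lemma form_inner_contract:
  assumes "\<beta> \<in> alt l"
  shows "form_inner g k \<alpha> \<beta> = contract k (\<beta> \<circ> map (sharp g)) \<alpha> []"
proof -
  have "(\<Sum>J\<in>{J. length J = k}. (\<Prod>r<k. inverse_gram g $ (I ! r) $ (J ! r)) * \<alpha> (basis_vecs I) * \<beta> (basis_vecs J))
    = (\<beta> \<circ> map (sharp g)) (basis_vecs I) * \<alpha> (basis_vecs I @ [])" if "length I = k" for I
    using alt_expand_all[OF assms that, of "\<lambda>i. inverse_gram g $ i" "[]"]
    by (simp add: basis_vecs_def o_def sharp_axis sum_distrib_left[symmetric] mult_ac)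
  then show ?thesis unfolding form_inner_def contract_def by simp
qed

text \<open>\<open>L\<close> is a frame that turns the form into the model. The inverse is a
  separate parameter, so that metric, volume and dual form are obtained by composing with
  \<open>K\<close>.\<close>

locale adapted_frame =
  fixes \<phi> :: "(real^7) list \<Rightarrow> real" and L K :: "real^7 \<Rightarrow> real^7"
  assumes linear_L: "linear L" and linear_K: "linear K"
    and L_K [simp]: "L (K v) = v" and K_L [simp]: "K (L v) = v"
    and phi_L: "\<phi> \<circ> map L = phi0"
begin

lemma map_L_K [simp]: "map L (map K vs) = vs" "map K (map L vs) = vs"
  by (simp_all add: o_def)

lemma o_map_cancel [simp]: "\<omega> \<circ> map L \<circ> map K = \<omega>" "\<omega> \<circ> map K \<circ> map L = \<omega>"
  for \<omega> :: "(real^7) list \<Rightarrow> real"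
  by (simp_all add: fun_eq_iff o_def)

lemma phi_eq: "\<phi> = phi0 \<circ> map K"
  unfolding phi_L[symmetric] by simp

lemma phi_alt: "\<phi> \<in> alt 3"
  unfolding phi_eq by (intro alt_map phi0_alt linear_K)

lemma eq_if_L: "\<alpha> \<circ> map L = \<beta> \<circ> map L \<Longrightarrow> \<alpha> = \<beta>" for \<alpha> \<beta> :: "(real^7) list \<Rightarrow> real"
  by (metis o_map_cancel(1))

abbreviation g where "g u v \<equiv> K u \<bullet> K v"

abbreviation vol where "vol \<equiv> vol0 \<circ> map K"

abbreviation psi where "psi \<equiv> psi0 \<circ> map K"

lemma wedge_phi: "wedge (wedge (int_prod u \<phi>) (int_prod v \<phi>)) \<phi> = (6 * g u v) *\<^sub>R vol"
proof -
  have "int_prod u \<phi> = int_prod (K u) phi0 \<circ> map K" for u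
    by (simp add: phi_eq fun_eq_iff int_prod_def)
  then have "wedge (wedge (int_prod u \<phi>) (int_prod v \<phi>)) \<phi> =
      wedge (wedge (int_prod (K u) phi0) (int_prod (K v) phi0)) phi0 \<circ> map K"
    by (simp add: phi_eq wedge_map)
  also have "\<dots> = (6 * g u v) *\<^sub>R vol"
    using phi0_g2_metric_vol unfolding g2_metric_vol_def by (simp add: fun_eq_iff scaleR_fun_def)
  finally show ?thesis .
qed

lemma g2_metric_vol: "g2_metric_vol \<phi> g vol"
  unfolding g2_metric_vol_def
proof (intro conjI allI wedge_phi)
  show "inner_product_form g"
    unfolding inner_product_form_def bilinear_def
  proof (intro conjI allI impI)
    show "linear (\<lambda>y. K x \<bullet> K y)" "linear (\<lambda>y. K y \<bullet> K x)" for x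
      using linear_compose[OF linear_K linear_inner(1)] linear_compose[OF linear_K linear_inner(2)]
      by (simp_all add: o_def)
    show "0 < K v \<bullet> K v" if "v \<noteq> 0" for v
      using that K_L L_K linear_0[OF linear_L] by (metis inner_gt_zero_iff)
  qed (simp add: inner_commute)
  show "volume_form g vol"
    unfolding volume_form_def using alt_map[OF vol0_alt linear_K] by (auto intro!: vol0_orthonormal)
qed

text \<open>The defining equation determines only the product of metric and volume, which leaves
  \<open>h = g / c\<close> and \<open>v = c vol\<close>. The normalization of the volume on an
  orthonormal basis forces \<open>c = 1\<close>.\<close>

lemma g2_metric_vol_unique:
  assumes "g2_metric_vol \<phi> h v"
  shows "h = g \<and> v = vol"
proof -
  let ?b = "map L std_basis"
  have h: "inner_product_form h" and vol: "volume_form h v"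
    and w: "\<And>x y. (6 * h x y) *\<^sub>R v = (6 * g x y) *\<^sub>R vol"
    using assms unfolding g2_metric_vol_def wedge_phi by auto
  have v: "v \<in> alt 7" using vol unfolding volume_form_def by blast
  define c where "c = v ?b"
  have gc: "g x y = c * h x y" for x y
    using fun_cong[OF w[of x y], of ?b] vol0_std_basis
    by (simp add: scaleR_fun_def c_def o_def mult.commute)
  have "h (L (axis 1 1)) (L (axis 1 1)) > 0"
    using h linear_0[OF linear_K] K_L unfolding inner_product_form_def by (metis axis_eq_0_iff zero_neq_one)
  moreover have "c * h (L (axis 1 1)) (L (axis 1 1)) = 1"
    unfolding gc[symmetric] by (simp add: inner_axis)
  \<comment> \<open>Definiteness of \<open>h\<close> excludes the opposite orientation.\<close>
  ultimately have c: "c > 0" by (metis zero_less_mult_pos2 zero_less_one)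
  \<comment> \<open>An orthonormal basis for \<open>h\<close>, since \<open>h\<close> is
    \<open>g\<close> divided by \<open>c\<close>.\<close>
  define es where "es = map ((*\<^sub>R) (sqrt c)) ?b"
  have "h (es ! i) (es ! j) = (if i = j then 1 else 0)" if "i < 7" "j < 7" for i j
  proof -
    have bl: "bilinear h" using h unfolding inner_product_form_def by blast
    have "es ! i = sqrt c *\<^sub>R L (std_basis ! i)" "es ! j = sqrt c *\<^sub>R L (std_basis ! j)"
      using that by (simp_all add: es_def del: basis_vecs_simps(2))
    then have "h (es ! i) (es ! j) = c * h (L (std_basis ! i)) (L (std_basis ! j))"
      using c by (simp add: bilinear_lmul[OF bl] bilinear_rmul[OF bl] del: basis_vecs_simps(2))
    also have "\<dots> = std_basis ! i \<bullet> std_basis ! j" unfolding gc[symmetric] by simp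
    also have "\<dots> = (if i = j then 1 else 0)"
    proof -
      obtain a b where ab: "row_pos a = i" "row_pos b = j" using \<open>i < 7\<close> \<open>j < 7\<close> row_pos_surj by metis
      have "std_basis ! row_pos a = axis a 1" for a
        using row_matrix_std_basis by (simp add: row_matrix_def vec_eq_iff mat_def axis_def)
      then show ?thesis unfolding ab[symmetric] row_pos_inj by (simp add: inner_axis_axis)
    qed
    finally show ?thesis .
  qed
  moreover have "length es = 7" by (simp add: es_def)
  ultimately have "\<bar>v es\<bar> = 1" using vol unfolding volume_form_def by blast
  moreover have "v es = sqrt c ^ 7 * c"
  proof -
    have "length ?b = 7" by simp
    then show ?thesis using alt_scale_all[OF v, of "[]" "sqrt c" ?b]
      unfolding es_def c_def[symmetric] append_Nil by metis
  qed
  ultimately have "sqrt c ^ 7 * c = 1" using c by simp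
  then have "c = 1"
  proof -
    \<comment> \<open>Seven factors come from the basis vectors and two from \<open>c\<close>
      itself.\<close>
    have "sqrt c ^ 9 = 1" using \<open>sqrt c ^ 7 * c = 1\<close> c by (simp add: eval_nat_numeral mult_ac)
    then have "sqrt c = 1" using power_eq_1_iff c
      by (metis abs_of_nonneg less_eq_real_def real_sqrt_ge_zero real_norm_def zero_neq_numeral)
    then show ?thesis by simp
  qed
  then have "h = g" using gc by (simp add: fun_eq_iff)
  moreover have "v = vol"
    using w[of "L (axis 1 1)" "L (axis 1 1)"] unfolding \<open>h = g\<close> by (simp add: inner_axis)
  ultimately show ?thesis by blast
qed

lemma g2_metric_eq: "g2_metric \<phi> = g"
  unfolding g2_metric_def using g2_metric_vol g2_metric_vol_unique by (intro the_equality) blast+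

lemma g2_vol_eq: "g2_vol \<phi> = vol"
  unfolding g2_vol_def using g2_metric_vol g2_metric_vol_unique by (intro the_equality) blast+

definition gram :: "real^7^7" where "gram = (\<chi> i j. g (axis i 1) (axis j 1))"

lemma gram_eq: "gram = transpose (matrix K) ** matrix K"
  by (simp add: gram_def vec_eq_iff matrix_matrix_mult_def transpose_def matrix_def inner_vec_def)

lemma gram_inverse:
  "gram ** (matrix L ** transpose (matrix L)) = mat 1"
  "(matrix L ** transpose (matrix L)) ** gram = mat 1"
proof -
  have KL: "matrix K ** matrix L = mat 1" "matrix L ** matrix K = mat 1"
    using matrix_compose[OF linear_L linear_K] matrix_compose[OF linear_K linear_L]
    by (simp_all add: o_def matrix_id_mat_1[unfolded id_def])
  then have "transpose (matrix K) ** transpose (matrix L) = mat 1" "transpose (matrix L) ** transpose (matrix K) = mat 1"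
    by (metis matrix_transpose_mul transpose_mat)+
  with KL show "gram ** (matrix L ** transpose (matrix L)) = mat 1"
      "(matrix L ** transpose (matrix L)) ** gram = mat 1"
    unfolding gram_eq by (metis matrix_mul_assoc matrix_mul_lid matrix_mul_rid)+
qed

lemma inverse_gram_eq: "inverse_gram (g2_metric \<phi>) = matrix L ** transpose (matrix L)"
  unfolding inverse_gram_def g2_metric_eq using gram_inverse unfolding gram_def
  by (rule matrix_inv_eqI)

text \<open>The Gram matrix is the transpose of \<open>K\<close> times \<open>K\<close>, so its
  inverse is \<open>L\<close> times the transpose of \<open>L\<close>. In this shape the behaviour
  of raising under changes of charts is visible.\<close>

lemma sharp_eq: "sharp (g2_metric \<phi>) \<xi> = L (adjoint L \<xi>)"
proof -
  have "sharp (g2_metric \<phi>) \<xi> = (matrix L ** transpose (matrix L)) *v \<xi>"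
    unfolding sharp_def inverse_gram_eq
    by (metis matrix_transpose_mul transpose_matrix_vector transpose_transpose)
  also have "\<dots> = L (adjoint L \<xi>)"
    by (metis adjoint_linear linear_L matrix_adjoint matrix_vector_mul matrix_vector_mul_assoc)
  finally show ?thesis .
qed

lemma sharp_adjoint_K: "sharp (g2_metric \<phi>) (adjoint K \<xi>) = L \<xi>"
proof -
  have "adjoint L (adjoint K \<xi>) = \<xi>"
  proof (rule vector_eq_ldot[THEN iffD1], rule allI)
    fix z show "z \<bullet> adjoint L (adjoint K \<xi>) = z \<bullet> \<xi>"
      by (simp add: adjoint_works linear_L linear_K)
  qed
  then show ?thesis by (simp add: sharp_eq)
qed

text \<open>In the frame the metric is Euclidean and raising becomes the identity. Identities that
  combine raising and contraction thus reduce to those of \<open>phi0\<close> and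
  \<open>psi0\<close>.\<close>

lemma contract_sharp:
  assumes "\<omega> \<in> alt q" "\<eta> \<in> alt l"
  shows "contract q (\<omega> \<circ> map (sharp (g2_metric \<phi>))) \<eta> \<circ> map L = contract q (\<omega> \<circ> map L) (\<eta> \<circ> map L)"
proof -
  let ?Q = "\<omega> \<circ> map (sharp (g2_metric \<phi>))"
  have "sharp (g2_metric \<phi>) = L \<circ> adjoint L" by (simp add: fun_eq_iff sharp_eq)
  then have "linear (sharp (g2_metric \<phi>))"
    using linear_compose[OF adjoint_linear[OF linear_L] linear_L] by simp
  then have "?Q \<in> alt q" using assms(1) by (rule alt_map[rotated])
  moreover have "?Q \<circ> map (adjoint K) = \<omega> \<circ> map L"
    by (simp add: fun_eq_iff o_def sharp_adjoint_K)
  moreover have "L \<circ> K = id" by (simp add: fun_eq_iff)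
  ultimately show ?thesis using contract_frame[OF linear_L linear_K _ _ assms(2)] by metis
qed

text \<open>Existence transports \<open>psi0_hodge\<close> along the frame; uniqueness is
  \<open>alt4_eq_0\<close>.\<close>

lemma hodge_star_phi: "hodge_star (g2_metric \<phi>) (g2_vol \<phi>) 3 \<phi> = psi"
  unfolding hodge_star_def g2_vol_eq
proof (rule the_equality)
  have *: "wedge \<alpha> psi = form_inner (g2_metric \<phi>) 3 \<alpha> \<phi> *\<^sub>R vol" if \<alpha>: "\<alpha> \<in> alt 3" for \<alpha>
  proof -
    have "form_inner (g2_metric \<phi>) 3 \<alpha> \<phi> = (contract 3 (\<phi> \<circ> map (sharp (g2_metric \<phi>))) \<alpha> \<circ> map L) []"
      by (simp add: form_inner_contract[OF phi_alt])
    also have "\<dots> = contract 3 phi0 (\<alpha> \<circ> map L) []"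
      unfolding contract_sharp[OF phi_alt \<alpha>] phi_L ..
    finally have "form_inner (g2_metric \<phi>) 3 \<alpha> \<phi> *\<^sub>R vol = (contract 3 phi0 (\<alpha> \<circ> map L) [] *\<^sub>R vol0) \<circ> map K"
      by (simp add: fun_eq_iff scaleR_fun_def)
    also have "\<dots> = wedge (\<alpha> \<circ> map L) psi0 \<circ> map K"
      using psi0_hodge[OF alt_map[OF \<alpha> linear_L]] by simp
    also have "\<dots> = wedge \<alpha> psi" unfolding wedge_map[symmetric] by simp
    finally show ?thesis ..
  qed
  show "psi \<in> alt (7 - 3) \<and> (\<forall>\<alpha>\<in>alt 3. wedge \<alpha> psi = form_inner (g2_metric \<phi>) 3 \<alpha> \<phi> *\<^sub>R vol)"
    using * alt_map[OF psi0_alt linear_K] by simp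
  fix \<eta> assume \<eta>: "\<eta> \<in> alt (7 - 3) \<and> (\<forall>\<alpha>\<in>alt 3. wedge \<alpha> \<eta> = form_inner (g2_metric \<phi>) 3 \<alpha> \<phi> *\<^sub>R vol)"
  have "\<eta> - psi = 0"
  proof (rule alt4_eq_0)
    show "\<eta> - psi \<in> alt 4" using \<eta> alt_map[OF psi0_alt linear_K] by (intro alt_diff) simp_all
    show "wedge \<alpha> (\<eta> - psi) = 0" if "\<alpha> \<in> alt 3" for \<alpha>
      using \<eta> *[OF that] that unfolding wedge_diff_right by (metis diff_self)
  qed
  then show "\<eta> = psi" by simp
qed

text \<open>Eliminates the frame: the sum over its vectors becomes the inverse Gram matrix, so the
  dual form is an expression in \<open>\<phi>\<close> and the metric and its smoothness can be read
  off.\<close>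

lemma psi_eval: "psi [u, v, w, x] =
    (\<Sum>i\<in>UNIV. \<Sum>j\<in>UNIV. inverse_gram (g2_metric \<phi>) $ i $ j * \<phi> [u, v, axis i 1] * \<phi> [w, x, axis j 1])
    - g2_metric \<phi> u w * g2_metric \<phi> v x + g2_metric \<phi> u x * g2_metric \<phi> v w"
proof -
  have "phi0 [K u, K v, axis m 1] = (\<Sum>i\<in>UNIV. L (axis m 1) $ i * \<phi> [u, v, axis i 1])" for u v m
    using alt_expand[OF phi_alt, of "[u, v]" "L (axis m 1)" "[]"] unfolding phi_L[symmetric] by simp
  then have "(\<Sum>m\<in>UNIV. phi0 [K u, K v, axis m 1] * phi0 [K w, K x, axis m 1]) =
    (\<Sum>m\<in>UNIV. \<Sum>i\<in>UNIV. \<Sum>j\<in>UNIV. (L (axis m 1) $ i * L (axis m 1) $ j) * \<phi> [u, v, axis i 1] * \<phi> [w, x, axis j 1])"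
    by (simp add: sum_product mult_ac)
  also have "\<dots> = (\<Sum>i\<in>UNIV. \<Sum>j\<in>UNIV. \<Sum>m\<in>UNIV. (L (axis m 1) $ i * L (axis m 1) $ j) * \<phi> [u, v, axis i 1] * \<phi> [w, x, axis j 1])"
    by (subst sum.swap) (intro sum.cong refl sum.swap)
  also have "\<dots> = (\<Sum>i\<in>UNIV. \<Sum>j\<in>UNIV. inverse_gram (g2_metric \<phi>) $ i $ j * \<phi> [u, v, axis i 1] * \<phi> [w, x, axis j 1])"
    unfolding inverse_gram_eq
    by (simp add: matrix_matrix_mult_def transpose_def matrix_def sum_distrib_right)
  finally show ?thesis by (simp add: psi0_eval g2_metric_eq)
qed

end

section \<open>Inverting the contractions in an adapted frame\<close>

context adapted_frame
begin

abbreviation raise :: "((real^7) list \<Rightarrow> real) \<Rightarrow> (real^7) list \<Rightarrow> real" where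
  "raise \<omega> \<equiv> \<omega> \<circ> map (sharp (g2_metric \<phi>))"

lemma psi_alt: "psi \<in> alt 4"
  by (intro alt_map psi0_alt linear_K)

lemma contract_phi_alt: "contract 1 Q \<phi> \<in> alt 2" "contract 2 Q \<phi> \<in> alt 1"
  using contract_alt[of \<phi> 1 2] contract_alt[of \<phi> 2 1] phi_alt by (simp_all del: One_nat_def)

lemma contract_psi_alt: "contract 1 Q psi \<in> alt 3" "contract 2 Q psi \<in> alt 2" "contract 3 Q psi \<in> alt 1"
  using contract_alt[of psi 1 3] contract_alt[of psi 2 2] contract_alt[of psi 3 1] psi_alt
  by (simp_all del: One_nat_def)

lemma scaleR_o: "(r *\<^sub>R \<omega>) \<circ> f = r *\<^sub>R (\<omega> \<circ> f)" for \<omega> :: "'b \<Rightarrow> real"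
  by (simp add: fun_eq_iff scaleR_fun_def)

lemma plus_o: "(\<omega> + \<eta>) \<circ> f = (\<omega> \<circ> f) + (\<eta> \<circ> f)" for \<omega> :: "'b \<Rightarrow> real"
  by (simp add: fun_eq_iff)

lemma contract_phi_phi:
  assumes \<alpha>: "\<alpha> \<in> alt 1"
  shows "contract 2 (raise (contract 1 (raise \<alpha>) \<phi>)) \<phi> = 3 *\<^sub>R \<alpha>"
proof (rule eq_if_L)
  show "contract 2 (raise (contract 1 (raise \<alpha>) \<phi>)) \<phi> \<circ> map L = (3 *\<^sub>R \<alpha>) \<circ> map L"
    unfolding contract_sharp[OF contract_phi_alt(1) phi_alt] contract_sharp[OF \<alpha> phi_alt] phi_L scaleR_o
    by (rule contract_phi0_phi0[OF alt_map[OF \<alpha> linear_L]])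
qed

lemma contract_psi_psi_3:
  assumes \<alpha>: "\<alpha> \<in> alt 1"
  shows "contract 3 (raise (contract 1 (raise \<alpha>) psi)) psi = (-4) *\<^sub>R \<alpha>"
proof (rule eq_if_L)
  show "contract 3 (raise (contract 1 (raise \<alpha>) psi)) psi \<circ> map L = ((-4) *\<^sub>R \<alpha>) \<circ> map L"
    unfolding contract_sharp[OF contract_psi_alt(1) psi_alt] contract_sharp[OF \<alpha> psi_alt] o_map_cancel scaleR_o
    by (rule contract_psi0_psi0_3[OF alt_map[OF \<alpha> linear_L]])
qed

lemma contract_psi_psi_2:
  assumes \<omega>: "\<omega> \<in> alt 2"
  shows "contract 2 (raise (contract 2 (raise \<omega>) psi)) psi = contract 2 (raise \<omega>) psi + 2 *\<^sub>R \<omega>"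
proof (rule eq_if_L)
  show "contract 2 (raise (contract 2 (raise \<omega>) psi)) psi \<circ> map L = (contract 2 (raise \<omega>) psi + 2 *\<^sub>R \<omega>) \<circ> map L"
    unfolding contract_sharp[OF contract_psi_alt(2) psi_alt] contract_sharp[OF \<omega> psi_alt] o_map_cancel scaleR_o
      plus_o
    by (rule contract_psi0_psi0_2[OF alt_map[OF \<omega> linear_L]])
qed

lemma raise_surj:
  assumes "Q \<in> alt q"
  obtains \<omega> where "\<omega> \<in> alt q" "Q = raise \<omega>"
proof
  \<comment> \<open>\<open>adjoint K \<circ> K\<close> lowers indices: it is the Gram map, inverse
    to \<open>sharp\<close>.\<close>
  show "Q \<circ> map (adjoint K \<circ> K) \<in> alt q"
    using assms by (rule alt_map) (intro linear_compose linear_K adjoint_linear)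
  have "adjoint K (adjoint L \<xi>) = \<xi>" for \<xi>
  proof (rule vector_eq_ldot[THEN iffD1], rule allI)
    fix z show "z \<bullet> adjoint K (adjoint L \<xi>) = z \<bullet> \<xi>"
      by (simp add: adjoint_works linear_L linear_K)
  qed
  then show "Q = raise (Q \<circ> map (adjoint K \<circ> K))"
    by (simp add: fun_eq_iff sharp_eq o_def)
qed

lemma zero_o: "(0 :: 'b \<Rightarrow> real) \<circ> f = 0"
  by (simp add: fun_eq_iff)

lemma contract_zero_left: "contract q 0 \<omega> = 0"
  by (simp add: contract_def fun_eq_iff)

text \<open>Every multivector is a raised form, and the formulas for repeated contraction turn a
  vanishing contraction into the vanishing of a nonzero multiple of that form.\<close>

lemma contract_injI:
  assumes "Q \<in> alt q" "contract q Q \<eta> = 0"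
    and "\<And>\<omega>. \<omega> \<in> alt q \<Longrightarrow> contract q (raise \<omega>) \<eta> = 0 \<Longrightarrow> r *\<^sub>R \<omega> = 0" and "r \<noteq> 0"
  shows "Q = 0"
proof -
  obtain \<omega> where \<omega>: "\<omega> \<in> alt q" "Q = raise \<omega>" using raise_surj[OF assms(1)] .
  have "r *\<^sub>R \<omega> = 0" using assms(2) unfolding \<omega>(2) by (rule assms(3)[OF \<omega>(1)])
  then show ?thesis using assms(4) unfolding \<omega>(2) by (simp add: zero_o)
qed

lemma contract_1_phi_inj: "Q \<in> alt 1 \<Longrightarrow> contract 1 Q \<phi> = 0 \<Longrightarrow> Q = 0"
proof (rule contract_injI)
  show "3 *\<^sub>R \<omega> = 0" if "\<omega> \<in> alt 1" "contract 1 (raise \<omega>) \<phi> = 0" for \<omega>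
    using contract_phi_phi[OF that(1)] unfolding that(2) by (simp add: zero_o contract_zero_left)
qed simp_all

lemma contract_1_psi_inj: "Q \<in> alt 1 \<Longrightarrow> contract 1 Q psi = 0 \<Longrightarrow> Q = 0"
proof (rule contract_injI)
  show "(-4) *\<^sub>R \<omega> = 0" if "\<omega> \<in> alt 1" "contract 1 (raise \<omega>) psi = 0" for \<omega>
    using contract_psi_psi_3[OF that(1)] unfolding that(2) by (simp add: zero_o contract_zero_left)
qed simp_all

lemma contract_2_psi_inj: "Q \<in> alt 2 \<Longrightarrow> contract 2 Q psi = 0 \<Longrightarrow> Q = 0"
proof (rule contract_injI)
  show "2 *\<^sub>R \<omega> = 0" if "\<omega> \<in> alt 2" "contract 2 (raise \<omega>) psi = 0" for \<omega>
    using contract_psi_psi_2[OF that(1)] unfolding that(2) by (simp add: zero_o contract_zero_left)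
qed simp_all

section \<open>Determinants that recover the coordinate volume\<close>

lemma vol_std_basis: "vol std_basis = det (matrix K)"
proof -
  have "std_basis ! row_pos i = axis i 1" for i
    using row_matrix_std_basis by (simp add: row_matrix_def vec_eq_iff mat_def axis_def)
  then have "map K std_basis ! row_pos i = K (axis i 1)" for i
    by (subst nth_map) (use row_pos_less[of i] in \<open>simp_all add: eval_nat_numeral\<close>)
  then have "row_matrix (map K std_basis) = transpose (matrix K)"
    by (simp add: row_matrix_def vec_eq_iff transpose_def matrix_def del: basis_vecs_simps(2))
  then show ?thesis by (simp add: vol0_def det_transpose del: basis_vecs_simps(2))
qed

lemma det_gram: "det gram = det (matrix K) ^ 2"
  by (simp add: gram_eq det_mul det_transpose power2_eq_square)

lemma det_K_nonzero: "det (matrix K) \<noteq> 0"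
  using gram_inverse(1) det_mul[of gram] det_gram by (metis det_I mult_zero_left power_zero_numeral zero_neq_one)

text \<open>Its entries are cubic polynomials in the components of \<open>\<phi>\<close>, so they
  are smooth without any choice of frames.\<close>

definition metric_density :: "real^7^7" where
  "metric_density = (\<chi> i j. wedge (wedge (int_prod (axis i 1) \<phi>) (int_prod (axis j 1) \<phi>)) \<phi> std_basis)"

lemma metric_density_eq: "metric_density = (6 * det (matrix K)) *\<^sub>R gram"
proof -
  have "wedge (wedge (int_prod u \<phi>) (int_prod v \<phi>)) \<phi> std_basis = 6 * g u v * det (matrix K)" for u v
    unfolding wedge_phi scaleR_fun_def vol_std_basis by simp
  then show ?thesis unfolding metric_density_def gram_def by (simp add: vec_eq_iff)
qed

text \<open>With \<open>v = det (matrix K)\<close>, dimension 7 gives the factors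
  \<open>6 ^ 7\<close> and \<open>v ^ 7\<close>, and the Gram determinant adds
  \<open>v ^ 2\<close>.\<close>

lemma det_metric_density: "det metric_density = 6 ^ 7 * det (matrix K) ^ 9"
proof -
  have "det (c *\<^sub>R A) = c ^ 7 * det A" for c and A :: "real^7^7"
    using det_rows_mul[of "\<lambda>_. c" "\<lambda>i. A $ i"]
    by (simp add: scalar_mult_eq_scaleR) (simp add: scaleR_vec_def)
  then show ?thesis by (simp add: metric_density_eq det_gram power_mult_distrib flip: power_add)
qed

end

text \<open>Carries a frame to another chart, with \<open>A\<close> the derivative of the transition
  map and \<open>\<phi>\<close>, \<open>\<phi>'\<close> the representatives of one form in the two
  charts.\<close>

lemma adapted_frame_change:
  assumes "adapted_frame \<phi> L K" and A: "linear A" "linear B" "\<And>x. A (B x) = x" "\<And>x. B (A x) = x"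
    and \<phi>: "\<phi> = \<phi>' \<circ> map A"
  shows "adapted_frame \<phi>' (A \<circ> L) (K \<circ> B)"
proof -
  interpret adapted_frame \<phi> L K by fact
  show ?thesis
  proof (rule adapted_frame.intro)
    show "\<phi>' \<circ> map (A \<circ> L) = phi0" using phi_L unfolding \<phi> by (simp add: fun_eq_iff)
    show "linear (A \<circ> L)" "linear (K \<circ> B)"
      using A(1,2) linear_L linear_K by (auto intro: linear_compose)
  qed (simp_all add: A)
qed

section \<open>Smooth functions\<close>

lemma frechet_derivative_cong:
  assumes "open S" "x \<in> S" "\<And>y. y \<in> S \<Longrightarrow> f y = g y"
  shows "frechet_derivative f (at x) = frechet_derivative g (at x)"
proof -
  have "(f has_derivative D) (at x) \<longleftrightarrow> (g has_derivative D) (at x)" for D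
    using has_derivative_transform_within_open[of f D x UNIV S g]
      has_derivative_transform_within_open[of g D x UNIV S f] assms by auto
  then show ?thesis unfolding frechet_derivative_def by simp
qed

lemma Ck_on_cong:
  assumes S: "open S" and eq: "\<And>x. x \<in> S \<Longrightarrow> f x = g x"
  shows "Ck_on k f S \<longleftrightarrow> Ck_on k g S"
proof -
  have "Ck_on k g S" if "Ck_on k f S" "\<And>x. x \<in> S \<Longrightarrow> f x = g x" for f g
    using that
  proof (induction k arbitrary: f g)
    case 0
    then show ?case using continuous_on_cong[OF refl, of S f g] by simp
  next
    case (Suc k)
    have "g differentiable_on S"
      using Suc.prems by (auto simp: differentiable_on_def intro: differentiable_transform_within[OF _ zero_less_one])
    moreover have "Ck_on k (\<lambda>x. frechet_derivative g (at x) v) S" for v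
      using Suc.IH[of "\<lambda>x. frechet_derivative f (at x) v" "\<lambda>x. frechet_derivative g (at x) v"]
        Suc.prems frechet_derivative_cong[OF S _ Suc.prems(2)] by simp
    ultimately show ?case by simp
  qed
  from this[of f g] this[of g f] show ?thesis using eq by auto
qed

lemma Ck_on_SucD: "Ck_on (Suc k) f S \<Longrightarrow> Ck_on k f S"
  by (induction k arbitrary: f) (auto intro: differentiable_imp_continuous_on)

lemma differentiable_onD: "f differentiable_on S \<Longrightarrow> open S \<Longrightarrow> x \<in> S \<Longrightarrow> f differentiable (at x)"
  by (metis at_within_open differentiable_on_def)

text \<open>Accepts any derivative formula valid on \<open>S\<close> in place of
  \<open>frechet_derivative\<close>.\<close>

lemma Ck_on_SucI:
  assumes S: "open S" and D: "\<And>x. x \<in> S \<Longrightarrow> (f has_derivative D x) (at x)"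
    and k: "\<And>v. Ck_on k (\<lambda>x. D x v) S"
  shows "Ck_on (Suc k) f S"
proof -
  have "f differentiable_on S"
    using D has_derivative_at_withinI unfolding differentiable_on_def differentiable_def by blast
  moreover have "frechet_derivative f (at x) = D x" if "x \<in> S" for x
    using frechet_derivative_at[OF D[OF that]] ..
  ultimately show ?thesis
    using k Ck_on_cong[OF S, of "\<lambda>x. frechet_derivative f (at x) _" "\<lambda>x. D x _"] by simp
qed

lemma Ck_on_SucE:
  assumes "Ck_on (Suc k) f S" "open S"
  shows "x \<in> S \<Longrightarrow> (f has_derivative frechet_derivative f (at x)) (at x)"
    and "Ck_on k (\<lambda>x. frechet_derivative f (at x) v) S" and "Ck_on k f S"
  using assms differentiable_onD[of f S x] Ck_on_SucD[OF assms(1)]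
  by (auto simp: frechet_derivative_works[symmetric])

lemma Ck_on_const: "open S \<Longrightarrow> Ck_on k (\<lambda>x. c) S"
proof (induction k arbitrary: c)
  case (Suc k)
  then show ?case by (intro Ck_on_SucI[where D="\<lambda>_ _. 0"]) auto
qed simp

lemma Ck_on_add: "open S \<Longrightarrow> Ck_on k f S \<Longrightarrow> Ck_on k g S \<Longrightarrow> Ck_on k (\<lambda>x. f x + g x) S"
proof (induction k arbitrary: f g)
  case (Suc k)
  note f = Ck_on_SucE[OF Suc.prems(2,1)] and g = Ck_on_SucE[OF Suc.prems(3,1)]
  show ?case
    by (rule Ck_on_SucI[OF Suc.prems(1) has_derivative_add[OF f(1) g(1)] Suc.IH[OF Suc.prems(1) f(2) g(2)]])
qed (auto intro: continuous_intros)

lemma Ck_on_mult: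
  fixes f g :: "'a::euclidean_space \<Rightarrow> real"
  shows "open S \<Longrightarrow> Ck_on k f S \<Longrightarrow> Ck_on k g S \<Longrightarrow> Ck_on k (\<lambda>x. f x * g x) S"
proof (induction k arbitrary: f g)
  case (Suc k)
  note f = Ck_on_SucE[OF Suc.prems(2,1)] and g = Ck_on_SucE[OF Suc.prems(3,1)]
  show ?case
    by (rule Ck_on_SucI[OF Suc.prems(1) has_derivative_mult[OF f(1) g(1)]], assumption, assumption)
      (intro Ck_on_add Suc.IH Suc.prems f g)
qed (auto intro: continuous_intros)

text \<open>The derivative of the reciprocal is built from the derivative of \<open>f\<close> and
  the reciprocal itself, so the induction hypothesis covers it.\<close>

lemma Ck_on_inverse:
  fixes f :: "'a::euclidean_space \<Rightarrow> real"
  shows "open S \<Longrightarrow> Ck_on k f S \<Longrightarrow> (\<And>x. x \<in> S \<Longrightarrow> f x \<noteq> 0) \<Longrightarrow> Ck_on k (\<lambda>x. inverse (f x)) S"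
proof (induction k)
  case (Suc k)
  note f = Ck_on_SucE[OF Suc.prems(2,1)]
  have "Ck_on k (\<lambda>x. (-1) * (inverse (f x) * frechet_derivative f (at x) v * inverse (f x))) S" for v
    by (intro Ck_on_mult Ck_on_const Suc.IH Suc.prems f)
  then show ?case
    by (intro Ck_on_SucI[OF Suc.prems(1) Deriv.has_derivative_inverse[OF Suc.prems(3) f(1)]]) simp_all
qed (auto intro: continuous_intros)

text \<open>An odd root is differentiable away from 0 for either sign, and its derivative is
  expressed through the root itself, which closes the induction.\<close>

lemma Ck_on_root9:
  fixes f :: "'a::euclidean_space \<Rightarrow> real"
  shows "open S \<Longrightarrow> Ck_on k f S \<Longrightarrow> (\<And>x. x \<in> S \<Longrightarrow> f x \<noteq> 0) \<Longrightarrow> Ck_on k (\<lambda>x. root 9 (f x)) S"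
proof (induction k)
  case (Suc k)
  note f = Ck_on_SucE[OF Suc.prems(2,1)]
  have root: "Ck_on k (\<lambda>x. root 9 (f x)) S" by (intro Suc.IH Suc.prems f)
  note op = \<open>open S\<close>
  have pow: "Ck_on k (\<lambda>x. root 9 (f x) ^ n) S" for n
    by (induction n) (simp_all add: Ck_on_const op Ck_on_mult root)
  have "Ck_on k (\<lambda>x. frechet_derivative f (at x) v * inverse (9 * root 9 (f x) ^ 8)) S" for v
    by (intro Ck_on_mult Ck_on_inverse Ck_on_const pow Suc.prems f) (use Suc.prems(3) in auto)
  moreover have "((\<lambda>x. root 9 (f x)) has_derivative (\<lambda>v. frechet_derivative f (at x) v * inverse (9 * root 9 (f x) ^ 8))) (at x)"
    if "x \<in> S" for x
    using DERIV_compose_FDERIV[OF DERIV_odd_real_root[of 9 "f x"] f(1)[OF that]] Suc.prems(3)[OF that] by simp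
  ultimately show ?case by (intro Ck_on_SucI[OF Suc.prems(1)])
qed (auto intro!: continuous_intros)

lemma Ck_on_sum: "open S \<Longrightarrow> (\<And>i. i \<in> I \<Longrightarrow> Ck_on k (f i) S) \<Longrightarrow> Ck_on k (\<lambda>x. \<Sum>i\<in>I. f i x) S"
  by (induction I rule: infinite_finite_induct) (auto intro: Ck_on_const Ck_on_add)

lemma Ck_on_prod:
  fixes f :: "'i \<Rightarrow> 'a::euclidean_space \<Rightarrow> real"
  shows "open S \<Longrightarrow> (\<And>i. i \<in> I \<Longrightarrow> Ck_on k (f i) S) \<Longrightarrow> Ck_on k (\<lambda>x. \<Prod>i\<in>I. f i x) S"
  by (induction I rule: infinite_finite_induct) (auto intro: Ck_on_const Ck_on_mult)

section \<open>Closure properties of smooth functions on an open set\<close>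

context
  fixes S :: "'a::euclidean_space set"
  assumes S: "open S"
begin

lemma smooth_on_cong: "(\<And>x. x \<in> S \<Longrightarrow> f x = g x) \<Longrightarrow> smooth_on f S \<longleftrightarrow> smooth_on g S"
  unfolding smooth_on_def using Ck_on_cong[OF S] by blast

lemma smooth_on_const: "smooth_on (\<lambda>x. c) S"
  by (simp add: smooth_on_def Ck_on_const S)

lemma smooth_on_add: "smooth_on f S \<Longrightarrow> smooth_on g S \<Longrightarrow> smooth_on (\<lambda>x. f x + g x) S"
  by (simp add: smooth_on_def Ck_on_add S)

lemma smooth_on_mult: "smooth_on f S \<Longrightarrow> smooth_on g S \<Longrightarrow> smooth_on (\<lambda>x. f x * g x :: real) S"
  by (simp add: smooth_on_def Ck_on_mult S)

lemma smooth_on_if: "smooth_on f S \<Longrightarrow> smooth_on g S \<Longrightarrow> smooth_on (\<lambda>x. if b then f x else g x) S"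
  by (cases b) auto

lemma smooth_on_minus: "smooth_on f S \<Longrightarrow> smooth_on (\<lambda>x. - f x :: real) S"
  using smooth_on_mult[OF smooth_on_const[of "-1"], of f] by simp

lemma smooth_on_diff: "smooth_on f S \<Longrightarrow> smooth_on g S \<Longrightarrow> smooth_on (\<lambda>x. f x - g x :: real) S"
  using smooth_on_add[OF _ smooth_on_minus, of f g] by simp

lemma smooth_on_divide:
  "smooth_on f S \<Longrightarrow> smooth_on g S \<Longrightarrow> (\<And>x. x \<in> S \<Longrightarrow> g x \<noteq> 0) \<Longrightarrow> smooth_on (\<lambda>x. f x / g x :: real) S"
  unfolding divide_inverse by (simp add: smooth_on_def Ck_on_mult Ck_on_inverse S)

lemma smooth_on_root9:
  "smooth_on f S \<Longrightarrow> (\<And>x. x \<in> S \<Longrightarrow> f x \<noteq> 0) \<Longrightarrow> smooth_on (\<lambda>x. root 9 (f x)) S"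
  by (simp add: smooth_on_def Ck_on_root9 S)

lemma smooth_on_sum: "(\<And>i. i \<in> I \<Longrightarrow> smooth_on (f i) S) \<Longrightarrow> smooth_on (\<lambda>x. \<Sum>i\<in>I. f i x) S"
  by (simp add: smooth_on_def Ck_on_sum S)

lemma smooth_on_prod: "(\<And>i. i \<in> I \<Longrightarrow> smooth_on (f i) S) \<Longrightarrow> smooth_on (\<lambda>x. \<Prod>i\<in>I. f i x :: real) S"
  by (simp add: smooth_on_def Ck_on_prod S)

lemma smooth_on_has_derivative:
  "smooth_on f S \<Longrightarrow> x \<in> S \<Longrightarrow> (f has_derivative frechet_derivative f (at x)) (at x)"
  using Ck_on_SucE(1)[of 0 f S x] S unfolding smooth_on_def by blast

lemma smooth_on_frechet_derivative:
  "smooth_on f S \<Longrightarrow> smooth_on (\<lambda>x. frechet_derivative f (at x) v) S"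
  using Ck_on_SucE(2)[of _ f S v] S unfolding smooth_on_def by blast

lemma smooth_on_det:
  fixes A :: "'a \<Rightarrow> real^'n^'n"
  assumes "\<And>i j. smooth_on (\<lambda>x. A x $ i $ j) S"
  shows "smooth_on (\<lambda>x. det (A x)) S"
  unfolding det_def by (intro smooth_on_sum smooth_on_mult smooth_on_const smooth_on_prod assms)

text \<open>Cramer's rule writes each entry as a quotient of determinants.\<close>

lemma smooth_on_matrix_inv:
  fixes A :: "'a \<Rightarrow> real^'n^'n"
  assumes A: "\<And>i j. smooth_on (\<lambda>x. A x $ i $ j) S" and det: "\<And>x. x \<in> S \<Longrightarrow> det (A x) \<noteq> 0"
  shows "smooth_on (\<lambda>x. matrix_inv (A x) $ i $ j) S"
proof -
  have "matrix_inv (A x) $ i $ j =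
      det (\<chi> k l. if l = i then axis j 1 $ k else A x $ k $ l) / det (A x)" if "x \<in> S" for x
  proof -
    have "A x ** matrix_inv (A x) = mat 1"
      using det[OF that] by (metis invertible_det_nz invertible_def matrix_inv_eqI)
    then have "A x *v (matrix_inv (A x) *v axis j 1) = axis j 1"
      by (simp add: matrix_vector_mul_assoc)
    then have "(matrix_inv (A x) *v axis j 1) $ i = det (\<chi> k l. if l = i then axis j 1 $ k else A x $ k $ l) / det (A x)"
      using cramer[OF det[OF that]] by simp
    then show ?thesis by (simp add: matrix_vector_mul_component inner_axis)
  qed
  moreover have "smooth_on (\<lambda>x. det (\<chi> k l. if l = i then axis j 1 $ k else A x $ k $ l) / det (A x)) S"
    by (intro smooth_on_divide smooth_on_det A det) (auto intro!: A smooth_on_const smooth_on_if)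
  ultimately show ?thesis using smooth_on_cong[of "\<lambda>x. matrix_inv (A x) $ i $ j"] by simp
qed

lemma smooth_on_wedge:
  assumes "\<And>vs. smooth_on (\<lambda>x. \<alpha> x vs) S" "\<And>vs. smooth_on (\<lambda>x. \<beta> x vs) S"
  shows "smooth_on (\<lambda>x. wedge (\<alpha> x) (\<beta> x) vs) S"
  unfolding wedge_def by (intro smooth_on_sum smooth_on_mult smooth_on_const assms)

lemma smooth_on_contract:
  assumes "\<And>vs. smooth_on (\<lambda>x. \<alpha> x vs) S" "\<And>vs. smooth_on (\<lambda>x. \<beta> x vs) S"
  shows "smooth_on (\<lambda>x. contract q (\<alpha> x) (\<beta> x) vs) S"
  unfolding contract_def by (intro smooth_on_sum smooth_on_mult smooth_on_const smooth_on_divide assms) simp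

end

section \<open>Symmetry of second derivatives\<close>

lemma second_difference:
  fixes f :: "'a::euclidean_space \<Rightarrow> real"
  assumes f: "Ck_on 2 f S" "open S" and s: "s > 0"
    and sub: "\<And>a b. 0 \<le> a \<Longrightarrow> a \<le> s \<Longrightarrow> 0 \<le> b \<Longrightarrow> b \<le> s \<Longrightarrow> x + a *\<^sub>R v + b *\<^sub>R w \<in> S"
  shows "\<exists>a b. 0 \<le> a \<and> a \<le> s \<and> 0 \<le> b \<and> b \<le> s \<and>
    f (x + s *\<^sub>R v + s *\<^sub>R w) - f (x + s *\<^sub>R v) - f (x + s *\<^sub>R w) + f x =
    s * (s * frechet_derivative (\<lambda>y. frechet_derivative f (at y) v) (at (x + a *\<^sub>R v + b *\<^sub>R w)) w)"
proof -
  let ?D = "\<lambda>y. frechet_derivative f (at y) v"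
  have f': "Ck_on (Suc (Suc 0)) f S" using f(1) by (simp only: numeral_2_eq_2)
  note D1 = Ck_on_SucE(1)[OF f' f(2)] and D2 = Ck_on_SucE(1)[OF Ck_on_SucE(2)[OF f' f(2), of v] f(2)]
  have line: "((\<lambda>t. F (c + t *\<^sub>R u)) has_real_derivative F' u) (at t)"
    if "(F has_derivative F') (at (c + t *\<^sub>R u))" for F F' c u t
  proof -
    have "((\<lambda>t. c + t *\<^sub>R u) has_derivative (\<lambda>h. h *\<^sub>R u)) (at t)"
      by (auto intro!: derivative_eq_intros)
    from has_derivative_compose[OF this that]
    have "((\<lambda>t. F (c + t *\<^sub>R u)) has_derivative (\<lambda>h. F' (h *\<^sub>R u))) (at t)" .
    moreover have "F' (h *\<^sub>R u) = F' u * h" for h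
      using linear_scale[OF has_derivative_linear[OF that]] by simp
    ultimately show ?thesis by (simp add: has_field_derivative_def mult_commute_abs)
  qed
  \<comment> \<open>Mean value theorem along \<open>v\<close> for the difference between
    \<open>f\<close> shifted by \<open>s\<close> times \<open>w\<close> and \<open>f\<close>
    itself.\<close>
  have "\<exists>a>0. a < s \<and> (f ((x + s *\<^sub>R w) + s *\<^sub>R v) - f (x + s *\<^sub>R v)) - (f ((x + s *\<^sub>R w) + 0 *\<^sub>R v) - f (x + 0 *\<^sub>R v)) =
      (s - 0) * (?D ((x + s *\<^sub>R w) + a *\<^sub>R v) - ?D (x + a *\<^sub>R v))"
  proof (rule MVT2[OF s])
    fix t :: real assume t: "0 \<le> t" "t \<le> s"
    show "((\<lambda>t. f ((x + s *\<^sub>R w) + t *\<^sub>R v) - f (x + t *\<^sub>R v)) has_real_derivative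
        ?D ((x + s *\<^sub>R w) + t *\<^sub>R v) - ?D (x + t *\<^sub>R v)) (at t)"
      using sub[OF t, of s] sub[OF t, of 0] s
      by (intro DERIV_diff line D1) (simp_all add: algebra_simps)
  qed
  then obtain a where a: "0 < a" "a < s"
    "f ((x + s *\<^sub>R w) + s *\<^sub>R v) - f (x + s *\<^sub>R v) - f (x + s *\<^sub>R w) + f x =
      s * (?D ((x + s *\<^sub>R w) + a *\<^sub>R v) - ?D (x + a *\<^sub>R v))" by (auto simp: algebra_simps)
  \<comment> \<open>Mean value theorem along \<open>w\<close> for the derivative in direction
    \<open>v\<close>.\<close>
  have "\<exists>b>0. b < s \<and> ?D ((x + a *\<^sub>R v) + s *\<^sub>R w) - ?D ((x + a *\<^sub>R v) + 0 *\<^sub>R w) =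
      (s - 0) * frechet_derivative ?D (at ((x + a *\<^sub>R v) + b *\<^sub>R w)) w"
  proof (rule MVT2[OF s])
    fix t :: real assume t: "0 \<le> t" "t \<le> s"
    show "((\<lambda>t. ?D ((x + a *\<^sub>R v) + t *\<^sub>R w)) has_real_derivative
        frechet_derivative ?D (at ((x + a *\<^sub>R v) + t *\<^sub>R w)) w) (at t)"
      using a sub[of a, OF _ _ t] by (intro line D2) simp
  qed
  then obtain b where b: "0 < b" "b < s" "?D ((x + a *\<^sub>R v) + s *\<^sub>R w) - ?D (x + a *\<^sub>R v) =
      s * frechet_derivative ?D (at (x + a *\<^sub>R v + b *\<^sub>R w)) w" by auto
  have "(x + s *\<^sub>R w) + a *\<^sub>R v = (x + a *\<^sub>R v) + s *\<^sub>R w" "(x + s *\<^sub>R w) + s *\<^sub>R v = x + s *\<^sub>R v + s *\<^sub>R w"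
    by (simp_all add: algebra_simps)
  with a b show ?thesis by (intro exI[of _ a] exI[of _ b]) simp
qed

text \<open>The second difference is unchanged when \<open>v\<close> and \<open>w\<close> are
  exchanged, so it is \<open>s ^ 2\<close> times a value of either mixed derivative near
  \<open>x\<close>. Continuity of both then makes them agree at \<open>x\<close>.\<close>

lemma second_derivative_symmetric:
  fixes f :: "'a::euclidean_space \<Rightarrow> real"
  assumes f: "Ck_on 2 f S" and S: "open S" and x: "x \<in> S"
  shows "frechet_derivative (\<lambda>y. frechet_derivative f (at y) v) (at x) w =
    frechet_derivative (\<lambda>y. frechet_derivative f (at y) w) (at x) v"
proof (rule ccontr)
  define A where "A v w y = frechet_derivative (\<lambda>y. frechet_derivative f (at y) v) (at y) w" for v w y
  assume "\<not> ?thesis"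
  then have "A v w x \<noteq> A w v x" unfolding A_def .
  \<comment> \<open>Half of the supposed gap, so that two errors below \<open>e\<close> cannot add
    up to it.\<close>
  define e where "e = \<bar>A v w x - A w v x\<bar> / 2"
  have e: "e > 0" using \<open>A v w x \<noteq> A w v x\<close> by (simp add: e_def)
  have f': "Ck_on (Suc (Suc 0)) f S" using f by (simp only: numeral_2_eq_2)
  have "\<exists>d>0. \<forall>y. dist y x < d \<longrightarrow> y \<in> S \<and> dist (A v w y) (A v w x) < e" for v w
  proof -
    have "continuous_on S (A v w)"
      using Ck_on_SucE(2)[OF Ck_on_SucE(2)[OF f' S, of v] S, of w] unfolding A_def by simp
    then have "isCont (A v w) x" using S x by (simp add: continuous_on_eq_continuous_at)
    then obtain d1 where "d1 > 0" "\<forall>y. dist y x < d1 \<longrightarrow> dist (A v w y) (A v w x) < e"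
      using e unfolding continuous_at_eps_delta by metis
    moreover obtain d2 where "d2 > 0" "\<forall>y. dist y x < d2 \<longrightarrow> y \<in> S"
      using S x unfolding open_dist by metis
    ultimately show ?thesis by (intro exI[of _ "min d1 d2"]) auto
  qed
  from this[of v w] this[of w v] obtain d1 d2 where
    d: "d1 > 0" "\<And>y. dist y x < d1 \<Longrightarrow> y \<in> S \<and> dist (A v w y) (A v w x) < e"
       "d2 > 0" "\<And>y. dist y x < d2 \<Longrightarrow> y \<in> S \<and> dist (A w v y) (A w v x) < e" by metis
  \<comment> \<open>Keeps the parallelogram spanned by \<open>s\<close> times \<open>v\<close> and
    \<open>s\<close> times \<open>w\<close> within the smaller radius; the summand 1 avoids division
    by zero.\<close>
  define s where "s = min d1 d2 / (2 * (norm v + norm w + 1))"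
  have pos: "norm v + norm w + 1 > 0" by (smt (verit) norm_ge_zero)
  have s: "s > 0" unfolding s_def using d pos by (intro divide_pos_pos) auto
  have near: "dist (x + a *\<^sub>R v + b *\<^sub>R w) x < min d1 d2" if "0 \<le> a" "a \<le> s" "0 \<le> b" "b \<le> s" for a b
  proof -
    have "dist (x + a *\<^sub>R v + b *\<^sub>R w) x = norm (a *\<^sub>R v + b *\<^sub>R w)" by (simp add: dist_norm)
    also have "\<dots> \<le> a * norm v + b * norm w" using norm_triangle_ineq[of "a *\<^sub>R v" "b *\<^sub>R w"] that by simp
    also have "\<dots> \<le> s * norm v + s * norm w" using that by (intro add_mono mult_right_mono) auto
    also have "\<dots> \<le> s * (norm v + norm w + 1)" using s by (simp add: algebra_simps)
    also have "\<dots> = min d1 d2 / 2" unfolding s_def using pos by (simp add: field_simps)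
    also have "\<dots> < min d1 d2" using \<open>0 < d1\<close> \<open>0 < d2\<close> by (simp add: min_def)
    finally show ?thesis .
  qed
  obtain a b where ab: "0 \<le> a" "a \<le> s" "0 \<le> b" "b \<le> s"
    "f (x + s *\<^sub>R v + s *\<^sub>R w) - f (x + s *\<^sub>R v) - f (x + s *\<^sub>R w) + f x = s * (s * A v w (x + a *\<^sub>R v + b *\<^sub>R w))"
    using second_difference[OF f S s, of x v w] near d unfolding A_def by (metis min_less_iff_conj)
  have near': "dist (x + a *\<^sub>R w + b *\<^sub>R v) x < min d1 d2" if "0 \<le> a" "a \<le> s" "0 \<le> b" "b \<le> s" for a b
    using near[OF that(3,4,1,2)] by (simp add: algebra_simps)
  obtain a' b' where ab': "0 \<le> a'" "a' \<le> s" "0 \<le> b'" "b' \<le> s"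
    "f (x + s *\<^sub>R w + s *\<^sub>R v) - f (x + s *\<^sub>R w) - f (x + s *\<^sub>R v) + f x = s * (s * A w v (x + a' *\<^sub>R w + b' *\<^sub>R v))"
    using second_difference[OF f S s, of x w v] near' d unfolding A_def by (metis min_less_iff_conj)
  have eq: "x + s *\<^sub>R w + s *\<^sub>R v = x + s *\<^sub>R v + s *\<^sub>R w" by (simp add: algebra_simps)
  have "s * (s * A v w (x + a *\<^sub>R v + b *\<^sub>R w)) = s * (s * A w v (x + a' *\<^sub>R w + b' *\<^sub>R v))"
    using ab(5) ab'(5)[unfolded eq] by linarith
  with s have "A v w (x + a *\<^sub>R v + b *\<^sub>R w) = A w v (x + a' *\<^sub>R w + b' *\<^sub>R v)" by simp
  moreover have "dist (A v w (x + a *\<^sub>R v + b *\<^sub>R w)) (A v w x) < e" using near[OF ab(1-4)] d(2) by simp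
  moreover have "dist (A w v (x + a' *\<^sub>R w + b' *\<^sub>R v)) (A w v x) < e" using near'[OF ab'(1-4)] d(4) by simp
  moreover have "\<bar>p - r\<bar> \<le> \<bar>q - p\<bar> + \<bar>q - r\<bar>" for p q r :: real by linarith
  ultimately show False
    unfolding e_def dist_real_def by (metis add_strict_mono field_sum_of_halves not_less)
qed

lemma Ck_on_component:
  fixes f :: "'a::euclidean_space \<Rightarrow> real^'n"
  shows "open S \<Longrightarrow> Ck_on k f S \<Longrightarrow> Ck_on k (\<lambda>x. f x $ i) S"
proof (induction k arbitrary: f)
  case (Suc k)
  note f = Ck_on_SucE[OF Suc.prems(2,1)]
  show ?case
    by (rule Ck_on_SucI[OF Suc.prems(1) bounded_linear.has_derivative[OF bounded_linear_vec_nth f(1)]], assumption)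
      (rule Suc.IH[OF Suc.prems(1) f(2)])
qed (auto intro: continuous_intros)

section \<open>Smooth dependence on the form\<close>

text \<open>The frames are given for each point separately and need not vary continuously with
  it.\<close>

locale adapted_family =
  fixes S :: "(real^7) set" and \<phi> :: "real^7 \<Rightarrow> (real^7) list \<Rightarrow> real"
  assumes S: "open S" and smooth_phi: "\<And>vs. smooth_on (\<lambda>x. \<phi> x vs) S"
    and frames: "\<And>x. x \<in> S \<Longrightarrow> \<exists>L K. adapted_frame (\<phi> x) L K"
begin

definition density :: "real^7 \<Rightarrow> 7 \<Rightarrow> 7 \<Rightarrow> real" where
  "density x i j = wedge (wedge (int_prod (axis i 1) (\<phi> x)) (int_prod (axis j 1) (\<phi> x))) (\<phi> x) std_basis"

text \<open>The root has to be odd because the coordinate volume is negative in a chart that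
  reverses the orientation.\<close>

definition volume :: "real^7 \<Rightarrow> real" where
  "volume x = root 9 (det (\<chi> i j. density x i j) / 6 ^ 7)"

lemma metric_eq:
  assumes "x \<in> S"
  shows "det (\<chi> i j. density x i j) \<noteq> 0"
    and "volume x \<noteq> 0"
    and "g2_metric (\<phi> x) (axis i 1) (axis j 1) = density x i j / (6 * volume x)"
    and "det (\<chi> i j. g2_metric (\<phi> x) (axis i 1) (axis j 1)) \<noteq> 0"
    and "bilinear (g2_metric (\<phi> x))"
proof -
  obtain L K where "adapted_frame (\<phi> x) L K" using frames[OF assms] by blast
  then interpret adapted_frame "\<phi> x" L K .
  have d: "(\<chi> i j. density x i j) = metric_density"
    unfolding metric_density_def density_def ..
  show "det (\<chi> i j. density x i j) \<noteq> 0"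
    unfolding d det_metric_density using det_K_nonzero by simp
  have v: "volume x = det (matrix K)"
    unfolding volume_def d det_metric_density by (simp add: odd_real_root_power_cancel)
  then show "volume x \<noteq> 0" using det_K_nonzero by simp
  have "density x i j = metric_density $ i $ j" unfolding d[symmetric] by simp
  also have "\<dots> = 6 * volume x * g2_metric (\<phi> x) (axis i 1) (axis j 1)"
    unfolding metric_density_eq by (simp add: gram_def g2_metric_eq v)
  finally show "g2_metric (\<phi> x) (axis i 1) (axis j 1) = density x i j / (6 * volume x)"
    using \<open>volume x \<noteq> 0\<close> by simp
  show "det (\<chi> i j. g2_metric (\<phi> x) (axis i 1) (axis j 1)) \<noteq> 0"
    using det_gram det_K_nonzero unfolding g2_metric_eq gram_def by simp
  show "bilinear (g2_metric (\<phi> x))"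
    using g2_metric_vol unfolding g2_metric_eq g2_metric_vol_def inner_product_form_def by blast
qed

lemma smooth_metric: "smooth_on (\<lambda>x. g2_metric (\<phi> x) u v) S"
proof -
  have dens: "smooth_on (\<lambda>x. density x i j) S" for i j
    unfolding density_def by (intro smooth_on_wedge S) (auto simp: int_prod_def intro: smooth_phi)
  have "smooth_on volume S"
    unfolding volume_def
    by (intro smooth_on_root9 smooth_on_divide smooth_on_det smooth_on_const S)
      (simp_all add: dens metric_eq(1))
  then have *: "smooth_on (\<lambda>x. density x i j / (6 * volume x)) S" for i j
    by (intro smooth_on_divide smooth_on_mult smooth_on_const dens S) (simp_all add: metric_eq(2))
  have "g2_metric (\<phi> x) u v = (\<Sum>i\<in>UNIV. \<Sum>j\<in>UNIV. u $ i * (v $ j * (density x i j / (6 * volume x))))"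
    if x: "x \<in> S" for x
  proof -
    note bl = metric_eq(5)[OF x]
    have "g2_metric (\<phi> x) u v = g2_metric (\<phi> x) (\<Sum>i\<in>UNIV. (u $ i) *\<^sub>R axis i 1) (\<Sum>j\<in>UNIV. (v $ j) *\<^sub>R axis j 1)"
      using vec_axis_sum[of u] vec_axis_sum[of v] by simp
    also have "\<dots> = (\<Sum>i\<in>UNIV. \<Sum>j\<in>UNIV. u $ i * (v $ j * g2_metric (\<phi> x) (axis i 1) (axis j 1)))"
      by (simp add: bilinear_sum[OF bl] bilinear_lmul[OF bl] bilinear_rmul[OF bl] sum.cartesian_product mult_ac)
    finally show ?thesis unfolding metric_eq(3)[OF x] .
  qed
  moreover have "smooth_on (\<lambda>x. \<Sum>i\<in>UNIV. \<Sum>j\<in>UNIV. u $ i * (v $ j * (density x i j / (6 * volume x)))) S"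
    by (intro smooth_on_sum smooth_on_mult smooth_on_const * S)
  ultimately show ?thesis using smooth_on_cong[OF S, of "\<lambda>x. g2_metric (\<phi> x) u v"] by simp
qed

lemma smooth_inverse_gram: "smooth_on (\<lambda>x. inverse_gram (g2_metric (\<phi> x)) $ i $ j) S"
  unfolding inverse_gram_def
  by (intro smooth_on_matrix_inv S metric_eq(4)) (simp_all add: smooth_metric)

text \<open>Smoothness is known for constant arguments, while the raised arguments vary with the
  point. They are expanded one by one in the standard basis, with smooth coefficients.\<close>

lemma smooth_raise:
  assumes \<omega>: "\<And>x. x \<in> S \<Longrightarrow> \<omega> x \<in> alt l" and smooth: "\<And>vs. smooth_on (\<lambda>x. \<omega> x vs) S"
  shows "smooth_on (\<lambda>x. (\<omega> x \<circ> map (sharp (g2_metric (\<phi> x)))) vs) S"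
proof -
  have "smooth_on (\<lambda>x. \<omega> x (as @ map (sharp (g2_metric (\<phi> x))) vs)) S" for as
  proof (induction vs arbitrary: as)
    case (Cons v vs)
    have "smooth_on (\<lambda>x. sharp (g2_metric (\<phi> x)) v $ i) S" for i
      unfolding sharp_def vector_matrix_mult_def
      by (simp, intro smooth_on_sum smooth_on_mult smooth_on_const smooth_inverse_gram S)
    then have "smooth_on (\<lambda>x. \<Sum>i\<in>UNIV. sharp (g2_metric (\<phi> x)) v $ i *
        \<omega> x ((as @ [axis i 1]) @ map (sharp (g2_metric (\<phi> x))) vs)) S"
      by (intro smooth_on_sum smooth_on_mult Cons.IH S)
    moreover have "\<omega> x (as @ map (sharp (g2_metric (\<phi> x))) (v # vs)) = (\<Sum>i\<in>UNIV. sharp (g2_metric (\<phi> x)) v $ i *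
        \<omega> x ((as @ [axis i 1]) @ map (sharp (g2_metric (\<phi> x))) vs))" if "x \<in> S" for x
      using alt_expand[OF \<omega>[OF that], of as "sharp (g2_metric (\<phi> x)) v" "map (sharp (g2_metric (\<phi> x))) vs"]
      by simp
    ultimately show ?case
      using smooth_on_cong[OF S, of "\<lambda>x. \<omega> x (as @ map (sharp (g2_metric (\<phi> x))) (v # vs))"] by simp
  qed (simp add: smooth)
  from this[of "[]"] show ?thesis by simp
qed

lemma smooth_hodge_star: "smooth_on (\<lambda>x. hodge_star (g2_metric (\<phi> x)) (g2_vol (\<phi> x)) 3 (\<phi> x) vs) S"
proof (cases "length vs = 4")
  case True
  then obtain u v w z where vs: "vs = [u, v, w, z]" by (auto simp: eval_nat_numeral length_Suc_conv)
  have "hodge_star (g2_metric (\<phi> x)) (g2_vol (\<phi> x)) 3 (\<phi> x) vs =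
    (\<Sum>i\<in>UNIV. \<Sum>j\<in>UNIV. inverse_gram (g2_metric (\<phi> x)) $ i $ j * \<phi> x [u, v, axis i 1] * \<phi> x [w, z, axis j 1])
    - g2_metric (\<phi> x) u w * g2_metric (\<phi> x) v z + g2_metric (\<phi> x) u z * g2_metric (\<phi> x) v w" if x: "x \<in> S" for x
  proof -
    obtain L K where "adapted_frame (\<phi> x) L K" using frames[OF x] by blast
    then interpret adapted_frame "\<phi> x" L K .
    show ?thesis unfolding vs hodge_star_phi by (rule psi_eval)
  qed
  moreover have "smooth_on (\<lambda>x. (\<Sum>i\<in>UNIV. \<Sum>j\<in>UNIV. inverse_gram (g2_metric (\<phi> x)) $ i $ j * \<phi> x [u, v, axis i 1] * \<phi> x [w, z, axis j 1])
    - g2_metric (\<phi> x) u w * g2_metric (\<phi> x) v z + g2_metric (\<phi> x) u z * g2_metric (\<phi> x) v w) S"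
    by (intro smooth_on_add smooth_on_diff smooth_on_sum smooth_on_mult smooth_phi smooth_metric smooth_inverse_gram S)
  ultimately show ?thesis
    using smooth_on_cong[OF S, of "\<lambda>x. hodge_star (g2_metric (\<phi> x)) (g2_vol (\<phi> x)) 3 (\<phi> x) vs"] by simp
next
  case False
  have "hodge_star (g2_metric (\<phi> x)) (g2_vol (\<phi> x)) 3 (\<phi> x) vs = 0" if x: "x \<in> S" for x
  proof -
    obtain L K where "adapted_frame (\<phi> x) L K" using frames[OF x] by blast
    then interpret adapted_frame "\<phi> x" L K .
    show ?thesis unfolding hodge_star_phi using alt_length[OF psi_alt False] .
  qed
  then show ?thesis
    using smooth_on_cong[OF S, of "\<lambda>x. hodge_star (g2_metric (\<phi> x)) (g2_vol (\<phi> x)) 3 (\<phi> x) vs" "\<lambda>x. 0"]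
      smooth_on_const[OF S, of "0::real"] by simp
qed

end

section \<open>Quotient spaces\<close>

lemma mem_coset: "y \<in> coset W x \<longleftrightarrow> y - x \<in> W"
  unfolding coset_def image_def by (auto intro!: bexI[of _ "y - x"])

lemma coset_add:
  assumes "subspace W"
  shows "coset W x + coset W y = coset W (x + y)"
proof (intro set_eqI iffI)
  fix z assume "z \<in> coset W x + coset W y"
  then obtain a b where "a - x \<in> W" "b - y \<in> W" "z = a + b" by (auto simp: set_plus_def mem_coset)
  then show "z \<in> coset W (x + y)"
    using subspace_add[OF assms, of "a - x" "b - y"] by (simp add: mem_coset algebra_simps)
next
  fix z assume "z \<in> coset W (x + y)"
  then have "x + (z - x) \<in> coset W x + coset W y"
    using subspace_0[OF assms] by (intro set_plus_intro) (auto simp: mem_coset algebra_simps)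
  then show "z \<in> coset W x + coset W y" by simp
qed

lemma coset_scale_coset:
  assumes "subspace W"
  shows "coset_scale W r (coset W x) = coset W (r *\<^sub>R x)"
proof (intro set_eqI iffI)
  fix z assume "z \<in> coset_scale W r (coset W x)"
  then obtain a b where "a - x \<in> W" "b \<in> W" "z = r *\<^sub>R a + b"
    by (auto simp: coset_scale_def set_plus_def mem_coset)
  then show "z \<in> coset W (r *\<^sub>R x)"
    using subspace_add[OF assms subspace_scale[OF assms, of "a - x" r], of b]
    by (simp add: mem_coset algebra_simps)
next
  fix z assume "z \<in> coset W (r *\<^sub>R x)"
  then have "r *\<^sub>R x + (z - r *\<^sub>R x) \<in> coset_scale W r (coset W x)"
    using subspace_0[OF assms] unfolding coset_scale_def
    by (intro set_plus_intro imageI) (auto simp: mem_coset)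
  then show "z \<in> coset_scale W r (coset W x)" by simp
qed

lemma quotient_space_add:
  assumes "subspace V" "subspace W" "C \<in> quotient_space V W" "D \<in> quotient_space V W"
  shows "C + D \<in> quotient_space V W"
  using assms unfolding quotient_space_def by (auto simp: coset_add subspace_add)

lemma quotient_space_scale:
  assumes "subspace V" "subspace W" "C \<in> quotient_space V W"
  shows "coset_scale W r C \<in> quotient_space V W"
  using assms unfolding quotient_space_def by (auto simp: coset_scale_coset subspace_scale)

text \<open>Compatibility with sums and scalars is checked after applying \<open>G\<close>, which is
  injective on the classes.\<close>

lemma quotient_iso_factor:
  assumes F: "quotient_iso V W X Y F" and G: "quotient_iso V' W' X Y G"
  shows "\<exists>H. quotient_iso V W V' W' H \<and> (\<forall>C\<in>quotient_space V W. G (H C) = F C)"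
proof -
  let ?Q = "quotient_space V W" and ?Q' = "quotient_space V' W'"
  define H where "H = inv_into ?Q' G \<circ> F"
  have bF: "bij_betw F ?Q (quotient_space X Y)" and bG: "bij_betw G ?Q' (quotient_space X Y)"
    using F G unfolding quotient_iso_def by blast+
  have bH: "bij_betw H ?Q ?Q'"
    unfolding H_def using bF bij_betw_inv_into[OF bG] by (rule bij_betw_trans)
  have GH: "G (H C) = F C" if "C \<in> ?Q" for C
  proof -
    have "F C \<in> G ` ?Q'" using that bF bG unfolding bij_betw_def by blast
    then show ?thesis unfolding H_def by (simp add: f_inv_into_f)
  qed
  have HQ: "H C \<in> ?Q'" if "C \<in> ?Q" for C using that bH bij_betwE by blast
  have inj: "C = D" if "C \<in> ?Q'" "D \<in> ?Q'" "G C = G D" for C D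
    using that bG unfolding bij_betw_def inj_on_def by blast
  have V: "subspace V" "subspace W" "subspace V'" "subspace W'"
    using F G unfolding quotient_iso_def by blast+
  note add = quotient_space_add[OF V(1,2)] quotient_space_add[OF V(3,4)]
  note scale = quotient_space_scale[OF V(1,2)] quotient_space_scale[OF V(3,4)]
  have "H (C + D) = H C + H D" if "C \<in> ?Q" "D \<in> ?Q" for C D
  proof (rule inj)
    show "G (H (C + D)) = G (H C + H D)"
      using that F G add HQ GH unfolding quotient_iso_def by metis
  qed (use that add HQ in blast)+
  moreover have "H (coset_scale W r C) = coset_scale W' r (H C)" if "C \<in> ?Q" for r C
  proof (rule inj)
    show "G (H (coset_scale W r C)) = G (coset_scale W' r (H C))"
      using that F G scale HQ GH unfolding quotient_iso_def by metis
  qed (use that scale HQ in blast)+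
  ultimately have "quotient_iso V W V' W' H"
    using F G bH unfolding quotient_iso_def by simp
  with GH show ?thesis by blast
qed

section \<open>Isomorphisms of quotients induced by a linear relation\<close>

locale linear_relation =
  fixes V :: "'a::real_vector set" and V' :: "'b::real_vector set"
    and A :: "'a \<Rightarrow> 'c::real_vector" and d :: "'b \<Rightarrow> 'c"
  assumes V: "subspace V" and V': "subspace V'"
    and A_add: "\<And>x y. x \<in> V \<Longrightarrow> y \<in> V \<Longrightarrow> A (x + y) = A x + A y"
    and A_scale: "\<And>r x. x \<in> V \<Longrightarrow> A (r *\<^sub>R x) = r *\<^sub>R A x"
    and d_add: "\<And>x y. x \<in> V' \<Longrightarrow> y \<in> V' \<Longrightarrow> d (x + y) = d x + d y"
    and d_scale: "\<And>r x. x \<in> V' \<Longrightarrow> d (r *\<^sub>R x) = r *\<^sub>R d x"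
begin

abbreviation "source \<equiv> {x \<in> V. \<exists>y\<in>V'. A x = d y}"
abbreviation "ker \<equiv> {x \<in> V. A x = 0}"
abbreviation "target \<equiv> {y \<in> V'. \<exists>x\<in>V. d y = A x}"
abbreviation "indet \<equiv> {y \<in> V'. d y = 0}"

lemma A_diff: "x \<in> V \<Longrightarrow> y \<in> V \<Longrightarrow> A (x - y) = A x - A y"
  using A_add[of x "- 1 *\<^sub>R y"] A_scale[of y "- 1"] subspace_scale[OF V, of y "- 1"] by simp

lemma d_diff: "x \<in> V' \<Longrightarrow> y \<in> V' \<Longrightarrow> d (x - y) = d x - d y"
  using d_add[of x "- 1 *\<^sub>R y"] d_scale[of y "- 1"] subspace_scale[OF V', of y "- 1"] by simp

lemma A_0: "A 0 = 0" and d_0: "d 0 = 0"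
  using A_scale[of 0 0] d_scale[of 0 0] subspace_0[OF V] subspace_0[OF V'] by simp_all

lemma subspace_source: "subspace source"
  unfolding subspace_def
proof (intro conjI ballI allI)
  show "0 \<in> source" using subspace_0[OF V] subspace_0[OF V'] A_0 d_0 by auto
next
  fix x y assume "x \<in> source" "y \<in> source"
  then obtain u v where "x \<in> V" "y \<in> V" "u \<in> V'" "v \<in> V'" "A x = d u" "A y = d v" by blast
  then show "x + y \<in> source"
    using subspace_add[OF V] subspace_add[OF V'] A_add d_add by (auto intro!: bexI[of _ "u + v"])
next
  fix r x assume "x \<in> source"
  then obtain u where "x \<in> V" "u \<in> V'" "A x = d u" by blast
  then show "r *\<^sub>R x \<in> source"
    using subspace_scale[OF V] subspace_scale[OF V'] A_scale d_scale by (auto intro!: bexI[of _ "r *\<^sub>R u"])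
qed

lemma subspace_ker: "subspace ker"
  unfolding subspace_def using subspace_0[OF V] subspace_add[OF V] subspace_scale[OF V] A_0 A_add A_scale by simp

lemma swap: "linear_relation V' V d A"
  using V V' A_add A_scale d_add d_scale by unfold_locales

lemma subspace_target: "subspace target" and subspace_indet: "subspace indet"
  using linear_relation.subspace_source[OF swap] linear_relation.subspace_ker[OF swap] .

text \<open>Collecting all elements related to a member of the class avoids choosing
  representatives. The relation is symmetric in its two sides, so the inverse is the same
  construction for the swapped relation.\<close>

definition transfer :: "'a set \<Rightarrow> 'b set" where
  "transfer C = {y \<in> V'. \<exists>x\<in>C. A x = d y}"

text \<open>All members of the coset have the same value under \<open>A\<close>, so the result is
  one fibre of \<open>d\<close>, that is, a coset of its kernel.\<close>

lemma transfer_coset: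
  assumes x: "x \<in> V" and y: "y \<in> V'" and xy: "A x = d y"
  shows "transfer (coset ker x) = coset indet y"
proof -
  have "A x' = A x" if "x' \<in> coset ker x" for x'
    using that A_add[of x "x' - x"] x by (simp add: mem_coset)
  moreover have "x \<in> coset ker x" using subspace_0[OF subspace_ker] by (simp add: mem_coset)
  ultimately have "(\<exists>x'\<in>coset ker x. A x' = d z) \<longleftrightarrow> d z = d y" for z
    using xy by metis
  then have t: "transfer (coset ker x) = {z \<in> V'. d z = d y}" by (simp add: transfer_def)
  have i: "z \<in> V' \<and> d z = d y \<longleftrightarrow> z - y \<in> indet" for z
  proof
    show "z - y \<in> indet" if "z \<in> V' \<and> d z = d y"
      using that y by (simp add: d_diff subspace_diff[OF V'])
    show "z \<in> V' \<and> d z = d y" if "z - y \<in> indet"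
      using that y d_add[of "z - y" y] subspace_add[OF V', of "z - y" y] by simp
  qed
  show ?thesis unfolding set_eq_iff t mem_coset i[symmetric] by simp
qed

lemma quotient_iso_transfer: "quotient_iso source ker target indet transfer"
proof -
  let ?Q = "quotient_space source ker"
  have Q: "\<exists>x\<in>V. \<exists>y\<in>V'. A x = d y \<and> C = coset ker x" if "C \<in> ?Q" for C
    using that unfolding quotient_space_def by blast
  have Q': "\<exists>y\<in>V'. \<exists>x\<in>V. d y = A x \<and> D = coset indet y" if "D \<in> quotient_space target indet" for D
    using that unfolding quotient_space_def by blast
  note inv = linear_relation.transfer_coset[OF swap]
  have "bij_betw transfer ?Q (quotient_space target indet)"
  proof (rule bij_betw_byWitness[where f'="linear_relation.transfer V d A"])
    show "\<forall>C\<in>?Q. linear_relation.transfer V d A (transfer C) = C"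
    proof
      fix C assume "C \<in> ?Q"
      then obtain x y where "x \<in> V" "y \<in> V'" "A x = d y" "C = coset ker x" using Q by blast
      then show "linear_relation.transfer V d A (transfer C) = C" using transfer_coset[of x y] inv[of y x] by simp
    qed
    show "\<forall>D\<in>quotient_space target indet. transfer (linear_relation.transfer V d A D) = D"
    proof
      fix D assume "D \<in> quotient_space target indet"
      then obtain x y where "x \<in> V" "y \<in> V'" "d y = A x" "D = coset indet y" using Q' by blast
      then show "transfer (linear_relation.transfer V d A D) = D" using transfer_coset[of x y] inv[of y x] by simp
    qed
    show "transfer ` ?Q \<subseteq> quotient_space target indet"
    proof
      fix D assume "D \<in> transfer ` ?Q"
      then obtain x y where "x \<in> V" "y \<in> V'" "A x = d y" "D = transfer (coset ker x)" using Q by blast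
      then show "D \<in> quotient_space target indet"
        using transfer_coset[of x y] unfolding quotient_space_def by (intro image_eqI[of _ _ y]) (auto intro!: bexI[of _ x])
    qed
    show "linear_relation.transfer V d A ` quotient_space target indet \<subseteq> ?Q"
    proof
      fix C assume "C \<in> linear_relation.transfer V d A ` quotient_space target indet"
      then obtain x y where "x \<in> V" "y \<in> V'" "d y = A x" "C = linear_relation.transfer V d A (coset indet y)"
        using Q' by blast
      then show "C \<in> ?Q"
        using inv[of y x] unfolding quotient_space_def by (intro image_eqI[of _ _ x]) (auto intro!: bexI[of _ y])
    qed
  qed
  moreover have "transfer (C + D) = transfer C + transfer D" if CD: "C \<in> ?Q" "D \<in> ?Q" for C D
  proof -
    obtain x y where x: "x \<in> V" "y \<in> V'" "A x = d y" "C = coset ker x" using Q[OF CD(1)] by blast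
    obtain u v where u: "u \<in> V" "v \<in> V'" "A u = d v" "D = coset ker u" using Q[OF CD(2)] by blast
    have "transfer (coset ker (x + u)) = coset indet (y + v)"
      by (intro transfer_coset) (simp_all add: subspace_add V V' A_add d_add x u)
    then show ?thesis unfolding x(4) u(4) coset_add[OF subspace_ker] transfer_coset[OF x(1-3)]
        transfer_coset[OF u(1-3)] coset_add[OF subspace_indet] .
  qed
  moreover have "transfer (coset_scale ker r C) = coset_scale indet r (transfer C)" if C: "C \<in> ?Q" for r C
  proof -
    obtain x y where x: "x \<in> V" "y \<in> V'" "A x = d y" "C = coset ker x" using Q[OF C] by blast
    have "transfer (coset ker (r *\<^sub>R x)) = coset indet (r *\<^sub>R y)"
      by (intro transfer_coset) (simp_all add: subspace_scale V V' A_scale d_scale x)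
    then show ?thesis unfolding x(4) coset_scale_coset[OF subspace_ker] transfer_coset[OF x(1-3)]
        coset_scale_coset[OF subspace_indet] .
  qed
  moreover have "ker \<subseteq> source" "indet \<subseteq> target"
    using subspace_0[OF V] subspace_0[OF V'] A_0 d_0 by auto
  ultimately show ?thesis unfolding quotient_iso_def
    using subspace_source subspace_ker subspace_target subspace_indet by blast
qed

end

section \<open>Charts\<close>

locale manifold =
  fixes M :: "'m topology" and \<A> :: "'m chart set"
  assumes manifold: "smooth_manifold M \<A>"
begin

declare split_paired_All [simp del] split_paired_Ex [simp del]

lemma openin_chart: "c \<in> \<A> \<Longrightarrow> openin M (fst c)"
  and open_image: "c \<in> \<A> \<Longrightarrow> open (snd c ` fst c)"
  and homeomorphic_chart: "c \<in> \<A> \<Longrightarrow>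
    homeomorphic_map (subtopology M (fst c)) (top_of_set (snd c ` fst c)) (snd c)"
  using manifold unfolding smooth_manifold_def by blast+

lemma topspace_chart: "c \<in> \<A> \<Longrightarrow> topspace (subtopology M (fst c)) = fst c"
  using openin_subset[OF openin_chart[of c]] by (simp add: Int_absorb1)

lemma inj_chart: "c \<in> \<A> \<Longrightarrow> inj_on (snd c) (fst c)"
  using homeomorphic_imp_injective_map[OF homeomorphic_chart] topspace_chart by fastforce

lemma inv_chart [simp]: "c \<in> \<A> \<Longrightarrow> p \<in> fst c \<Longrightarrow> inv_into (fst c) (snd c) (snd c p) = p"
  by (simp add: inj_chart inv_into_f_f)

lemma chart_exists: "p \<in> topspace M \<Longrightarrow> \<exists>c. chart_at \<A> p c"
  using manifold unfolding smooth_manifold_def chart_at_def by blast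

lemma chart_at_topspace: "chart_at \<A> p c \<Longrightarrow> p \<in> topspace M"
  using openin_subset[OF openin_chart] unfolding chart_at_def by blast

lemma open_image_openin:
  assumes c: "c \<in> \<A>" and U: "openin M U" "U \<subseteq> fst c"
  shows "open (snd c ` U)"
proof -
  have "openin (subtopology M (fst c)) U"
    unfolding openin_subtopology using U by (intro exI[of _ U]) auto
  then have "openin (top_of_set (snd c ` fst c)) (snd c ` U)"
    using homeomorphic_imp_open_map[OF homeomorphic_chart[OF c]] unfolding open_map_def by blast
  then show ?thesis using open_image[OF c] openin_open_eq by blast
qed

lemma openin_preimage:
  assumes c: "c \<in> \<A>" and B: "open B"
  shows "openin M {q \<in> fst c. snd c q \<in> B}"
proof -
  have "continuous_map (subtopology M (fst c)) (top_of_set (snd c ` fst c)) (snd c)"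
    using homeomorphic_imp_continuous_map[OF homeomorphic_chart[OF c]] .
  moreover have "openin (top_of_set (snd c ` fst c)) (snd c ` fst c \<inter> B)" using B by blast
  ultimately have "openin (subtopology M (fst c)) {q \<in> topspace (subtopology M (fst c)). snd c q \<in> snd c ` fst c \<inter> B}"
    by (rule openin_continuous_map_preimage)
  moreover have "{q \<in> topspace (subtopology M (fst c)). snd c q \<in> snd c ` fst c \<inter> B} = {q \<in> fst c. snd c q \<in> B}"
    unfolding topspace_chart[OF c] by auto
  ultimately show ?thesis using openin_trans_full openin_chart[OF c] by metis
qed

lemma local_rep_chart [simp]: "c \<in> \<A> \<Longrightarrow> p \<in> fst c \<Longrightarrow> local_rep c \<omega> (snd c p) = \<omega> p c"
  unfolding local_rep_def by simp

lemma local_rep_image: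
  assumes "c \<in> \<A>" "x \<in> snd c ` fst c"
  obtains p where "chart_at \<A> p c" "x = snd c p" "\<And>\<omega>. local_rep c \<omega> x = \<omega> p c"
  using assms by (auto simp: chart_at_def)

abbreviation overlap :: "'m chart \<Rightarrow> 'm chart \<Rightarrow> (real^7) set" where
  "overlap c d \<equiv> snd c ` (fst c \<inter> fst d)"

lemma open_overlap: "c \<in> \<A> \<Longrightarrow> d \<in> \<A> \<Longrightarrow> open (overlap c d)"
  by (intro open_image_openin openin_Int openin_chart) auto

lemma smooth_transition: "c \<in> \<A> \<Longrightarrow> d \<in> \<A> \<Longrightarrow> smooth_on (transition c d) (overlap c d)"
  using manifold unfolding smooth_manifold_def by blast

lemma transition_chart [simp]: "c \<in> \<A> \<Longrightarrow> q \<in> fst c \<Longrightarrow> transition c d (snd c q) = snd d q"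
  by (simp add: transition_def)

lemma transition_has_derivative:
  assumes "chart_at \<A> p c" "chart_at \<A> p d"
  shows "(transition c d has_derivative transition_deriv p c d) (at (snd c p))"
  unfolding transition_deriv_def
  by (rule smooth_on_has_derivative[OF open_overlap smooth_transition])
    (use assms in \<open>auto simp: chart_at_def\<close>)

lemma linear_transition_deriv: "chart_at \<A> p c \<Longrightarrow> chart_at \<A> p d \<Longrightarrow> linear (transition_deriv p c d)"
  using has_derivative_linear[OF transition_has_derivative] .

text \<open>Chain rule: the two transition maps compose to the identity on the overlap, a
  neighbourhood of the point.\<close>

lemma transition_deriv_inverse:
  assumes c: "chart_at \<A> p c" and d: "chart_at \<A> p d"
  shows "transition_deriv p d c (transition_deriv p c d v) = v"
proof -
  have cd: "c \<in> \<A>" "d \<in> \<A>" "p \<in> fst c" "p \<in> fst d" using c d by (auto simp: chart_at_def)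
  have "(transition d c has_derivative transition_deriv p d c) (at (transition c d (snd c p)))"
    using transition_has_derivative[OF d c] cd by simp
  from diff_chain_at[OF transition_has_derivative[OF c d] this]
  have "((\<lambda>x. x) has_derivative transition_deriv p d c \<circ> transition_deriv p c d) (at (snd c p))"
    by (rule has_derivative_transform_within_open[where s="overlap c d"])
      (use cd open_overlap in auto)
  from has_derivative_unique[OF this has_derivative_ident]
  show ?thesis by (simp add: fun_eq_iff)
qed

section \<open>Spaces of fields, their contraction, and linearity of the exterior derivative\<close>

lemma forms_alt: "\<omega> \<in> forms \<A> l \<Longrightarrow> chart_at \<A> p c \<Longrightarrow> \<omega> p c \<in> alt l"
  and mvecs_alt: "Q \<in> mvecs \<A> l \<Longrightarrow> chart_at \<A> p c \<Longrightarrow> Q p c \<in> alt l"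
  and forms_outside: "\<omega> \<in> forms \<A> l \<Longrightarrow> \<not> chart_at \<A> p c \<Longrightarrow> \<omega> p c = 0"
  and mvecs_outside: "Q \<in> mvecs \<A> l \<Longrightarrow> \<not> chart_at \<A> p c \<Longrightarrow> Q p c = 0"
  unfolding forms_def mvecs_def smooth_alt_field_def by auto

lemma forms_smooth: "\<omega> \<in> forms \<A> l \<Longrightarrow> c \<in> \<A> \<Longrightarrow> smooth_on (\<lambda>x. local_rep c \<omega> x vs) (snd c ` fst c)"
  and mvecs_smooth: "Q \<in> mvecs \<A> l \<Longrightarrow> c \<in> \<A> \<Longrightarrow> smooth_on (\<lambda>x. local_rep c Q x vs) (snd c ` fst c)"
  unfolding forms_def mvecs_def smooth_alt_field_def by auto

lemma forms_transition:
  assumes "\<omega> \<in> forms \<A> l" "chart_at \<A> p c" "chart_at \<A> p d"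
  shows "\<omega> p c = \<omega> p d \<circ> map (transition_deriv p c d)"
  using assms unfolding forms_def by (intro ext, unfold comp_apply) blast

lemma mvecs_transition:
  assumes "Q \<in> mvecs \<A> l" "chart_at \<A> p c" "chart_at \<A> p d"
  shows "Q p d = Q p c \<circ> map (adjoint (transition_deriv p c d))"
  using assms unfolding mvecs_def by (intro ext, unfold comp_apply) blast

lemma smooth_alt_fieldI:
  assumes "\<And>p c. chart_at \<A> p c \<Longrightarrow> \<omega> p c \<in> alt l" "\<And>p c. \<not> chart_at \<A> p c \<Longrightarrow> \<omega> p c = 0"
    and "\<And>c vs. c \<in> \<A> \<Longrightarrow> smooth_on (\<lambda>x. local_rep c \<omega> x vs) (snd c ` fst c)"
  shows "smooth_alt_field \<A> l \<omega>"
  unfolding smooth_alt_field_def using assms by auto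

lemma formsI:
  assumes "\<And>p c. chart_at \<A> p c \<Longrightarrow> \<omega> p c \<in> alt l" "\<And>p c. \<not> chart_at \<A> p c \<Longrightarrow> \<omega> p c = 0"
    and "\<And>c vs. c \<in> \<A> \<Longrightarrow> smooth_on (\<lambda>x. local_rep c \<omega> x vs) (snd c ` fst c)"
    and "\<And>p c d. chart_at \<A> p c \<Longrightarrow> chart_at \<A> p d \<Longrightarrow> \<omega> p c = \<omega> p d \<circ> map (transition_deriv p c d)"
  shows "\<omega> \<in> forms \<A> l"
  unfolding forms_def mem_Collect_eq
proof (intro conjI allI impI)
  show "smooth_alt_field \<A> l \<omega>" by (rule smooth_alt_fieldI[OF assms(1-3)])
  show "\<omega> p c vs = \<omega> p d (map (transition_deriv p c d) vs)" if "chart_at \<A> p c \<and> chart_at \<A> p d" for p c d vs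
    using fun_cong[OF assms(4)[of p c d], of vs] that by simp
qed

lemma mvecsI:
  assumes "\<And>p c. chart_at \<A> p c \<Longrightarrow> Q p c \<in> alt l" "\<And>p c. \<not> chart_at \<A> p c \<Longrightarrow> Q p c = 0"
    and "\<And>c vs. c \<in> \<A> \<Longrightarrow> smooth_on (\<lambda>x. local_rep c Q x vs) (snd c ` fst c)"
    and "\<And>p c d. chart_at \<A> p c \<Longrightarrow> chart_at \<A> p d \<Longrightarrow> Q p d = Q p c \<circ> map (adjoint (transition_deriv p c d))"
  shows "Q \<in> mvecs \<A> l"
  unfolding mvecs_def mem_Collect_eq
proof (intro conjI allI impI)
  show "smooth_alt_field \<A> l Q" by (rule smooth_alt_fieldI[OF assms(1-3)])
  show "Q p d vs = Q p c (map (adjoint (transition_deriv p c d)) vs)"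
    if "chart_at \<A> p c \<and> chart_at \<A> p d" for p c d vs
    using fun_cong[OF assms(4)[of p c d], of vs] that by simp
qed

lemma local_rep_simps:
  "local_rep c 0 x vs = 0" "local_rep c (\<omega> + \<eta>) x vs = local_rep c \<omega> x vs + local_rep c \<eta> x vs"
  "local_rep c (r *\<^sub>R \<omega>) x vs = r * local_rep c \<omega> x vs"
  by (simp_all add: local_rep_def scaleR_fun_def)

lemma field_scale: "(r *\<^sub>R \<omega>) p c = r *\<^sub>R \<omega> p c" for \<omega> :: "'m field"
  by (simp add: scaleR_fun_def)

lemma subspace_smooth_alt_field: "subspace {\<omega>. smooth_alt_field \<A> l \<omega>}"
  unfolding subspace_def smooth_alt_field_def
  by (auto simp: field_scale local_rep_simps alt_0 alt_add alt_scale intro!: smooth_on_add smooth_on_mult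
      smooth_on_const open_image split: if_splits)

text \<open>One shape for both transformation laws: forms and multivector fields differ in which of
  the two charts carries the transformed arguments.\<close>

lemma subspace_transition:
  "subspace {\<omega> :: 'm field. \<forall>p c d vs. P p c d \<longrightarrow> \<omega> p (F c d) vs = \<omega> p (G c d) (T p c d vs)}"
  unfolding subspace_def by (auto simp: scaleR_fun_def)

lemma subspace_forms: "subspace (forms \<A> l)"
  using subspace_inter[OF subspace_smooth_alt_field subspace_transition[of "\<lambda>p c d. chart_at \<A> p c \<and> chart_at \<A> p d"
      "\<lambda>c d. c" "\<lambda>c d. d" "\<lambda>p c d. map (transition_deriv p c d)"]]
  unfolding forms_def Collect_conj_eq .

lemma subspace_mvecs: "subspace (mvecs \<A> l)"
  using subspace_inter[OF subspace_smooth_alt_field subspace_transition[of "\<lambda>p c d. chart_at \<A> p c \<and> chart_at \<A> p d"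
      "\<lambda>c d. d" "\<lambda>c d. c" "\<lambda>p c d. map (adjoint (transition_deriv p c d))"]]
  unfolding mvecs_def Collect_conj_eq .

lemma field_contract_add: "field_contract q (P + Q) \<omega> = field_contract q P \<omega> + field_contract q Q \<omega>"
  by (simp add: field_contract_def fun_eq_iff contract_def ring_distribs sum.distrib add_divide_distrib)

lemma field_contract_scale: "field_contract q (r *\<^sub>R Q) \<omega> = r *\<^sub>R field_contract q Q \<omega>"
  by (simp add: field_contract_def fun_eq_iff contract_def scaleR_fun_def sum_distrib_left mult_ac)

lemma field_contract_forms:
  assumes Q: "Q \<in> mvecs \<A> q" and \<omega>: "\<omega> \<in> forms \<A> (q + l)"
  shows "field_contract q Q \<omega> \<in> forms \<A> l"
proof (rule formsI)
  fix p c assume c: "chart_at \<A> p c"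
  show "field_contract q Q \<omega> p c \<in> alt l"
    unfolding field_contract_def by (rule contract_alt[OF forms_alt[OF \<omega> c]])
  fix d assume d: "chart_at \<A> p d"
  \<comment> \<open>The derivatives of the two transition maps are inverse to each other, so they
    play the roles of \<open>L\<close> and \<open>K\<close> in
    \<open>contract_frame\<close>.\<close>
  have "transition_deriv p c d \<circ> transition_deriv p d c = id"
    using transition_deriv_inverse[OF d c] by (simp add: fun_eq_iff)
  from contract_frame[OF linear_transition_deriv[OF c d] linear_transition_deriv[OF d c] this
        mvecs_alt[OF Q d] forms_alt[OF \<omega> d]]
  show "field_contract q Q \<omega> p c = field_contract q Q \<omega> p d \<circ> map (transition_deriv p c d)"
    unfolding field_contract_def forms_transition[OF \<omega> c d] mvecs_transition[OF Q d c] .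
next
  fix p c assume "\<not> chart_at \<A> p c"
  then show "field_contract q Q \<omega> p c = 0"
    using mvecs_outside[OF Q] by (simp add: field_contract_def contract_def fun_eq_iff)
next
  fix c vs assume c: "c \<in> \<A>"
  have "local_rep c (field_contract q Q \<omega>) x vs = contract q (local_rep c Q x) (local_rep c \<omega> x) vs" for x
    by (simp add: local_rep_def field_contract_def)
  then show "smooth_on (\<lambda>x. local_rep c (field_contract q Q \<omega>) x vs) (snd c ` fst c)"
    by (simp add: smooth_on_contract[OF open_image[OF c]] mvecs_smooth[OF Q c] forms_smooth[OF \<omega> c])
qed

abbreviation local_deriv :: "'m \<Rightarrow> 'm chart \<Rightarrow> 'm field \<Rightarrow> (real^7) list \<Rightarrow> real^7 \<Rightarrow> real" where
  "local_deriv p c \<omega> vs \<equiv> frechet_derivative (\<lambda>x. local_rep c \<omega> x vs) (at (snd c p))"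

lemma local_rep_has_derivative:
  assumes "\<omega> \<in> forms \<A> l" "chart_at \<A> p c"
  shows "((\<lambda>x. local_rep c \<omega> x vs) has_derivative local_deriv p c \<omega> vs) (at (snd c p))"
  using assms smooth_on_has_derivative[OF open_image forms_smooth] by (auto simp: chart_at_def)

lemma frechet_local_rep_add:
  assumes "\<omega> \<in> forms \<A> l" "\<eta> \<in> forms \<A> l" "chart_at \<A> p c"
  shows "local_deriv p c (\<omega> + \<eta>) vs v =
    local_deriv p c \<omega> vs v
    + local_deriv p c \<eta> vs v"
proof -
  note has_derivative_add[OF local_rep_has_derivative[OF assms(1,3), of vs] local_rep_has_derivative[OF assms(2,3), of vs]]
  from frechet_derivative_at[OF this, symmetric] show ?thesis unfolding local_rep_simps by simp
qed

lemma frechet_local_rep_scale: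
  assumes "\<omega> \<in> forms \<A> l" "chart_at \<A> p c"
  shows "local_deriv p c (r *\<^sub>R \<omega>) vs v =
    r * local_deriv p c \<omega> vs v"
proof -
  note has_derivative_mult_right[OF local_rep_has_derivative[OF assms, of vs], of r]
  from frechet_derivative_at[OF this, symmetric] show ?thesis unfolding local_rep_simps by simp
qed

lemma ext_deriv_add:
  assumes "\<omega> \<in> forms \<A> l" "\<eta> \<in> forms \<A> l"
  shows "ext_deriv \<A> (\<omega> + \<eta>) = ext_deriv \<A> \<omega> + ext_deriv \<A> \<eta>"
  by (intro ext) (simp add: ext_deriv_def frechet_local_rep_add[OF assms] ring_distribs sum.distrib)

lemma ext_deriv_scale:
  assumes "\<omega> \<in> forms \<A> l"
  shows "ext_deriv \<A> (r *\<^sub>R \<omega>) = r *\<^sub>R ext_deriv \<A> \<omega>"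
proof (intro ext)
  fix p c vs
  show "ext_deriv \<A> (r *\<^sub>R \<omega>) p c vs = (r *\<^sub>R ext_deriv \<A> \<omega>) p c vs"
    unfolding scaleR_fun_def[of r "ext_deriv \<A> \<omega>"]
      scaleR_fun_def[of r "ext_deriv \<A> \<omega> p"] scaleR_fun_def[of r "ext_deriv \<A> \<omega> p c"]
    by (simp add: ext_deriv_def frechet_local_rep_scale[OF assms] sum_distrib_left mult_ac)
qed

end

section \<open>The exterior derivative in degrees 0 and 1\<close>

context manifold
begin

lemma local_rep_alt: "\<omega> \<in> forms \<A> l \<Longrightarrow> local_rep c \<omega> x \<in> alt l"
  unfolding local_rep_def using forms_alt forms_outside alt_0 by metis

lemma local_rep_length: "\<omega> \<in> forms \<A> l \<Longrightarrow> length vs \<noteq> l \<Longrightarrow> local_rep c \<omega> x vs = 0"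
  using alt_length[OF local_rep_alt] .

lemma ext_deriv_length:
  assumes "\<omega> \<in> forms \<A> l" "length vs \<noteq> Suc l"
  shows "ext_deriv \<A> \<omega> p c vs = 0"
proof -
  have "frechet_derivative (\<lambda>x. local_rep c \<omega> x (take i vs @ drop (Suc i) vs)) (at y) v = 0"
    if "i < length vs" for i y v
  proof -
    have "(\<lambda>x. local_rep c \<omega> x (take i vs @ drop (Suc i) vs)) = (\<lambda>x. 0)"
      using that assms by (intro ext local_rep_length) auto
    then show ?thesis by simp
  qed
  then show ?thesis by (simp add: ext_deriv_def)
qed

lemma ext_deriv_outside: "\<not> chart_at \<A> p c \<Longrightarrow> ext_deriv \<A> \<omega> p c = 0"
  by (simp add: ext_deriv_def fun_eq_iff)

lemma ext_deriv_smooth: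
  assumes \<omega>: "\<omega> \<in> forms \<A> l" and c: "c \<in> \<A>"
  shows "smooth_on (\<lambda>x. local_rep c (ext_deriv \<A> \<omega>) x vs) (snd c ` fst c)"
proof -
  have "local_rep c (ext_deriv \<A> \<omega>) x vs = (\<Sum>i<length vs. (-1) ^ i *
       frechet_derivative (\<lambda>x. local_rep c \<omega> x (take i vs @ drop (Suc i) vs)) (at x) (vs ! i))"
    if x: "x \<in> snd c ` fst c" for x
  proof -
    obtain p where "chart_at \<A> p c" "x = snd c p" "\<And>\<omega>. local_rep c \<omega> x = \<omega> p c"
      using local_rep_image[OF c x] by metis
    then show ?thesis by (simp add: ext_deriv_def)
  qed
  moreover have "smooth_on (\<lambda>x. \<Sum>i<length vs. (-1) ^ i *
       frechet_derivative (\<lambda>x. local_rep c \<omega> x (take i vs @ drop (Suc i) vs)) (at x) (vs ! i)) (snd c ` fst c)"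
    by (intro smooth_on_sum smooth_on_mult smooth_on_const smooth_on_frechet_derivative forms_smooth[OF \<omega> c]
        open_image[OF c])
  ultimately show ?thesis
    using smooth_on_cong[OF open_image[OF c], of "\<lambda>x. local_rep c (ext_deriv \<A> \<omega>) x vs"] by simp
qed

lemma linear_frechet_local_rep:
  assumes "\<omega> \<in> forms \<A> l" "chart_at \<A> p c"
  shows "linear (local_deriv p c \<omega> vs)"
  using has_derivative_linear[OF local_rep_has_derivative[OF assms]] .

lemma linear_frechet_local_rep_slot:
  assumes \<omega>: "\<omega> \<in> forms \<A> l" and c: "chart_at \<A> p c"
  shows "linear (\<lambda>u. local_deriv p c \<omega> ((as @ u # bs)) v)"
proof (rule linearI)
  note D = local_rep_has_derivative[OF \<omega> c] and lin = alt_linear[OF local_rep_alt[OF \<omega>], of c _ as bs]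
  fix u w and r :: real
  have "(\<lambda>x. local_rep c \<omega> x (as @ (u + w) # bs)) = (\<lambda>x. local_rep c \<omega> x (as @ u # bs) + local_rep c \<omega> x (as @ w # bs))"
    by (rule ext) (rule linear_add[OF lin])
  then show "local_deriv p c \<omega> ((as @ (u + w) # bs)) v =
      local_deriv p c \<omega> ((as @ u # bs)) v +
      local_deriv p c \<omega> ((as @ w # bs)) v"
    using frechet_derivative_at[OF has_derivative_add[OF D D], of "as @ u # bs" "as @ w # bs", symmetric] by simp
  have "(\<lambda>x. local_rep c \<omega> x (as @ (r *\<^sub>R u) # bs)) = (\<lambda>x. r * local_rep c \<omega> x (as @ u # bs))"
    by (rule ext) (use linear_scale[OF lin] in simp)
  then show "local_deriv p c \<omega> ((as @ (r *\<^sub>R u) # bs)) v =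
      r *\<^sub>R local_deriv p c \<omega> ((as @ u # bs)) v"
    using frechet_derivative_at[OF has_derivative_mult_right[OF D], of r "as @ u # bs", symmetric] by simp
qed

lemma ext_deriv_1:
  assumes "chart_at \<A> p c"
  shows "ext_deriv \<A> \<omega> p c [v] = local_deriv p c \<omega> [] v"
  using assms by (simp add: ext_deriv_def)

lemma ext_deriv_2:
  assumes "chart_at \<A> p c"
  shows "ext_deriv \<A> \<omega> p c [v, w] = local_deriv p c \<omega> [w] v -
    local_deriv p c \<omega> [v] w"
  using assms by (simp add: ext_deriv_def)

lemma local_rep_transition:
  assumes \<omega>: "\<omega> \<in> forms \<A> l" and c: "c \<in> \<A>" and d: "d \<in> \<A>" and x: "x \<in> overlap c d"
  shows "local_rep c \<omega> x vs =
    local_rep d \<omega> (transition c d x) (map (frechet_derivative (transition c d) (at x)) vs)"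
proof -
  obtain q where q: "x = snd c q" "q \<in> fst c" "q \<in> fst d" using x by auto
  then have "\<omega> q c = \<omega> q d \<circ> map (transition_deriv q c d)"
    using c d by (intro forms_transition[OF \<omega>]) (auto simp: chart_at_def)
  then show ?thesis using q c d by (simp add: transition_deriv_def)
qed

lemma ext_deriv_forms_0:
  assumes \<omega>: "\<omega> \<in> forms \<A> 0"
  shows "ext_deriv \<A> \<omega> \<in> forms \<A> 1"
proof (rule formsI)
  fix p c assume c: "chart_at \<A> p c"
  show "ext_deriv \<A> \<omega> p c \<in> alt 1"
  proof (rule altI)
    show "ext_deriv \<A> \<omega> p c vs = 0" if "length vs \<noteq> 1" for vs
      using ext_deriv_length[OF \<omega>] that by simp
    show "linear (\<lambda>v. ext_deriv \<A> \<omega> p c (as @ v # bs))" if "Suc (length as + length bs) = 1" for as bs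
      using that linear_frechet_local_rep[OF \<omega> c, of "[]"] by (simp add: ext_deriv_1[OF c])
  qed simp
  fix d assume d: "chart_at \<A> p d"
  have cd: "c \<in> \<A>" "d \<in> \<A>" "p \<in> fst c" "p \<in> fst d" using c d by (auto simp: chart_at_def)
  show "ext_deriv \<A> \<omega> p c = ext_deriv \<A> \<omega> p d \<circ> map (transition_deriv p c d)"
  proof
    fix vs
    show "ext_deriv \<A> \<omega> p c vs = (ext_deriv \<A> \<omega> p d \<circ> map (transition_deriv p c d)) vs"
    proof (cases "length vs = 1")
      case True
      then obtain v where vs: "vs = [v]" by (auto simp: length_Suc_conv)
      have "((\<lambda>x. local_rep d \<omega> x []) has_derivative local_deriv p d \<omega> [])
          (at (transition c d (snd c p)))"
        using local_rep_has_derivative[OF \<omega> d, of "[]"] cd by simp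
      from diff_chain_at[OF transition_has_derivative[OF c d] this]
      have "((\<lambda>x. local_rep c \<omega> x []) has_derivative
          local_deriv p d \<omega> [] \<circ> transition_deriv p c d) (at (snd c p))"
        by (rule has_derivative_transform_within_open[where s="overlap c d"])
          (use cd open_overlap local_rep_transition[OF \<omega>] in auto)
      from frechet_derivative_at[OF this] show ?thesis
        by (simp add: vs ext_deriv_1[OF c] ext_deriv_1[OF d] fun_eq_iff)
    qed (simp add: ext_deriv_length[OF \<omega>])
  qed
qed (simp_all add: ext_deriv_outside ext_deriv_smooth[OF \<omega>])

text \<open>Differentiating the transformation law of a 1-form produces an extra term with second
  derivatives of the transition map. It is symmetric in the two arguments and cancels in the
  exterior derivative.\<close>

lemma ext_deriv_forms_1:
  assumes \<omega>: "\<omega> \<in> forms \<A> 1"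
  shows "ext_deriv \<A> \<omega> \<in> forms \<A> 2"
proof (rule formsI)
  fix p c assume c: "chart_at \<A> p c"
  show "ext_deriv \<A> \<omega> p c \<in> alt 2"
  proof (rule altI)
    show "ext_deriv \<A> \<omega> p c vs = 0" if "length vs \<noteq> 2" for vs
      using ext_deriv_length[OF \<omega>] that by simp
    show "linear (\<lambda>v. ext_deriv \<A> \<omega> p c (as @ v # bs))" if l: "Suc (length as + length bs) = 2" for as bs
    proof -
      note lin = linear_frechet_local_rep[OF \<omega> c] linear_frechet_local_rep_slot[OF \<omega> c, of "[]" "[]", simplified]
      have "linear (\<lambda>v. ext_deriv \<A> \<omega> p c [v, w])" "linear (\<lambda>v. ext_deriv \<A> \<omega> p c [w, v])" for w
        unfolding ext_deriv_2[OF c] by (intro linear_compose_sub lin)+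
      moreover have "length as = 0 \<and> length bs = 1 \<or> length as = 1 \<and> length bs = 0" using l by arith
      ultimately show ?thesis by (auto simp: length_Suc_conv)
    qed
    show "ext_deriv \<A> \<omega> p c (as @ x # x # bs) = 0" if "Suc (Suc (length as + length bs)) = 2" for as bs x
      using that by (simp add: ext_deriv_2[OF c])
  qed
  fix d assume d: "chart_at \<A> p d"
  have cd: "c \<in> \<A>" "d \<in> \<A>" "p \<in> fst c" "p \<in> fst d" using c d by (auto simp: chart_at_def)
  let ?x = "snd c p" and ?W = "overlap c d" and ?\<tau> = "transition c d" and ?T = "transition_deriv p c d"
  have W: "open ?W" "?x \<in> ?W" using open_overlap cd by auto
  \<comment> \<open>Scalar components, since the symmetry of second derivatives is stated for real
    functions.\<close>
  define t where "t i y = ?\<tau> y $ i" for i y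
  have t: "Ck_on k (t i) ?W" for k i
    using smooth_transition[OF cd(1,2)] unfolding t_def smooth_on_def by (intro Ck_on_component W) blast
  have t': "frechet_derivative ?\<tau> (at y) v $ i = frechet_derivative (t i) (at y) v" if y: "y \<in> ?W" for y v i
  proof -
    have "(?\<tau> has_derivative frechet_derivative ?\<tau> (at y)) (at y)"
      by (rule smooth_on_has_derivative[OF W(1) smooth_transition[OF cd(1,2)] y])
    from bounded_linear.has_derivative[OF bounded_linear_vec_nth this, of i]
    have "(t i has_derivative (\<lambda>v. frechet_derivative ?\<tau> (at y) v $ i)) (at y)" unfolding t_def .
    from frechet_derivative_at[OF this] show ?thesis by (simp add: fun_eq_iff)
  qed
  define H where "H i v w = frechet_derivative (\<lambda>y. frechet_derivative (t i) (at y) w) (at ?x) v" for i v w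
  have H_sym: "H i v w = H i w v" for i v w
    unfolding H_def by (rule second_derivative_symmetric[OF t W])
  \<comment> \<open>In the coordinates of \<open>c\<close> the form is a sum of derivatives of the
    transition map times coefficients taken in \<open>d\<close>. The product rule gives the extra
    term with \<open>H\<close>; the rest is the chain rule.\<close>
  have key: "frechet_derivative (\<lambda>x. local_rep c \<omega> x [w]) (at ?x) v =
      (\<Sum>i\<in>UNIV. H i v w * \<omega> p d [axis i 1]) + local_deriv p d \<omega> [?T w] (?T v)"
    for v w
  proof -
    let ?a = "\<lambda>i. \<lambda>x. local_rep d \<omega> x [axis i 1]"
    have rep: "local_rep d \<omega> z [u] = (\<Sum>i\<in>UNIV. u $ i * ?a i z)" for z u
      using alt_expand[OF local_rep_alt[OF \<omega>], of d z "[]" u "[]"] by simp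
    have tD: "((\<lambda>y. frechet_derivative (t i) (at y) w) has_derivative (\<lambda>v. H i v w)) (at ?x)" for i
      unfolding H_def using Ck_on_SucE(1)[OF Ck_on_SucE(2)[OF t[of "Suc (Suc 0)"] W(1)] W] by simp
    have aD: "((\<lambda>y. ?a i (?\<tau> y)) has_derivative (\<lambda>v. frechet_derivative (?a i) (at (snd d p)) (?T v))) (at ?x)" for i
    proof -
      have "(?a i has_derivative frechet_derivative (?a i) (at (snd d p))) (at (?\<tau> ?x))"
        using local_rep_has_derivative[OF \<omega> d] cd by simp
      from diff_chain_at[OF transition_has_derivative[OF c d] this] show ?thesis by (simp add: o_def)
    qed
    have "((\<lambda>y. \<Sum>i\<in>UNIV. frechet_derivative (t i) (at y) w * ?a i (?\<tau> y)) has_derivative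
       (\<lambda>v. \<Sum>i\<in>UNIV. frechet_derivative (t i) (at ?x) w * frechet_derivative (?a i) (at (snd d p)) (?T v) +
          H i v w * ?a i (?\<tau> ?x))) (at ?x)"
      by (intro has_derivative_sum has_derivative_mult tD aD)
    moreover have "(\<Sum>i\<in>UNIV. frechet_derivative (t i) (at y) w * ?a i (?\<tau> y)) = local_rep c \<omega> y [w]" if "y \<in> ?W" for y
      using local_rep_transition[OF \<omega> cd(1,2) that, of "[w]"]
        rep[of "?\<tau> y" "frechet_derivative ?\<tau> (at y) w"] by (simp add: t'[OF that])
    ultimately have "((\<lambda>y. local_rep c \<omega> y [w]) has_derivative
       (\<lambda>v. \<Sum>i\<in>UNIV. frechet_derivative (t i) (at ?x) w * frechet_derivative (?a i) (at (snd d p)) (?T v) +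
          H i v w * ?a i (?\<tau> ?x))) (at ?x)"
      by (rule has_derivative_transform_within_open[OF _ W])
    note fun_cong[OF frechet_derivative_at[OF this], of v, symmetric]
    moreover have "local_deriv p d \<omega> [?T w] (?T v) =
        (\<Sum>i\<in>UNIV. frechet_derivative (t i) (at ?x) w * frechet_derivative (?a i) (at (snd d p)) (?T v))"
    proof -
      have "((\<lambda>z. \<Sum>i\<in>UNIV. ?T w $ i * ?a i z) has_derivative
          (\<lambda>v. \<Sum>i\<in>UNIV. ?T w $ i * frechet_derivative (?a i) (at (snd d p)) v)) (at (snd d p))"
        by (intro has_derivative_sum has_derivative_mult_right local_rep_has_derivative[OF \<omega> d])
      then have "((\<lambda>z. local_rep d \<omega> z [?T w]) has_derivative
          (\<lambda>v. \<Sum>i\<in>UNIV. ?T w $ i * frechet_derivative (?a i) (at (snd d p)) v)) (at (snd d p))"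
        unfolding rep[of _ "?T w", symmetric] .
      from frechet_derivative_at[OF this, symmetric] show ?thesis
        unfolding transition_deriv_def t'[OF W(2)] by simp
    qed
    ultimately show ?thesis using cd by (simp add: sum.distrib)
  qed
  show "ext_deriv \<A> \<omega> p c = ext_deriv \<A> \<omega> p d \<circ> map ?T"
  proof
    fix vs
    show "ext_deriv \<A> \<omega> p c vs = (ext_deriv \<A> \<omega> p d \<circ> map ?T) vs"
    proof (cases "length vs = 2")
      case True
      then obtain v w where vs: "vs = [v, w]" by (auto simp: numeral_2_eq_2 length_Suc_conv)
      show ?thesis
        using H_sym by (simp add: vs ext_deriv_2[OF c] ext_deriv_2[OF d] key)
    qed (simp add: ext_deriv_length[OF \<omega>])
  qed
qed (simp_all add: ext_deriv_outside ext_deriv_smooth[OF \<omega>])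

end

section \<open>Functions\<close>

context manifold
begin

lemma form0_forms:
  assumes f: "f \<in> smooth_functions M \<A>"
  shows "form0 \<A> f \<in> forms \<A> 0"
proof (rule formsI)
  fix p c assume c: "chart_at \<A> p c"
  show "form0 \<A> f p c \<in> alt 0" by (rule altI) (simp_all add: form0_def)
  fix d assume "chart_at \<A> p d"
  with c show "form0 \<A> f p c = form0 \<A> f p d \<circ> map (transition_deriv p c d)"
    by (simp add: form0_def fun_eq_iff)
next
  fix p c assume "\<not> chart_at \<A> p c"
  then show "form0 \<A> f p c = 0" by (simp add: form0_def fun_eq_iff)
next
  fix c vs assume c: "c \<in> \<A>"
  have "local_rep c (form0 \<A> f) x vs = (if vs = [] then (f \<circ> inv_into (fst c) (snd c)) x else 0)"
    if x: "x \<in> snd c ` fst c" for x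
    using x c by (auto simp: form0_def chart_at_def)
  moreover have "smooth_on (\<lambda>x. if vs = [] then (f \<circ> inv_into (fst c) (snd c)) x else 0) (snd c ` fst c)"
    using f c unfolding smooth_functions_def
    by (intro smooth_on_if smooth_on_const open_image) (auto simp: o_def)
  ultimately show "smooth_on (\<lambda>x. local_rep c (form0 \<A> f) x vs) (snd c ` fst c)"
    using smooth_on_cong[OF open_image[OF c], of "\<lambda>x. local_rep c (form0 \<A> f) x vs"] by simp
qed

lemma forms_0: "forms \<A> 0 = form0 \<A> ` smooth_functions M \<A>"
proof
  show "form0 \<A> ` smooth_functions M \<A> \<subseteq> forms \<A> 0" using form0_forms by blast
  show "forms \<A> 0 \<subseteq> form0 \<A> ` smooth_functions M \<A>"
  proof
    fix \<omega> assume \<omega>: "\<omega> \<in> forms \<A> 0"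
    \<comment> \<open>In degree 0 the transformation law says that the value does not depend on the
      chart, so any chart around \<open>p\<close> may be chosen.\<close>
    define f where "f p = (if p \<in> topspace M then \<omega> p (SOME c. chart_at \<A> p c) [] else 0)" for p
    have f: "\<omega> p c [] = f p" if c: "chart_at \<A> p c" for p c
    proof -
      have "chart_at \<A> p (SOME c. chart_at \<A> p c)" using c by (rule someI)
      from forms_transition[OF \<omega> c this] show ?thesis
        using chart_at_topspace[OF c] by (simp add: f_def)
    qed
    have "form0 \<A> f = \<omega>"
    proof (intro ext)
      fix p c vs
      show "form0 \<A> f p c vs = \<omega> p c vs"
        using f[of p c] alt_length[OF forms_alt[OF \<omega>], of p c vs] forms_outside[OF \<omega>, of p c]
        by (cases "chart_at \<A> p c") (auto simp: form0_def)
    qed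
    moreover have "f \<in> smooth_functions M \<A>"
      unfolding smooth_functions_def
    proof (intro CollectI conjI allI impI ballI)
      fix p assume "p \<notin> topspace M" then show "f p = 0" by (simp add: f_def)
    next
      fix c assume c: "c \<in> \<A>"
      have "local_rep c \<omega> x [] = (f \<circ> inv_into (fst c) (snd c)) x" if x: "x \<in> snd c ` fst c" for x
      proof -
        obtain p where p: "chart_at \<A> p c" "x = snd c p" "local_rep c \<omega> x = \<omega> p c"
          using local_rep_image[OF c x] by metis
        then have "p \<in> fst c" by (simp add: chart_at_def)
        then show ?thesis using p f[OF p(1)] c by simp
      qed
      then show "smooth_on (f \<circ> inv_into (fst c) (snd c)) (snd c ` fst c)"
        using forms_smooth[OF \<omega> c, of "[]"] smooth_on_cong[OF open_image[OF c], of "\<lambda>x. local_rep c \<omega> x []"]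
        by (simp add: o_def)
    qed
    ultimately show "\<omega> \<in> form0 \<A> ` smooth_functions M \<A>" by blast
  qed
qed

lemma locally_constant_has_derivative:
  assumes f: "f \<in> locally_constant_functions M" and c: "c \<in> \<A>" and x: "x \<in> snd c ` fst c"
  shows "((f \<circ> inv_into (fst c) (snd c)) has_derivative (\<lambda>_. 0)) (at x)"
proof -
  obtain p where p: "p \<in> fst c" "x = snd c p" using x by blast
  then have "p \<in> topspace M" using chart_at_topspace c by (auto simp: chart_at_def)
  then obtain U where U: "openin M U" "p \<in> U" "\<And>q. q \<in> U \<Longrightarrow> f q = f p"
    using f unfolding locally_constant_functions_def by blast
  have "open (snd c ` (U \<inter> fst c))"
    using U openin_chart[OF c] by (intro open_image_openin[OF c]) auto
  then show ?thesis
  proof (rule has_derivative_transform_within_open[OF has_derivative_const[of "f p"]])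
    show "x \<in> snd c ` (U \<inter> fst c)" using p U(2) by blast
    show "f p = (f \<circ> inv_into (fst c) (snd c)) y" if "y \<in> snd c ` (U \<inter> fst c)" for y
      using that U(3) c by auto
  qed
qed

lemma locally_constant_smooth:
  assumes f: "f \<in> locally_constant_functions M"
  shows "f \<in> smooth_functions M \<A>"
  unfolding smooth_functions_def
proof (intro CollectI conjI allI impI ballI)
  show "f p = 0" if "p \<notin> topspace M" for p
    using f that unfolding locally_constant_functions_def by blast
  fix c assume c: "c \<in> \<A>"
  have "Ck_on (Suc k) (f \<circ> inv_into (fst c) (snd c)) (snd c ` fst c)" for k
    by (rule Ck_on_SucI[OF open_image[OF c] locally_constant_has_derivative[OF f c] Ck_on_const[OF open_image[OF c]]])
  then show "smooth_on (f \<circ> inv_into (fst c) (snd c)) (snd c ` fst c)"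
    unfolding smooth_on_def using Ck_on_SucD by blast
qed

text \<open>A zero exterior derivative makes the coordinate expression constant on a ball, which is
  convex, and the preimage of the ball is the required neighbourhood.\<close>

lemma ext_deriv_form0_eq_0_iff:
  assumes f: "f \<in> smooth_functions M \<A>"
  shows "ext_deriv \<A> (form0 \<A> f) = 0 \<longleftrightarrow> f \<in> locally_constant_functions M"
proof -
  have D: "frechet_derivative (\<lambda>x. local_rep c (form0 \<A> f) x []) (at x) =
      frechet_derivative (f \<circ> inv_into (fst c) (snd c)) (at x)" if "c \<in> \<A>" "x \<in> snd c ` fst c" for c x
    by (rule frechet_derivative_cong[OF open_image[OF that(1)] that(2)])
      (use that in \<open>auto simp: form0_def chart_at_def\<close>)
  show ?thesis
  proof
    assume d0: "ext_deriv \<A> (form0 \<A> f) = 0"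
    show "f \<in> locally_constant_functions M"
      unfolding locally_constant_functions_def
    proof (intro CollectI conjI allI impI ballI)
      show "f p = 0" if "p \<notin> topspace M" for p using f that unfolding smooth_functions_def by blast
      fix p assume "p \<in> topspace M"
      then obtain c where c: "chart_at \<A> p c" using chart_exists by blast
      then have c': "c \<in> \<A>" "p \<in> fst c" by (auto simp: chart_at_def)
      let ?h = "f \<circ> inv_into (fst c) (snd c)"
      obtain e where e: "e > 0" "ball (snd c p) e \<subseteq> snd c ` fst c"
        using open_image[OF c'(1)] c'(2) open_contains_ball by blast
      have h: "(?h has_derivative (\<lambda>_. 0)) (at x)" if x: "x \<in> snd c ` fst c" for x
      proof -
        obtain q where q: "chart_at \<A> q c" "x = snd c q" using local_rep_image[OF c'(1) x] by metis
        have "frechet_derivative ?h (at x) v = 0" for v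
          using fun_cong[OF fun_cong[OF fun_cong[OF d0, of q], of c], of "[v]"]
          unfolding ext_deriv_1[OF q(1)] q(2)[symmetric] D[OF c'(1) x] by simp
        moreover have "(?h has_derivative frechet_derivative ?h (at x)) (at x)"
          using f c'(1) unfolding smooth_functions_def
          by (intro smooth_on_has_derivative[OF open_image[OF c'(1)] _ x]) blast
        moreover have "frechet_derivative ?h (at x) = (\<lambda>_. 0)" using calculation(1) by (rule ext)
        ultimately show ?thesis by simp
      qed
      have "\<exists>k. \<forall>x\<in>ball (snd c p) e. ?h x = k"
        by (rule has_derivative_zero_constant[OF convex_ball])
          (use h e(2) in \<open>blast intro: has_derivative_at_withinI\<close>)
      then have const: "?h x = ?h (snd c p)" if "x \<in> ball (snd c p) e" for x
        using that e(1) by (metis centre_in_ball)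
      show "\<exists>U. openin M U \<and> p \<in> U \<and> (\<forall>q\<in>U. f q = f p)"
      proof (intro exI conjI ballI)
        show "openin M {q \<in> fst c. snd c q \<in> ball (snd c p) e}"
          by (rule openin_preimage[OF c'(1)]) simp
        show "p \<in> {q \<in> fst c. snd c q \<in> ball (snd c p) e}" using c' e by simp
        show "f q = f p" if q: "q \<in> {q \<in> fst c. snd c q \<in> ball (snd c p) e}" for q
          using const[of "snd c q"] q c' by simp
      qed
    qed
  next
    assume lc: "f \<in> locally_constant_functions M"
    show "ext_deriv \<A> (form0 \<A> f) = 0"
    proof (intro ext)
      fix p c vs
      show "ext_deriv \<A> (form0 \<A> f) p c vs = (0 :: 'm field) p c vs"
      proof (cases "chart_at \<A> p c \<and> length vs = 1")
        case True
        then obtain v where v: "vs = [v]" and c: "chart_at \<A> p c" by (auto simp: length_Suc_conv)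
        then have c': "c \<in> \<A>" "snd c p \<in> snd c ` fst c" by (auto simp: chart_at_def)
        show ?thesis
          unfolding v ext_deriv_1[OF c] D[OF c']
          using frechet_derivative_at[OF locally_constant_has_derivative[OF lc c'], symmetric] by simp
      next
        case False
        then show ?thesis
          using ext_deriv_length[OF form0_forms[OF f], of vs p c] ext_deriv_outside[of p c] by auto
      qed
    qed
  qed
qed

lemma closed_forms_0: "closed_forms \<A> 0 = form0 \<A> ` locally_constant_functions M"
  unfolding closed_forms_def forms_0
  using ext_deriv_form0_eq_0_iff locally_constant_smooth by auto

end

section \<open>Manifolds with a \<open>G\<^sub>2\<close>-structure\<close>

locale g2_manifold =
  fixes M :: "'m topology" and \<A> :: "'m chart set" and \<phi> :: "'m field"
  assumes G2: "G2_structure M \<A> \<phi>"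

sublocale g2_manifold \<subseteq> manifold
  using G2 unfolding G2_structure_def by unfold_locales blast

context g2_manifold
begin

abbreviation \<psi> :: "'m field" where "\<psi> \<equiv> star_phi \<A> \<phi>"

lemma phi_forms: "\<phi> \<in> forms \<A> 3"
  using G2 unfolding G2_structure_def by blast

lemma frame_exists:
  assumes "chart_at \<A> p c"
  shows "\<exists>L K. adapted_frame (\<phi> p c) L K"
proof -
  obtain L where L: "linear L" "bij L" "\<And>vs. \<phi> p c (map L vs) = phi0 vs"
    using G2 assms unfolding G2_structure_def by blast
  have "adapted_frame (\<phi> p c) L (inv L)"
  proof (rule adapted_frame.intro)
    show "linear (inv L)" using inj_linear_imp_inv_linear[OF L(1)] L(2) bij_is_inj by blast
    show "\<phi> p c \<circ> map L = phi0" using L(3) by (simp add: fun_eq_iff)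
    show "L (inv L v) = v" "inv L (L v) = v" for v
      using L(2) by (simp_all add: bij_is_surj surj_f_inv_f bij_is_inj)
  qed fact
  then show ?thesis by blast
qed

lemma chart_family:
  assumes c: "c \<in> \<A>"
  shows "adapted_family (snd c ` fst c) (local_rep c \<phi>)"
proof
  show "open (snd c ` fst c)" by (rule open_image[OF c])
  show "smooth_on (\<lambda>x. local_rep c \<phi> x vs) (snd c ` fst c)" for vs by (rule forms_smooth[OF phi_forms c])
  show "\<exists>L K. adapted_frame (local_rep c \<phi> x) L K" if "x \<in> snd c ` fst c" for x
    using local_rep_image[OF c that] frame_exists by metis
qed

lemma frame_transition:
  assumes c: "chart_at \<A> p c" and d: "chart_at \<A> p d" and fr: "adapted_frame (\<phi> p c) L K"
  shows "adapted_frame (\<phi> p d) (transition_deriv p c d \<circ> L) (K \<circ> transition_deriv p d c)"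
  using adapted_frame_change[OF fr linear_transition_deriv[OF c d] linear_transition_deriv[OF d c]
      transition_deriv_inverse[OF d c] transition_deriv_inverse[OF c d] forms_transition[OF phi_forms c d]] .

lemma star_phi_frame:
  assumes "chart_at \<A> p c" "adapted_frame (\<phi> p c) L K"
  shows "\<psi> p c = psi0 \<circ> map K"
  using assms adapted_frame.hodge_star_phi by (simp add: star_phi_def)

text \<open>A frame carried from one chart to another computes the dual form there too, which gives
  the transformation law; smoothness rests on \<open>psi_eval\<close>.\<close>

lemma star_phi_forms: "\<psi> \<in> forms \<A> 4"
proof (rule formsI)
  fix p c assume c: "chart_at \<A> p c"
  obtain L K where fr: "adapted_frame (\<phi> p c) L K" using frame_exists[OF c] by blast
  show "\<psi> p c \<in> alt 4"
    unfolding star_phi_frame[OF c fr] using adapted_frame.psi_alt[OF fr] .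
  fix d assume d: "chart_at \<A> p d"
  show "\<psi> p c = \<psi> p d \<circ> map (transition_deriv p c d)"
    unfolding star_phi_frame[OF c fr] star_phi_frame[OF d frame_transition[OF c d fr]]
    by (simp add: fun_eq_iff o_def transition_deriv_inverse[OF c d])
next
  fix p c assume "\<not> chart_at \<A> p c" then show "\<psi> p c = 0" by (simp add: star_phi_def)
next
  fix c vs assume c: "c \<in> \<A>"
  have "local_rep c \<psi> x vs =
      hodge_star (g2_metric (local_rep c \<phi> x)) (g2_vol (local_rep c \<phi> x)) 3 (local_rep c \<phi> x) vs"
    if x: "x \<in> snd c ` fst c" for x
  proof -
    obtain p where "chart_at \<A> p c" "\<And>\<omega>. local_rep c \<omega> x = \<omega> p c" using local_rep_image[OF c x] by metis
    then show ?thesis by (simp add: star_phi_def)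
  qed
  then show "smooth_on (\<lambda>x. local_rep c \<psi> x vs) (snd c ` fst c)"
    using adapted_family.smooth_hodge_star[OF chart_family[OF c], of vs]
      smooth_on_cong[OF open_image[OF c], of "\<lambda>x. local_rep c \<psi> x vs"] by simp
qed

section \<open>Raising indices of fields\<close>

definition raise_form :: "'m field \<Rightarrow> 'm field" where
  "raise_form \<omega> p c = \<omega> p c \<circ> map (sharp (g2_metric (\<phi> p c)))"

text \<open>In any frame raising is \<open>L\<close> after its adjoint. Replacing \<open>L\<close>
  by \<open>?T \<circ> L\<close> puts \<open>?T\<close> in front and its adjoint behind, which is
  the transformation law of multivectors.\<close>

lemma raise_form_mvecs:
  assumes \<omega>: "\<omega> \<in> forms \<A> l"
  shows "raise_form \<omega> \<in> mvecs \<A> l"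
proof (rule mvecsI)
  fix p c assume c: "chart_at \<A> p c"
  obtain L K where fr: "adapted_frame (\<phi> p c) L K" using frame_exists[OF c] by blast
  interpret adapted_frame "\<phi> p c" L K by (rule fr)
  have "sharp (g2_metric (\<phi> p c)) = L \<circ> adjoint L" by (simp add: fun_eq_iff sharp_eq)
  then have "linear (sharp (g2_metric (\<phi> p c)))"
    using linear_compose[OF adjoint_linear[OF linear_L] linear_L] by simp
  then show "raise_form \<omega> p c \<in> alt l"
    unfolding raise_form_def by (rule alt_map[OF forms_alt[OF \<omega> c]])
  fix d assume d: "chart_at \<A> p d"
  let ?T = "transition_deriv p c d"
  note T = linear_transition_deriv[OF c d]
  have "adjoint (?T \<circ> L) \<xi> = adjoint L (adjoint ?T \<xi>)" for \<xi>
  proof (rule vector_eq_ldot[THEN iffD1], rule allI)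
    fix z show "z \<bullet> adjoint (?T \<circ> L) \<xi> = z \<bullet> adjoint L (adjoint ?T \<xi>)"
      by (simp add: adjoint_works linear_L T linear_compose)
  qed
  then have sharp_d: "sharp (g2_metric (\<phi> p d)) = ?T \<circ> sharp (g2_metric (\<phi> p c)) \<circ> adjoint ?T"
    using adapted_frame.sharp_eq[OF frame_transition[OF c d fr]] by (simp add: sharp_eq fun_eq_iff)
  show "raise_form \<omega> p d = raise_form \<omega> p c \<circ> map (adjoint ?T)"
    unfolding raise_form_def forms_transition[OF \<omega> c d] sharp_d by (simp add: fun_eq_iff o_assoc)
next
  fix p c assume "\<not> chart_at \<A> p c" then show "raise_form \<omega> p c = 0"
    using forms_outside[OF \<omega>] by (simp add: raise_form_def fun_eq_iff)
next
  fix c vs assume c: "c \<in> \<A>"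
  have "local_rep c (raise_form \<omega>) x vs = (local_rep c \<omega> x \<circ> map (sharp (g2_metric (local_rep c \<phi> x)))) vs" for x
    by (simp add: local_rep_def raise_form_def)
  then show "smooth_on (\<lambda>x. local_rep c (raise_form \<omega>) x vs) (snd c ` fst c)"
    using adapted_family.smooth_raise[OF chart_family[OF c], of "local_rep c \<omega>" l vs]
      local_rep_alt[OF \<omega>] forms_smooth[OF \<omega> c] by simp
qed

lemma contract_raise_forms:
  assumes "\<alpha> \<in> forms \<A> q" "\<omega> \<in> forms \<A> m" "q + l = m"
  shows "field_contract q (raise_form \<alpha>) \<omega> \<in> forms \<A> l"
  using field_contract_forms[OF raise_form_mvecs[OF assms(1)]] assms(2,3) by blast

lemma frame_eqI:
  assumes "\<And>p c L K. chart_at \<A> p c \<Longrightarrow> adapted_frame (\<phi> p c) L K \<Longrightarrow> \<omega> p c = \<eta> p c"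
    and "\<omega> \<in> forms \<A> l" "\<eta> \<in> forms \<A> l"
  shows "\<omega> = \<eta>"
  using assms(1) frame_exists forms_outside[OF assms(2)] forms_outside[OF assms(3)] by (intro ext) metis

section \<open>Surjectivity and injectivity of the contractions on fields\<close>

lemma contract_surjI:
  assumes "Q \<in> mvecs \<A> q" "field_contract q Q \<omega> = r *\<^sub>R \<alpha>" "r \<noteq> 0"
  shows "\<exists>Q\<in>mvecs \<A> q. field_contract q Q \<omega> = \<alpha>"
  using assms by (intro bexI[of _ "inverse r *\<^sub>R Q"]) (simp_all add: field_contract_scale subspace_scale[OF subspace_mvecs])

lemma contract_phi_surj:
  assumes \<alpha>: "\<alpha> \<in> forms \<A> 1"
  shows "\<exists>Q\<in>mvecs \<A> 2. field_contract 2 Q \<phi> = \<alpha>"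
proof (rule contract_surjI)
  let ?\<beta> = "field_contract 1 (raise_form \<alpha>) \<phi>"
  have \<beta>: "?\<beta> \<in> forms \<A> 2" by (rule contract_raise_forms[OF \<alpha> phi_forms]) simp
  then show "raise_form ?\<beta> \<in> mvecs \<A> 2" by (rule raise_form_mvecs)
  have "field_contract 2 (raise_form ?\<beta>) \<phi> \<in> forms \<A> 1" by (rule contract_raise_forms[OF \<beta> phi_forms]) simp
  then show "field_contract 2 (raise_form ?\<beta>) \<phi> = 3 *\<^sub>R \<alpha>"
    by (rule frame_eqI[rotated, OF _ subspace_scale[OF subspace_forms \<alpha>]])
      (simp only: field_scale field_contract_def raise_form_def star_phi_frame
        adapted_frame.contract_phi_phi forms_alt[OF \<alpha>])
qed simp

lemma contract_psi_3_surj: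
  assumes \<alpha>: "\<alpha> \<in> forms \<A> 1"
  shows "\<exists>Q\<in>mvecs \<A> 3. field_contract 3 Q \<psi> = \<alpha>"
proof (rule contract_surjI)
  let ?\<beta> = "field_contract 1 (raise_form \<alpha>) \<psi>"
  have \<beta>: "?\<beta> \<in> forms \<A> 3" by (rule contract_raise_forms[OF \<alpha> star_phi_forms]) simp
  then show "raise_form ?\<beta> \<in> mvecs \<A> 3" by (rule raise_form_mvecs)
  have "field_contract 3 (raise_form ?\<beta>) \<psi> \<in> forms \<A> 1" by (rule contract_raise_forms[OF \<beta> star_phi_forms]) simp
  then show "field_contract 3 (raise_form ?\<beta>) \<psi> = (-4) *\<^sub>R \<alpha>"
    by (rule frame_eqI[rotated, OF _ subspace_scale[OF subspace_forms \<alpha>]])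
      (simp only: field_scale field_contract_def raise_form_def star_phi_frame
        adapted_frame.contract_psi_psi_3 forms_alt[OF \<alpha>])
qed simp

lemma contract_psi_2_surj:
  assumes \<alpha>: "\<alpha> \<in> forms \<A> 2"
  shows "\<exists>Q\<in>mvecs \<A> 2. field_contract 2 Q \<psi> = \<alpha>"
proof (rule contract_surjI)
  let ?\<beta> = "field_contract 2 (raise_form \<alpha>) \<psi>"
  have \<beta>: "?\<beta> \<in> forms \<A> 2" by (rule contract_raise_forms[OF \<alpha> star_phi_forms]) simp
  \<comment> \<open>From \<open>T (T - 1) = 2\<close> a preimage of \<open>\<alpha>\<close> is half
    of \<open>T \<alpha> - \<alpha>\<close> with raised indices.\<close>
  show "raise_form ?\<beta> + (-1) *\<^sub>R raise_form \<alpha> \<in> mvecs \<A> 2"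
    by (intro subspace_scale subspace_add subspace_mvecs raise_form_mvecs \<alpha> \<beta>)
  have "field_contract 2 (raise_form ?\<beta>) \<psi> \<in> forms \<A> 2" by (rule contract_raise_forms[OF \<beta> star_phi_forms]) simp
  then have "field_contract 2 (raise_form ?\<beta>) \<psi> = ?\<beta> + 2 *\<^sub>R \<alpha>"
    by (rule frame_eqI[rotated, OF _ subspace_add[OF subspace_forms \<beta> subspace_scale[OF subspace_forms \<alpha>]]])
      (simp only: plus_fun_apply field_scale field_contract_def raise_form_def star_phi_frame
        adapted_frame.contract_psi_psi_2 forms_alt[OF \<alpha>])
  then show "field_contract 2 (raise_form ?\<beta> + (-1) *\<^sub>R raise_form \<alpha>) \<psi> = 2 *\<^sub>R \<alpha>"
    unfolding field_contract_scale field_contract_add by simp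
qed simp

lemma contract_injective:
  assumes "Q \<in> mvecs \<A> q" "field_contract q Q \<omega> = 0"
    and "\<And>p c. chart_at \<A> p c \<Longrightarrow> Q p c \<in> alt q \<Longrightarrow> contract q (Q p c) (\<omega> p c) = 0 \<Longrightarrow> Q p c = 0"
  shows "Q = 0"
proof (intro ext)
  fix p c vs
  have "contract q (Q p c) (\<omega> p c) = 0"
    using fun_cong[OF fun_cong[OF assms(2), of p], of c] by (simp add: field_contract_def)
  then have "Q p c = 0"
    using assms(3) mvecs_alt[OF assms(1)] mvecs_outside[OF assms(1)] by blast
  then show "Q p c vs = 0 p c vs" by simp
qed

lemma contract_phi_injective:
  assumes "Q \<in> mvecs \<A> 1" "field_contract 1 Q \<phi> = 0"
  shows "Q = 0"
proof (rule contract_injective[OF assms])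
  fix p c assume "chart_at \<A> p c" and Q: "Q p c \<in> alt 1" "contract 1 (Q p c) (\<phi> p c) = 0"
  then obtain L K where "adapted_frame (\<phi> p c) L K" using frame_exists by blast
  then show "Q p c = 0" using adapted_frame.contract_1_phi_inj Q by blast
qed

lemma contract_psi_injective:
  assumes "Q \<in> mvecs \<A> q" "field_contract q Q \<psi> = 0" "q = 1 \<or> q = 2"
  shows "Q = 0"
proof (rule contract_injective[OF assms(1,2)])
  fix p c assume c: "chart_at \<A> p c" and Q: "Q p c \<in> alt q" "contract q (Q p c) (\<psi> p c) = 0"
  obtain L K where fr: "adapted_frame (\<phi> p c) L K" using frame_exists[OF c] by blast
  show "Q p c = 0"
    using Q adapted_frame.contract_1_psi_inj[OF fr] adapted_frame.contract_2_psi_inj[OF fr] assms(3)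
    unfolding star_phi_frame[OF c fr] by blast
qed

section \<open>Rochesterian and coRochesterian spaces and their class maps\<close>

lemma R_ker_1: "R_ker \<A> \<phi> 1 = {0}"
  unfolding R_ker_def using contract_phi_injective subspace_0[OF subspace_mvecs]
  by (auto simp: field_contract_def contract_def fun_eq_iff)

lemma cR_ker_eq_0: "q = 1 \<or> q = 2 \<Longrightarrow> cR_ker \<A> \<phi> q = {0}"
  unfolding cR_ker_def using contract_psi_injective subspace_0[OF subspace_mvecs]
  by (auto simp: field_contract_def contract_def fun_eq_iff)

lemma R_forms_0: "R_forms \<A> \<phi> 0 = forms \<A> 0"
  unfolding R_forms_def using contract_phi_surj[OF ext_deriv_forms_0] by (auto, metis)

lemma cR_forms_0: "cR_forms \<A> \<phi> 0 = forms \<A> 0"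
  unfolding cR_forms_def using contract_psi_3_surj[OF ext_deriv_forms_0] by (auto, metis)

lemma cR_forms_1: "cR_forms \<A> \<phi> 1 = forms \<A> 1"
proof -
  have "(3::nat) - 1 = 2" by simp
  then show ?thesis
    unfolding cR_forms_def using contract_psi_2_surj[OF ext_deriv_forms_1] by (auto, metis)
qed

lemma linear_relation_contract:
  "linear_relation (mvecs \<A> q) (forms \<A> l) (\<lambda>Q. field_contract q Q \<omega>) (ext_deriv \<A>)"
  by unfold_locales (simp_all add: subspace_mvecs subspace_forms field_contract_add field_contract_scale
    ext_deriv_add ext_deriv_scale)

text \<open>The shape common to the five class maps of the theorem: an isomorphism of quotients
  together with its value on the class of a multivector field.\<close>

definition class_iso :: "nat \<Rightarrow> 'm field \<Rightarrow> nat \<Rightarrow> 'm field set \<Rightarrow> 'm field set \<Rightarrow> 'm field set \<Rightarrow>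
    ('m field set \<Rightarrow> 'm field set) \<Rightarrow> bool" where
  "class_iso q \<omega> l X K Y F \<longleftrightarrow> quotient_iso X K Y (closed_forms \<A> l) F \<and>
     (\<forall>Q\<in>mvecs \<A> q. \<forall>\<alpha>\<in>forms \<A> l. field_contract q Q \<omega> = ext_deriv \<A> \<alpha> \<longrightarrow>
        F (coset K Q) = coset (closed_forms \<A> l) \<alpha>)"

lemma R_iso:
  assumes "q + l = 2"
  obtains F where "class_iso q \<phi> l (R_mvecs \<A> \<phi> q) (R_ker \<A> \<phi> q) (R_forms \<A> \<phi> l) F"
proof -
  have "2 - q = l" "2 - l = q" using assms by auto
  then show thesis
    using that linear_relation.quotient_iso_transfer[OF linear_relation_contract, of q l \<phi>]
      linear_relation.transfer_coset[OF linear_relation_contract, of _ q _ l \<phi>]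
    unfolding class_iso_def R_mvecs_def R_ker_def R_forms_def closed_forms_def by auto
qed

lemma cR_iso:
  assumes "q + l = 3"
  obtains F where "class_iso q \<psi> l (cR_mvecs \<A> \<phi> q) (cR_ker \<A> \<phi> q) (cR_forms \<A> \<phi> l) F"
proof -
  have "3 - q = l" "3 - l = q" using assms by auto
  then show thesis
    using that linear_relation.quotient_iso_transfer[OF linear_relation_contract, of q l \<psi>]
      linear_relation.transfer_coset[OF linear_relation_contract, of _ q _ l \<psi>]
    unfolding class_iso_def cR_mvecs_def cR_ker_def cR_forms_def closed_forms_def by auto
qed

text \<open>The field \<open>\<iota> X\<close> is the solution of the contraction equation with
  \<open>\<psi>\<close>; it exists because every 2-form is such a contraction. Linearity follows
  from uniqueness, and injectivity from that of the contraction of vectors with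
  \<open>\<phi>\<close>.\<close>

lemma R_to_cR:
  obtains \<iota> where "linear_between (R_mvecs \<A> \<phi> 1) (cR_mvecs \<A> \<phi> 2) \<iota>" "inj_on \<iota> (R_mvecs \<A> \<phi> 1)"
    "\<And>X U. X \<in> R_mvecs \<A> \<phi> 1 \<Longrightarrow> U \<in> mvecs \<A> 2 \<Longrightarrow>
       field_contract 2 U \<psi> = field_contract 1 X \<phi> \<longleftrightarrow> U = \<iota> X"
proof
  let ?P = "\<lambda>X U. U \<in> mvecs \<A> 2 \<and> field_contract 2 U \<psi> = field_contract 1 X \<phi>"
  define \<iota> where "\<iota> X = (THE U. ?P X U)" for X
  have R: "X \<in> mvecs \<A> 1" "\<exists>\<alpha>\<in>forms \<A> 1. field_contract 1 X \<phi> = ext_deriv \<A> \<alpha>" if "X \<in> R_mvecs \<A> \<phi> 1" for X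
    using that unfolding R_mvecs_def by simp_all
  have unique: "U = V" if U: "?P X U" and V: "?P X V" for X U V
  proof -
    note lr = linear_relation.A_diff[OF linear_relation_contract]
    have "field_contract 2 (U - V) \<psi> = 0" using lr[of U 2 V] U V by simp
    moreover have "U - V \<in> mvecs \<A> 2" using U V by (intro subspace_diff[OF subspace_mvecs]) auto
    ultimately show ?thesis using contract_psi_injective[of "U - V" 2] by simp
  qed
  have ex: "\<exists>U. ?P X U" if X: "X \<in> mvecs \<A> 1" for X
  proof -
    have "field_contract 1 X \<phi> \<in> forms \<A> 2"
      by (rule field_contract_forms[OF X]) (use phi_forms in \<open>simp add: numeral_3_eq_3\<close>)
    then show ?thesis using contract_psi_2_surj by blast
  qed
  have \<iota>: "?P X (\<iota> X)" if "X \<in> mvecs \<A> 1" for X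
    unfolding \<iota>_def by (rule theI'[of "?P X"], rule ex_ex1I[OF ex[OF that]]) (rule unique)
  show "field_contract 2 U \<psi> = field_contract 1 X \<phi> \<longleftrightarrow> U = \<iota> X"
    if "X \<in> R_mvecs \<A> \<phi> 1" "U \<in> mvecs \<A> 2" for X U
    using \<iota>[OF R(1)[OF that(1)]] unique that(2) by blast
  show "inj_on \<iota> (R_mvecs \<A> \<phi> 1)"
  proof (rule inj_onI)
    fix X Y assume X: "X \<in> R_mvecs \<A> \<phi> 1" and Y: "Y \<in> R_mvecs \<A> \<phi> 1" and eq: "\<iota> X = \<iota> Y"
    have "field_contract 1 X \<phi> = field_contract 1 Y \<phi>"
      using \<iota>[OF R(1)[OF X]] \<iota>[OF R(1)[OF Y]] eq by metis
    then have "field_contract 1 (X - Y) \<phi> = 0"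
      using linear_relation.A_diff[OF linear_relation_contract, of X 1 Y] R(1)[OF X] R(1)[OF Y] by simp
    then show "X = Y"
      using contract_phi_injective[of "X - Y"] subspace_diff[OF subspace_mvecs R(1)[OF X] R(1)[OF Y]] by simp
  qed
  show "linear_between (R_mvecs \<A> \<phi> 1) (cR_mvecs \<A> \<phi> 2) \<iota>"
    unfolding linear_between_def
  proof (intro conjI ballI allI)
    show "subspace (R_mvecs \<A> \<phi> 1)" "subspace (cR_mvecs \<A> \<phi> 2)"
      using R_iso[of 1 1] cR_iso[of 2 1] unfolding class_iso_def quotient_iso_def by auto
    \<comment> \<open>A primitive for \<open>X\<close> is one for \<open>\<iota> X\<close> as well,
      since both contractions are the same 2-form.\<close>
    show "\<iota> ` R_mvecs \<A> \<phi> 1 \<subseteq> cR_mvecs \<A> \<phi> 2"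
    proof
      fix U assume "U \<in> \<iota> ` R_mvecs \<A> \<phi> 1"
      then obtain X where X: "X \<in> R_mvecs \<A> \<phi> 1" "U = \<iota> X" by blast
      then show "U \<in> cR_mvecs \<A> \<phi> 2"
        using R[OF X(1)] \<iota>[of X] unfolding cR_mvecs_def by auto
    qed
    fix X assume X: "X \<in> R_mvecs \<A> \<phi> 1"
    show "\<iota> (r *\<^sub>R X) = r *\<^sub>R \<iota> X" for r
    proof (rule unique[of _ "r *\<^sub>R X"])
      show "?P (r *\<^sub>R X) (\<iota> (r *\<^sub>R X))" by (intro \<iota> subspace_scale[OF subspace_mvecs] R(1) X)
      show "?P (r *\<^sub>R X) (r *\<^sub>R \<iota> X)"
        using \<iota>[OF R(1)[OF X]] subspace_scale[OF subspace_mvecs] by (simp add: field_contract_scale)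
    qed
    fix Y assume Y: "Y \<in> R_mvecs \<A> \<phi> 1"
    show "\<iota> (X + Y) = \<iota> X + \<iota> Y"
    proof (rule unique[of _ "X + Y"])
      show "?P (X + Y) (\<iota> (X + Y))" by (intro \<iota> subspace_add[OF subspace_mvecs] R(1) X Y)
      show "?P (X + Y) (\<iota> X + \<iota> Y)"
        using \<iota>[OF R(1)[OF X]] \<iota>[OF R(1)[OF Y]] subspace_add[OF subspace_mvecs] by (simp add: field_contract_add)
    qed
  qed
qed

end

theorem theorem1p1:
  fixes M :: "'m topology" and \<A> :: "'m chart set" and \<phi> \<psi> :: "'m field"
  assumes "G2_manifold M \<A> \<phi>" and "\<psi> = star_phi \<A> \<phi>"
  shows
    "\<comment> \<open>(i)\<close>
     (R_ker \<A> \<phi> 1 = {0} \<and> cR_ker \<A> \<phi> 2 = {0} \<and>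
      qR_forms \<A> \<phi> 1 \<subseteq> qcR_forms \<A> \<phi> 1 \<and>
      qcR_forms \<A> \<phi> 1 = quotient_space (forms \<A> 1) (closed_forms \<A> 1) \<and>
      (\<exists>F G \<iota>.
        quotient_iso (R_mvecs \<A> \<phi> 1) (R_ker \<A> \<phi> 1) (R_forms \<A> \<phi> 1) (closed_forms \<A> 1) F \<and>
        (\<forall>Q\<in>R_mvecs \<A> \<phi> 1. \<forall>\<alpha>\<in>forms \<A> 1. field_contract 1 Q \<phi> = ext_deriv \<A> \<alpha> \<longrightarrow>
           F (coset (R_ker \<A> \<phi> 1) Q) = coset (closed_forms \<A> 1) \<alpha>) \<and>
        quotient_iso (cR_mvecs \<A> \<phi> 2) (cR_ker \<A> \<phi> 2) (cR_forms \<A> \<phi> 1) (closed_forms \<A> 1) G \<and>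
        (\<forall>Q\<in>cR_mvecs \<A> \<phi> 2. \<forall>\<alpha>\<in>forms \<A> 1. field_contract 2 Q \<psi> = ext_deriv \<A> \<alpha> \<longrightarrow>
           G (coset (cR_ker \<A> \<phi> 2) Q) = coset (closed_forms \<A> 1) \<alpha>) \<and>
        linear_between (R_mvecs \<A> \<phi> 1) (cR_mvecs \<A> \<phi> 2) \<iota> \<and> inj_on \<iota> (R_mvecs \<A> \<phi> 1) \<and>
        (\<forall>X\<in>R_mvecs \<A> \<phi> 1. G (coset (cR_ker \<A> \<phi> 2) (\<iota> X)) = F (coset (R_ker \<A> \<phi> 1) X)) \<and>
        (\<forall>X\<in>R_mvecs \<A> \<phi> 1. \<forall>\<alpha>\<in>forms \<A> 1. field_contract 1 X \<phi> = ext_deriv \<A> \<alpha> \<longrightarrow>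
           (\<forall>U\<in>mvecs \<A> 2. field_contract 2 U \<psi> = ext_deriv \<A> \<alpha> \<longleftrightarrow> U = \<iota> X))))
   \<and> \<comment> \<open>(ii)\<close>
     (qR_forms \<A> \<phi> 0 = qcR_forms \<A> \<phi> 0 \<and>
      qcR_forms \<A> \<phi> 0 = quotient_space (form0 \<A> ` smooth_functions M \<A>)
                                       (form0 \<A> ` locally_constant_functions M) \<and>
      (\<exists>F G H.
        quotient_iso (R_mvecs \<A> \<phi> 2) (R_ker \<A> \<phi> 2) (R_forms \<A> \<phi> 0) (closed_forms \<A> 0) F \<and>
        (\<forall>Q\<in>R_mvecs \<A> \<phi> 2. \<forall>f\<in>smooth_functions M \<A>.
           field_contract 2 Q \<phi> = ext_deriv \<A> (form0 \<A> f) \<longrightarrow>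
           F (coset (R_ker \<A> \<phi> 2) Q) = coset (closed_forms \<A> 0) (form0 \<A> f)) \<and>
        quotient_iso (cR_mvecs \<A> \<phi> 3) (cR_ker \<A> \<phi> 3) (cR_forms \<A> \<phi> 0) (closed_forms \<A> 0) G \<and>
        (\<forall>Q\<in>cR_mvecs \<A> \<phi> 3. \<forall>f\<in>smooth_functions M \<A>.
           field_contract 3 Q \<psi> = ext_deriv \<A> (form0 \<A> f) \<longrightarrow>
           G (coset (cR_ker \<A> \<phi> 3) Q) = coset (closed_forms \<A> 0) (form0 \<A> f)) \<and>
        quotient_iso (R_mvecs \<A> \<phi> 2) (R_ker \<A> \<phi> 2) (cR_mvecs \<A> \<phi> 3) (cR_ker \<A> \<phi> 3) H \<and>
        (\<forall>C\<in>qR_mvecs \<A> \<phi> 2. G (H C) = F C)))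
   \<and> \<comment> \<open>(iii)\<close>
     (cR_ker \<A> \<phi> 1 = {0} \<and>
      (\<exists>F.
        quotient_iso (cR_mvecs \<A> \<phi> 1) (cR_ker \<A> \<phi> 1) (cR_forms \<A> \<phi> 2) (closed_forms \<A> 2) F \<and>
        (\<forall>X\<in>cR_mvecs \<A> \<phi> 1. \<forall>\<alpha>\<in>forms \<A> 2. field_contract 1 X \<psi> = ext_deriv \<A> \<alpha> \<longrightarrow>
           F (coset (cR_ker \<A> \<phi> 1) X) = coset (closed_forms \<A> 2) \<alpha>)))"
proof -
  interpret g2_manifold M \<A> \<phi>
    using assms(1) unfolding G2_manifold_def by unfold_locales blast
  have sub: "R_mvecs \<A> \<phi> q \<subseteq> mvecs \<A> q" "cR_mvecs \<A> \<phi> q \<subseteq> mvecs \<A> q" for q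
    unfolding R_mvecs_def cR_mvecs_def by blast+
  obtain F1 where F1: "class_iso 1 \<phi> 1 (R_mvecs \<A> \<phi> 1) (R_ker \<A> \<phi> 1) (R_forms \<A> \<phi> 1) F1"
    by (rule R_iso[of 1 1]) simp
  obtain G1 where G1: "class_iso 2 \<psi> 1 (cR_mvecs \<A> \<phi> 2) (cR_ker \<A> \<phi> 2) (cR_forms \<A> \<phi> 1) G1"
    unfolding assms(2) by (rule cR_iso[of 2 1]) simp
  obtain F0 where F0: "class_iso 2 \<phi> 0 (R_mvecs \<A> \<phi> 2) (R_ker \<A> \<phi> 2) (R_forms \<A> \<phi> 0) F0"
    by (rule R_iso[of 2 0]) simp
  obtain G0 where G0: "class_iso 3 \<psi> 0 (cR_mvecs \<A> \<phi> 3) (cR_ker \<A> \<phi> 3) (cR_forms \<A> \<phi> 0) G0"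
    unfolding assms(2) by (rule cR_iso[of 3 0]) simp
  obtain F2 where F2: "class_iso 1 \<psi> 2 (cR_mvecs \<A> \<phi> 1) (cR_ker \<A> \<phi> 1) (cR_forms \<A> \<phi> 2) F2"
    unfolding assms(2) by (rule cR_iso[of 1 2]) simp
  obtain \<iota> where \<iota>: "linear_between (R_mvecs \<A> \<phi> 1) (cR_mvecs \<A> \<phi> 2) \<iota>" "inj_on \<iota> (R_mvecs \<A> \<phi> 1)"
    "\<And>X U. X \<in> R_mvecs \<A> \<phi> 1 \<Longrightarrow> U \<in> mvecs \<A> 2 \<Longrightarrow>
       field_contract 2 U \<psi> = field_contract 1 X \<phi> \<longleftrightarrow> U = \<iota> X"
    unfolding assms(2) using R_to_cR by blast
  \<comment> \<open>Both sides are the class of one primitive \<open>\<alpha>\<close> common to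
    \<open>X\<close> and \<open>\<iota> X\<close>.\<close>
  have GF: "G1 (coset (cR_ker \<A> \<phi> 2) (\<iota> X)) = F1 (coset (R_ker \<A> \<phi> 1) X)" if X: "X \<in> R_mvecs \<A> \<phi> 1" for X
  proof -
    obtain \<alpha> where \<alpha>: "\<alpha> \<in> forms \<A> 1" "field_contract 1 X \<phi> = ext_deriv \<A> \<alpha>"
      using X unfolding R_mvecs_def by auto
    have "\<iota> X \<in> mvecs \<A> 2" using \<iota>(1) X sub(2) unfolding linear_between_def by blast
    moreover from this have "field_contract 2 (\<iota> X) \<psi> = ext_deriv \<A> \<alpha>" using \<iota>(3)[OF X] \<alpha>(2) by simp
    ultimately have "G1 (coset (cR_ker \<A> \<phi> 2) (\<iota> X)) = coset (closed_forms \<A> 1) \<alpha>"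
      using G1 \<alpha>(1) unfolding class_iso_def by blast
    moreover have "F1 (coset (R_ker \<A> \<phi> 1) X) = coset (closed_forms \<A> 1) \<alpha>"
      using F1 X sub(1) \<alpha> unfolding class_iso_def by blast
    ultimately show ?thesis by simp
  qed
  \<comment> \<open>Written with the common target \<open>forms \<A> 0\<close>, so that one
    isomorphism can be followed by the inverse of the other.\<close>
  have "quotient_iso (R_mvecs \<A> \<phi> 2) (R_ker \<A> \<phi> 2) (forms \<A> 0) (closed_forms \<A> 0) F0"
    "quotient_iso (cR_mvecs \<A> \<phi> 3) (cR_ker \<A> \<phi> 3) (forms \<A> 0) (closed_forms \<A> 0) G0"
    using F0 G0 unfolding class_iso_def R_forms_0 cR_forms_0 by blast+
  from quotient_iso_factor[OF this]
  obtain H where H: "quotient_iso (R_mvecs \<A> \<phi> 2) (R_ker \<A> \<phi> 2) (cR_mvecs \<A> \<phi> 3) (cR_ker \<A> \<phi> 3) H"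
    "\<forall>C\<in>qR_mvecs \<A> \<phi> 2. G0 (H C) = F0 C" unfolding qR_mvecs_def by blast
  show ?thesis
  proof (intro conjI, goal_cases)
    case 1
    show ?case by (rule R_ker_1)
  next
    case 2
    show ?case by (simp add: cR_ker_eq_0)
  next
    case 3
    \<comment> \<open>Both quotients consist of cosets of the same subspace, so the inclusion of
      classes is the inclusion of forms.\<close>
    show ?case unfolding qR_forms_def qcR_forms_def quotient_space_def cR_forms_1 R_forms_def by blast
  next
    case 4
    show ?case unfolding qcR_forms_def cR_forms_1 ..
  next
    case 5
    have "\<forall>U\<in>mvecs \<A> 2. field_contract 2 U \<psi> = ext_deriv \<A> \<alpha> \<longleftrightarrow> U = \<iota> X"
      if "X \<in> R_mvecs \<A> \<phi> 1" "field_contract 1 X \<phi> = ext_deriv \<A> \<alpha>" for X \<alpha>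
      using \<iota>(3) that by metis
    then show ?case
      using F1 G1 \<iota>(1,2) GF sub unfolding class_iso_def
      by (intro exI[of _ F1] exI[of _ G1] exI[of _ \<iota>]) blast
  next
    case 6
    show ?case unfolding qR_forms_def qcR_forms_def R_forms_0 cR_forms_0 ..
  next
    case 7
    show ?case unfolding qcR_forms_def cR_forms_0 forms_0[symmetric] closed_forms_0 ..
  next
    case 8
    show ?case
      using F0 G0 H sub form0_forms unfolding class_iso_def
      by (intro exI[of _ F0] exI[of _ G0] exI[of _ H]) blast
  next
    case 9
    show ?case using cR_ker_eq_0[of 1] by blast
  next
    case 10
    show ?case using F2 sub unfolding class_iso_def by (intro exI[of _ F2]) blast
  qed
qed

end
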